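(* There exist universal constants $c_0,c_1,c_2>0$ such that the following holds. Consider the normalized preconditioned spherical harmonics $\tilde Z_\ell^k$, $|k|\le\ell$, $\ell\ge 0$, and the associated orthogonalization probability measure $\nu$ (proportional to $|\tan(\theta)|^{1/3}\,d\theta\,d\varphi$). Let $s\ge1$, fix weights $\omega_{\ell,k}=C\max(1,\ell)^{1/6}$ and the index set $\Lambda_0=\{(\ell,k):|k|\le\ell\le s^3\}$ of size $N$ (of order $s^6$), and fix a number of samples $$m\ge c_0\,s\log^4(s).$$ Consider a fixed function $f(\varphi,\theta)=\sum_{\ell,k}x_{\ell,k}\tilde Z_\ell^k(\varphi,\theta)$ with $|\!|\!|f|\!|\!|_{\omega,1}<\infty$ and let $\eta=|\!|\!|f-f_{\Lambda_0}|\!|\!|_{\omega,1}$. Draw $(\varphi_j,\theta_j)$, $j=1,\dots,m$, i.i.d. from $\nu$, and consider sample values $y_j=f(\varphi_j,\theta_j)$, $j=1,\dots,m$. Then with probability exceeding $1-N^{-\log^3(s)}$, the function $f^\sharp=\sum_{(\ell,k)\in\Lambda_0}x_{\ell,k}^\sharp\tilde Z_\ell^k$ formed from the solution $x^\sharp$ of the weighted $\ell_1$ minimization program $$\min_{(u_{\ell,k})}\sum_{(\ell,k)\in\Lambda_0}\omega_{\ell,k}|u_{\ell,k}|\quad\text{subject to}\quad\sum_{j=1}^m\Big|\sum_{(\ell,k)\in\Lambda_0}u_{\ell,k}\tilde Z_\ell^k(\varphi_j,\theta_j)-y_j\Big|^2\le\frac{m\eta^2}{s}$$ satisfies $$\|f-f^\sharp\|_\infty\le|\!|\!|f-f^\sharp|\!|\!|_{\omega,1}\le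 c_1\,\sigma_s(f)_{\omega,1},\qquad\|f-f^\sharp\|_{L_2}\le c_2\,\sigma_s(f)_{\omega,1}/\sqrt s .$$
   Context: Spherical coordinates $(\varphi,\theta)\in[0,2\pi)\times[0,\pi)$ on $S^2$. The spherical harmonics $Y_\ell^k$ ($\ell\ge0$, $|k|\le\ell$ integers) satisfy $\int_0^{2\pi}\int_0^\pi Y_\ell^k\overline{Y_{\ell'}^{k'}}\sin\theta\,d\theta\,d\varphi=\delta_{\ell\ell',kk'}$. Let $\kappa=\int_0^{2\pi}\int_0^\pi|\tan\theta|^{1/3}\,d\theta\,d\varphi$, $d\nu=\kappa^{-1}|\tan\theta|^{1/3}\,d\theta\,d\varphi$, and $\tilde Z_\ell^k(\varphi,\theta)=\kappa^{1/2}\,(\sin^2\theta\,|\cos\theta|)^{1/6}\,Y_\ell^k(\varphi,\theta)$, which is an orthonormal system in $L_2(\nu)$. $C\ge1$ denotes a fixed universal constant for which $\|\tilde Z_\ell^k\|_\infty\le C\max(1,\ell)^{1/6}$ for all $\ell,k$ (such a constant is known to exist). $\|\cdot\|_\infty$ is the sup norm and $\|\cdot\|_{L_2}$ the norm of $L_2(\nu)$. For coefficient families $x=(x_{\ell,k})$: $\|x\|_{\omega,1}=\sum\omega_{\ell,k}|x_{\ell,k}|$, $\|x\|_{\omega,0}=\sum_{x_{\ell,k}\ne0}\omega_{\ell,k}^2$, $\sigma_s(x)_{\omega,1}=\inf\{\|x-z\|_{\omega,1}:\|z\|_{\omega,0}\le s\}$. For $f=\sum x_{\ell,k}\tilde Z_\ell^k$: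 $|\!|\!|f|\!|\!|_{\omega,1}=\|x\|_{\omega,1}$, $\sigma_s(f)_{\omega,1}=\sigma_s(x)_{\omega,1}$, and $f_{\Lambda_0}=\sum_{(\ell,k)\in\Lambda_0}x_{\ell,k}\tilde Z_\ell^k$. *)

theory Defs
  imports "HOL-Probability.Probability"
begin

definition assoc_legendre :: "nat \<Rightarrow> nat \<Rightarrow> real \<Rightarrow> real" where
  "assoc_legendre l m t =
     (-1) ^ m / (2 ^ l * fact l) * sqrt (1 - t\<^sup>2) ^ m
       * poly ((pderiv ^^ (l + m)) ([:-1, 0, 1:] ^ l)) t"

text \<open>
  Points are pairs (phi, theta): azimuth first, polar angle second. The phase convention is
  Condon-Shortley, so that for k < 0 the harmonic of order k is (-1)^k times the complex conjugate
  of the one of order -k. Only indices with |k| \<le> l are meaningful.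
\<close>

definition sph_harm :: "nat \<times> int \<Rightarrow> real \<times> real \<Rightarrow> complex" where
  "sph_harm = (\<lambda>(l, k) (\<phi>, \<theta>).
     (let a = nat \<bar>k\<bar> in
       of_real ((if k < 0 then (-1) ^ a else 1)
         * sqrt ((2 * real l + 1) / (4 * pi) * (fact (l - a) / fact (l + a)))
         * assoc_legendre l a (cos \<theta>))
       * cis (of_int k * \<phi>)))"

definition sph_dom :: "(real \<times> real) set" where
  "sph_dom = {0..<2 * pi} \<times> {0..<pi}"

definition kappa :: real where
  "kappa = (LBINT \<phi>=0..2 * pi. (LBINT \<theta>=0..pi. \<bar>tan \<theta>\<bar> powr (1/3)))"

definition nu :: "(real \<times> real) measure" where
  "nu = density (restrict_space lborel sph_dom)
          (\<lambda>(\<phi>, \<theta>). ennreal (\<bar>tan \<theta>\<bar> powr (1/3) / kappa))"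

definition Ztilde :: "nat \<times> int \<Rightarrow> real \<times> real \<Rightarrow> complex" where
  "Ztilde i = (\<lambda>(\<phi>, \<theta>).
     of_real (sqrt kappa * ((sin \<theta>)\<^sup>2 * \<bar>cos \<theta>\<bar>) powr (1/6)) * sph_harm i (\<phi>, \<theta>))"

text \<open>
  All norms take values in the extended nonnegative reals, so that divergent sums and integrals
  give infinity rather than the default value 0 of the real-valued operators. Coefficient families
  are total functions on pairs (l, k); only their values on the index set below matter.
\<close>

definition idx :: "(nat \<times> int) set" where
  "idx = {(l, k). \<bar>k\<bar> \<le> int l}"

definition sup_norm :: "(real \<times> real \<Rightarrow> complex) \<Rightarrow> ennreal" where
  "sup_norm g = (SUP p\<in>sph_dom. ennreal (cmod (g p)))"

definition L2_norm :: "(real \<times> real \<Rightarrow> complex) \<Rightarrow> ennreal" where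
  "L2_norm g = (let I = (\<integral>\<^sup>+ p. ennreal ((cmod (g p))\<^sup>2) \<partial>nu) in
                  if I = \<infinity> then \<infinity> else ennreal (sqrt (enn2real I)))"

definition wl1_norm :: "(nat \<times> int \<Rightarrow> real) \<Rightarrow> (nat \<times> int \<Rightarrow> complex) \<Rightarrow> ennreal" where
  "wl1_norm w x = (\<Sum>\<^sub>\<infinity>i\<in>idx. ennreal (w i * cmod (x i)))"

definition wl0_norm :: "(nat \<times> int \<Rightarrow> real) \<Rightarrow> (nat \<times> int \<Rightarrow> complex) \<Rightarrow> ennreal" where
  "wl0_norm w x = (\<Sum>\<^sub>\<infinity>i\<in>{i\<in>idx. x i \<noteq> 0}. ennreal ((w i)\<^sup>2))"

definition best_approx ::
  "(nat \<times> int \<Rightarrow> real) \<Rightarrow> real \<Rightarrow> (nat \<times> int \<Rightarrow> complex) \<Rightarrow> ennreal" where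
  "best_approx w s x = (INF z\<in>{z. wl0_norm w z \<le> ennreal s}. wl1_norm w (\<lambda>i. x i - z i))"

definition weight :: "real \<Rightarrow> nat \<times> int \<Rightarrow> real" where
  "weight C = (\<lambda>(l, k). C * max 1 (real l) powr (1/6))"

definition Lambda0 :: "real \<Rightarrow> (nat \<times> int) set" where
  "Lambda0 s = {(l, k). \<bar>k\<bar> \<le> int l \<and> real l \<le> s ^ 3}"

definition expansion :: "(nat \<times> int \<Rightarrow> complex) \<Rightarrow> real \<times> real \<Rightarrow> complex" where
  "expansion x p = (\<Sum>\<^sub>\<infinity>i\<in>idx. x i * Ztilde i p)"

definition partial_expansion ::
  "(nat \<times> int) set \<Rightarrow> (nat \<times> int \<Rightarrow> complex) \<Rightarrow> real \<times> real \<Rightarrow> complex" where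
  "partial_expansion L u p = (\<Sum>i\<in>L. u i * Ztilde i p)"

definition trunc :: "(nat \<times> int) set \<Rightarrow> (nat \<times> int \<Rightarrow> complex) \<Rightarrow> nat \<times> int \<Rightarrow> complex" where
  "trunc L x = (\<lambda>i. if i \<in> L then x i else 0)"

text \<open>
  Feasible points and solutions of the weighted minimization program for the sample points
  t 1, ..., t m and sample values y 1, ..., y m. A family indexed by \<open>Lambda0 s\<close> is represented by
  its extension by zero.
\<close>

definition feasible ::
  "real \<Rightarrow> nat \<Rightarrow> ennreal \<Rightarrow> (nat \<Rightarrow> real \<times> real) \<Rightarrow> (nat \<Rightarrow> complex) \<Rightarrow> (nat \<times> int \<Rightarrow> complex) \<Rightarrow> bool"
  where
  "feasible s m \<eta> t y u \<longleftrightarrow>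
     (\<forall>i. i \<notin> Lambda0 s \<longrightarrow> u i = 0) \<and>
     ennreal (\<Sum>j=1..m. (cmod (partial_expansion (Lambda0 s) u (t j) - y j))\<^sup>2)
       \<le> of_nat m * \<eta>\<^sup>2 / ennreal s"

definition is_solution ::
  "(nat \<times> int \<Rightarrow> real) \<Rightarrow> real \<Rightarrow> nat \<Rightarrow> ennreal \<Rightarrow> (nat \<Rightarrow> real \<times> real) \<Rightarrow> (nat \<Rightarrow> complex)
     \<Rightarrow> (nat \<times> int \<Rightarrow> complex) \<Rightarrow> bool" where
  "is_solution w s m \<eta> t y u \<longleftrightarrow>
     is_arg_min (\<lambda>u. \<Sum>i\<in>Lambda0 s. w i * cmod (u i)) (feasible s m \<eta> t y) u"

end

(* The weighted l1 minimizer is controlled by a one-sided restricted isometry: every coefficient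
   family v supported on Lambda0 satisfies |v|_2^2 <= const * (empirical L2 norm)^2 + |v|_{w,1}^2/(16 s).
   After division by its weighted l1 norm, f_v lies in the convex hull of 4N functions bounded by 1, so
   it suffices to bound E|g|^2 by the empirical mean uniformly over such a hull. Splitting |g|^2 into
   dyadic level sets, Maurey's empirical method replaces g on the level 2^(-i) by an average of
   O(4^i log s) hull vertices, up to a set that is small for the law nu and for the sample at once, and
   multiplicative lower Chernoff bounds plus a union bound handle the averages. The small levels carry
   the weight 4^(-i) needed to afford the failure probability exp(-O(log^4 s)) on each of them.

   The true coefficients are feasible with the required probability because the tail f - f_Lambda0 has
   sup norm at most eta but mean square at most eta^2/(C^2 s), with C > 1 forced by the hypothesis.
   For s < C^2 the only s-sparse family is 0, so no isometry is needed there.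

   Orthonormality of the harmonics reduces to that of the associated Legendre functions, obtained
   by integrating Rodrigues' formula by parts. *)

theory Submission
  imports Defs
begin

section \<open>Associated Legendre functions\<close>

text \<open>The empirical norm has to be bounded from above for one function only, the tail of the
  fixed \<open>f\<close>, and a single Chernoff bound does it. Its exponent is (m/s) * (ln D - 1 +
  1/D) with D = C^2, positive exactly because C > 1; the factor m/s appears because every weight
  outside \<open>Lambda0 s\<close> is at least C * sqrt s. The averages over hull vertices cost a
  cubic polynomial in ln s. The fourth logarithm in the number of samples pays for the failure
  exponent ln^3 s * ln N. Hence the split at s = C^2. Above it ln s is at least ln C^2 > 0, and all
  constants are absorbed into a multiple of ln^4 s. Below it only the tail has to be controlled, and
  where ln s is small the allowed failure probability N^(-ln^3 s) is so close to 1 that a single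
  sample suffices. For this reason \<open>c0\<close> depends on \<open>C\<close>, while
  \<open>c1\<close> and \<open>c2\<close> are numbers.\<close>

definition legendre_base :: "real poly" where
  "legendre_base = [:-1, 0, 1:]"

lemma poly_legendre_base [simp]: "poly legendre_base t = t\<^sup>2 - 1"
  by (simp add: legendre_base_def power2_eq_square)

definition poly_integral :: "real poly \<Rightarrow> real" where
  "poly_integral p = integral {-1..1} (poly p)"

lemma integrable_poly: "poly (p :: real poly) integrable_on {a..b}"
  by (intro integrable_continuous_real continuous_intros)

lemma poly_integral_add: "poly_integral (p + q) = poly_integral p + poly_integral q"
  unfolding poly_integral_def poly_add
  by (rule Henstock_Kurzweil_Integration.integral_add) (rule integrable_poly)+

lemma poly_integral_smult: "poly_integral (smult c p) = c * poly_integral p"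
  unfolding poly_integral_def poly_smult by simp

lemma poly_integral_pderiv: "poly_integral (pderiv p) = poly p 1 - poly p (-1)"
proof -
  have "(poly (pderiv p) has_integral (poly p 1 - poly p (-1))) {-1..1}"
    by (rule fundamental_theorem_of_calculus)
       (auto simp: has_real_derivative_iff_has_vector_derivative[symmetric]
          intro: has_field_derivative_at_within poly_DERIV)
  then show ?thesis unfolding poly_integral_def by (rule integral_unique)
qed

text \<open>Divisibility by \<open>legendre_base\<close> makes the product vanish at both endpoints,
  so there is no boundary term.\<close>

lemma poly_integral_by_parts:
  assumes "legendre_base dvd p * q"
  shows "poly_integral (p * pderiv q) = - poly_integral (pderiv p * q)"
proof -
  from assms obtain k where k: "p * q = legendre_base * k" by (auto simp: dvd_def)
  have "poly (p * q) 1 = 0" "poly (p * q) (-1) = 0" unfolding k by simp_all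
  then have "poly_integral (pderiv (p * q)) = 0" by (simp only: poly_integral_pderiv)
  then show ?thesis by (simp add: pderiv_mult poly_integral_add mult.commute)
qed

text \<open>Each derivative lowers the multiplicity of a factor by at most one. This supplies the
  divisibility that removes boundary terms in repeated integration by parts.\<close>

lemma power_dvd_higher_pderiv:
  fixes w :: "real poly"
  assumes "w ^ n dvd p" "r \<le> n"
  shows "w ^ (n - r) dvd (pderiv ^^ r) p"
  using assms(2)
proof (induction r)
  case (Suc r)
  then have "w ^ Suc (n - Suc r) dvd (pderiv ^^ r) p" by (simp add: Suc_diff_Suc)
  then obtain h where h: "(pderiv ^^ r) p = w ^ Suc (n - Suc r) * h" by (auto simp: dvd_def)
  have "(pderiv ^^ Suc r) p = w ^ (n - Suc r) *
      (w * pderiv h + smult (of_nat (Suc (n - Suc r))) (pderiv w * h))"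
    by (simp only: funpow.simps o_apply h pderiv_mult pderiv_power_Suc)
       (simp add: algebra_simps)
  then show ?case by simp
qed (use assms in simp)

lemma degree_higher_pderiv: "degree ((pderiv ^^ r) (p :: real poly)) = degree p - r"
  by (induction r) (auto simp: degree_pderiv)

lemma coeff_higher_pderiv:
  "coeff ((pderiv ^^ r) (p :: real poly)) n = pochhammer (of_nat (Suc n)) r * coeff p (n + r)"
proof (induction r arbitrary: n)
  case (Suc r)
  show ?case by (simp add: coeff_pderiv Suc pochhammer_rec algebra_simps)
qed simp

lemma degree_legendre_base_power: "degree (legendre_base ^ l) = 2 * l"
  by (subst degree_power_eq) (auto simp: legendre_base_def)

lemma lead_coeff_legendre_base_power: "coeff (legendre_base ^ l) (2 * l) = 1"
proof -
  have "lead_coeff (legendre_base ^ l) = 1"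
    by (simp add: lead_coeff_power legendre_base_def)
  then show ?thesis by (simp add: degree_legendre_base_power)
qed

text \<open>With w = t^2 - 1 one has t w' = 2 (w + 1), so the derivative of t w^(l+1) is a
  combination of w^(l+1) and w^l. Its integral is 0 because w vanishes at both endpoints, which
  gives a recurrence in l.\<close>

lemma poly_integral_legendre_base_power:
  "poly_integral (legendre_base ^ l) = (-1) ^ l * 2 ^ (2 * l + 1) * (fact l)\<^sup>2 / fact (2 * l + 1)"
proof (induction l)
  case 0
  have "poly_integral (pderiv [:0, 1:]) = 2" by (simp only: poly_integral_pderiv) simp
  then show ?case by (simp add: pderiv_pCons one_pCons)
next
  case (Suc l)
  let ?w = legendre_base
  have "pderiv ([:0, 1:] * ?w ^ Suc l)
      = smult (2 * real l + 3) (?w ^ Suc l) + smult (2 * real (Suc l)) (?w ^ l)"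
  proof -
    have w: "[:0, 1:] * pderiv ?w = smult 2 (?w + 1)"
      by (simp add: legendre_base_def pderiv_pCons one_pCons)
    have "pderiv ([:0, 1:] * ?w ^ Suc l) = [:0, 1:] * pderiv (?w ^ Suc l) + ?w ^ Suc l * pderiv [:0, 1:]"
      by (rule pderiv_mult)
    also have "[:0, 1:] * pderiv (?w ^ Suc l) = smult (real (Suc l)) (?w ^ l * ([:0, 1:] * pderiv ?w))"
      unfolding pderiv_power_Suc by (simp add: mult_ac)
    also have "\<dots> = smult (2 * real (Suc l)) (?w ^ Suc l + ?w ^ l)"
      unfolding w by (simp add: algebra_simps smult_add_right)
    finally have 1: "pderiv ([:0, 1:] * ?w ^ Suc l) = smult (2 * real (Suc l)) (?w ^ Suc l + ?w ^ l) + ?w ^ Suc l"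
      by (simp add: pderiv_pCons one_pCons[symmetric])
    have 2: "smult (2 * real l + 3) (?w ^ Suc l) = smult (2 * real (Suc l)) (?w ^ Suc l) + smult 1 (?w ^ Suc l)"
      unfolding smult_add_left[symmetric] by (intro arg_cong2[where f = smult]) simp_all
    have "smult b (X + Y) + X = (smult b X + smult 1 X) + smult b Y" for b :: real and X Y
      by (simp add: smult_add_right)
    from this[of "2 * real (Suc l)" "?w ^ Suc l" "?w ^ l"] show ?thesis unfolding 1 2 .
  qed
  moreover have "poly_integral (pderiv ([:0, 1:] * ?w ^ Suc l)) = 0"
    by (simp add: poly_integral_pderiv)
  ultimately have "(2 * real l + 3) * poly_integral (?w ^ Suc l) = - (2 * real (Suc l) * poly_integral (?w ^ l))"
    by (simp only: poly_integral_add poly_integral_smult)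
  then have "poly_integral (?w ^ Suc l) = - (2 * real (Suc l) * poly_integral (?w ^ l)) / (2 * real l + 3)"
    by (simp add: field_simps)
  also have "\<dots> = (-1) ^ Suc l * 2 ^ (2 * Suc l + 1) * (fact (Suc l))\<^sup>2 / fact (2 * Suc l + 1)"
  proof -
    have f: "fact (2 * Suc l + 1) = (2 * real l + 3) * (2 * real (Suc l)) * fact (2 * l + 1)"
      by (simp add: algebra_simps)
    have g: "fact (Suc l) = real (Suc l) * fact l" by simp
    have "- (2 * a * (e * p * b\<^sup>2 / F)) / d = (- e) * (4 * p) * (a * b)\<^sup>2 / (d * (2 * a) * F)"
      if "a \<noteq> 0" "d \<noteq> 0" "F \<noteq> 0" for a b d e p F :: real
      using that by (simp add: field_simps power2_eq_square)
    from this[of "real (Suc l)" "2 * real l + 3" "fact (2 * l + 1)" "(-1) ^ l" "2 ^ (2 * l + 1)" "fact l"]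
    show ?thesis unfolding Suc f g by simp
  qed
  finally show ?case .
qed

text \<open>A product of two associated Legendre functions of order m contains two factors sqrt (1 -
  t^2)^m. Their product (1 - t^2)^m is put entirely on one side here, so that the integrand becomes
  polynomial and this side is divisible by w^m.\<close>

definition legendre_weighted :: "nat \<Rightarrow> nat \<Rightarrow> real poly" where
  "legendre_weighted l m = (- legendre_base) ^ m * (pderiv ^^ (l + m)) (legendre_base ^ l)"

text \<open>The boundary terms vanish for two different reasons: during the first m steps the left
  factor still has a zero from (1 - t^2)^m, and from then on fewer than l derivatives are left on
  w^l.\<close>

lemma poly_integral_legendre_parts:
  assumes "r \<le> l + m"
  shows "poly_integral (legendre_weighted l' m * (pderiv ^^ (l + m)) (legendre_base ^ l))
    = (-1) ^ r * poly_integral ((pderiv ^^ r) (legendre_weighted l' m) *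
        (pderiv ^^ (l + m - r)) (legendre_base ^ l))"
  using assms
proof (induction r)
  case (Suc r)
  let ?u = "legendre_weighted l' m" and ?w = "legendre_base"
  have split: "(pderiv ^^ (l + m - r)) (?w ^ l) = pderiv ((pderiv ^^ (l + m - Suc r)) (?w ^ l))"
    using Suc.prems by (metis Suc_diff_Suc Suc_le_eq funpow.simps(2) o_apply)
  have "?w dvd (pderiv ^^ r) ?u * (pderiv ^^ (l + m - Suc r)) (?w ^ l)"
  proof (cases "r < m")
    case True
    have "?w ^ m dvd ?u"
      unfolding legendre_weighted_def by (intro dvd_mult2 dvd_power_same) simp
    from power_dvd_higher_pderiv[OF this, of r] True
    have "?w ^ (m - r) dvd (pderiv ^^ r) ?u" by simp
    moreover have "?w dvd ?w ^ (m - r)" using True by (intro dvd_power) auto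
    ultimately show ?thesis by (meson dvd_mult2 dvd_trans)
  next
    case False
    have "?w ^ (l - (l + m - Suc r)) dvd (pderiv ^^ (l + m - Suc r)) (?w ^ l)"
      using False Suc.prems by (intro power_dvd_higher_pderiv) auto
    moreover have "?w dvd ?w ^ (l - (l + m - Suc r))"
      using False Suc.prems by (intro dvd_power) auto
    ultimately show ?thesis by (meson dvd_mult dvd_trans)
  qed
  from poly_integral_by_parts[OF this] Suc show ?case by (simp add: split)
qed simp

lemma degree_legendre_weighted:
  assumes "m \<le> l"
  shows "degree (legendre_weighted l m) = l + m"
proof -
  have "(pderiv ^^ (l + m)) (legendre_base ^ l) \<noteq> 0"
  proof
    assume *: "(pderiv ^^ (l + m)) (legendre_base ^ l) = 0"
    have "l - m + (l + m) = 2 * l" using assms by simp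
    then have "coeff ((pderiv ^^ (l + m)) (legendre_base ^ l)) (l - m) = pochhammer (of_nat (Suc (l - m))) (l + m)"
      by (simp only: coeff_higher_pderiv lead_coeff_legendre_base_power)
    moreover have "pochhammer (real (Suc (l - m))) (l + m) > 0" by (intro pochhammer_pos) simp
    ultimately show False using * by simp
  qed
  moreover have "(- legendre_base) ^ m \<noteq> 0" by (simp add: legendre_base_def)
  ultimately have "degree (legendre_weighted l m) = degree ((- legendre_base) ^ m) + (2 * l - (l + m))"
    unfolding legendre_weighted_def
    by (subst degree_mult_eq) (auto simp: degree_higher_pderiv degree_legendre_base_power)
  moreover have "degree ((- legendre_base) ^ m) = 2 * m"
    by (subst degree_power_eq) (auto simp: legendre_base_def)
  ultimately show ?thesis using assms by simp
qed

lemma lead_coeff_legendre_weighted: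
  assumes "m \<le> l"
  shows "coeff (legendre_weighted l m) (l + m) = (-1) ^ m * (fact (2 * l) / fact (l - m))"
proof -
  have "lead_coeff (legendre_weighted l m)
      = lead_coeff ((- legendre_base) ^ m) * lead_coeff ((pderiv ^^ (l + m)) (legendre_base ^ l))"
    unfolding legendre_weighted_def by (rule lead_coeff_mult)
  also have "lead_coeff ((- legendre_base) ^ m) = (-1) ^ m"
    by (simp add: lead_coeff_power legendre_base_def)
  also have "lead_coeff ((pderiv ^^ (l + m)) (legendre_base ^ l)) = pochhammer (of_nat (Suc (l - m))) (l + m)"
  proof -
    have "l - m + (l + m) = 2 * l" "2 * l - (l + m) = l - m" using assms by simp_all
    then show ?thesis
      by (simp only: degree_higher_pderiv degree_legendre_base_power coeff_higher_pderiv lead_coeff_legendre_base_power)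
  qed
  also have "pochhammer (real (Suc (l - m))) (l + m) = fact (2 * l) / fact (l - m)"
  proof -
    have "fact (l - m + (l + m)) = (fact (l - m) :: real) * pochhammer (1 + of_nat (l - m)) (l + m)"
      unfolding pochhammer_fact by (rule pochhammer_product')
    moreover have "l - m + (l + m) = 2 * l" using assms by simp
    ultimately have "fact (2 * l) = (fact (l - m) :: real) * pochhammer (real (Suc (l - m))) (l + m)"
      by (simp only: of_nat_Suc add.commute)
    then show ?thesis by simp
  qed
  finally show ?thesis using assms by (simp add: degree_legendre_weighted)
qed

text \<open>All l + m derivatives are moved to the left factor, whose degree l' + m does not exceed
  their number. What remains is a constant times the integral of w^l; the constant is 0 for l' < l
  and comes from the leading coefficient for l' = l.\<close>

lemma legendre_orthogonal_aux:
  assumes "m \<le> l" "m \<le> l'" "l' \<le> l"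
  shows "poly_integral (legendre_weighted l' m * (pderiv ^^ (l + m)) (legendre_base ^ l))
    = (if l = l' then fact (l + m) / fact (l - m) * 2 * (2 ^ l * fact l)\<^sup>2 / (2 * real l + 1) else 0)"
proof -
  let ?u = "legendre_weighted l' m"
  let ?D = "(pderiv ^^ (l + m)) ?u"
  have "degree ?D = 0"
    using assms by (simp add: degree_higher_pderiv degree_legendre_weighted)
  then have "?D = [:coeff ?D 0:]" by (metis degree_0_id)
  also have "coeff ?D 0 = fact (l + m) * coeff ?u (l + m)"
    by (simp add: coeff_higher_pderiv pochhammer_fact)
  finally have "?D * legendre_base ^ l = smult (fact (l + m) * coeff ?u (l + m)) (legendre_base ^ l)"
    by simp
  then have I: "poly_integral (?u * (pderiv ^^ (l + m)) (legendre_base ^ l))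
      = (-1) ^ (l + m) * (fact (l + m) * coeff ?u (l + m) * poly_integral (legendre_base ^ l))"
    using poly_integral_legendre_parts[of "l + m" l m l'] by (simp add: poly_integral_smult)
  show ?thesis
  proof (cases "l = l'")
    case False
    then have "coeff ?u (l + m) = 0"
      using assms by (intro coeff_eq_0) (simp add: degree_legendre_weighted)
    then show ?thesis using False I by simp
  next
    case True
    have f: "fact (2 * l + 1) = (2 * real l + 1) * fact (2 * l)" by simp
    have s: "(-1) ^ (l + m) * ((-1) ^ m * (-1) ^ l) = (1::real)"
      by (simp add: power_add flip: power_mult_distrib) (simp add: mult_ac flip: power_mult_distrib)
    have "(-1) ^ (l + m) * (fact (l + m) * coeff ?u (l + m) * poly_integral (legendre_base ^ l))
       = ((-1) ^ (l + m) * ((-1) ^ m * (-1) ^ l)) *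
         (fact (l + m) / fact (l - m) * 2 * (2 ^ l * fact l)\<^sup>2 / (2 * real l + 1))"
      using assms
      by (simp only: True[symmetric] lead_coeff_legendre_weighted poly_integral_legendre_base_power f)
         (simp add: power2_eq_square power_add power_mult_distrib power_mult mult_ac del: fact_Suc)
    then show ?thesis using I True unfolding s by simp
  qed
qed

lemma integral_assoc_legendre_mult:
  assumes "m \<le> l" "m \<le> l'"
  shows "integral {-1..1} (\<lambda>t. assoc_legendre l m t * assoc_legendre l' m t)
    = (if l = l' then 2 / (2 * real l + 1) * (fact (l + m) / fact (l - m)) else 0)"
  using assms
proof (induction l l' rule: linorder_wlog)
  case (sym l l')
  then show ?case by (simp add: mult.commute cong: if_cong)
next
  case (le l' l)
  let ?c = "1 / (2 ^ l' * fact l' * (2 ^ l * fact l)) :: real"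
  have "integral {-1..1} (\<lambda>t. assoc_legendre l' m t * assoc_legendre l m t)
    = integral {-1..1} (poly (smult ?c (legendre_weighted l' m * (pderiv ^^ (l + m)) (legendre_base ^ l))))"
  proof (rule Henstock_Kurzweil_Integration.integral_cong)
    fix t :: real assume t: "t \<in> {-1..1}"
    then have "0 \<le> 1 - t\<^sup>2" by (auto simp: abs_square_le_1 abs_le_iff)
    then have "sqrt (1 - t\<^sup>2) ^ m * sqrt (1 - t\<^sup>2) ^ m = (1 - t\<^sup>2) ^ m"
      by (simp flip: power_mult_distrib)
    moreover have "(-1::real) ^ m * (-1) ^ m = 1" by (simp flip: power_mult_distrib)
    ultimately show "assoc_legendre l' m t * assoc_legendre l m t
        = poly (smult ?c (legendre_weighted l' m * (pderiv ^^ (l + m)) (legendre_base ^ l))) t"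
      unfolding assoc_legendre_def legendre_weighted_def legendre_base_def[symmetric]
      by (simp add: field_simps)
  qed
  also have "\<dots> = ?c * poly_integral (legendre_weighted l' m * (pderiv ^^ (l + m)) (legendre_base ^ l))"
    by (simp only: poly_integral_smult flip: poly_integral_def)
  also have "\<dots> = (if l' = l then 2 / (2 * real l' + 1) * (fact (l' + m) / fact (l' - m)) else 0)"
    using le by (subst legendre_orthogonal_aux) (auto simp: field_simps power2_eq_square)
  finally show ?case .
qed


section \<open>Orthonormality on the sphere\<close>

lemma borel_measurable_sin_cos_tan [measurable]:
  "(sin :: real \<Rightarrow> real) \<in> borel_measurable borel"
  "(cos :: real \<Rightarrow> real) \<in> borel_measurable borel"
  "(tan :: real \<Rightarrow> real) \<in> borel_measurable borel"
proof -
  show s: "(sin :: real \<Rightarrow> real) \<in> borel_measurable borel"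
    and c: "(cos :: real \<Rightarrow> real) \<in> borel_measurable borel"
    by (intro borel_measurable_continuous_onI continuous_intros)+
  show "(tan :: real \<Rightarrow> real) \<in> borel_measurable borel"
    unfolding tan_def[abs_def] using s c by measurable
qed

text \<open>The majorant is chosen for its elementary antiderivative. Where |tan| exceeds 1, sin is
  at least 1/2, so sin^(1/3) <= 1 <= 2 sin; elsewhere the summand 1 suffices.\<close>

lemma tan_powr_le:
  fixes \<theta> :: real
  assumes "0 \<le> \<theta>" "\<theta> \<le> pi"
  shows "\<bar>tan \<theta>\<bar> powr (1/3) \<le> 1 + 2 * (sin \<theta> * \<bar>cos \<theta>\<bar> powr (-1/3))"
proof (cases "\<bar>tan \<theta>\<bar> \<le> 1")
  case True
  have "\<bar>tan \<theta>\<bar> powr (1/3) \<le> 1 powr (1/3)" using True by (intro powr_mono2) auto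
  also have "\<dots> \<le> 1 + 2 * (sin \<theta> * \<bar>cos \<theta>\<bar> powr (-1/3))"
    using sin_ge_zero assms by simp
  finally show ?thesis .
next
  case False
  have s: "0 \<le> sin \<theta>" using sin_ge_zero assms by simp
  have c: "cos \<theta> \<noteq> 0" using False by (auto simp: tan_def)
  have tan: "\<bar>tan \<theta>\<bar> = sin \<theta> / \<bar>cos \<theta>\<bar>"
    unfolding tan_def by (simp only: abs_divide abs_of_nonneg[OF s])
  have "\<bar>cos \<theta>\<bar> < sin \<theta>" using False c by (simp add: tan divide_le_eq)
  then have "(cos \<theta>)\<^sup>2 < (sin \<theta>)\<^sup>2" by (metis abs_ge_zero power2_abs power_strict_mono zero_less_numeral)
  then have s2: "1/2 < (sin \<theta>)\<^sup>2" using sin_cos_squared_add[of \<theta>] by linarith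
  have sp: "1/2 \<le> sin \<theta>"
  proof (rule ccontr)
    assume "\<not> ?thesis"
    then have "(sin \<theta>)\<^sup>2 \<le> (1/2)\<^sup>2" using s by (intro power_mono) auto
    then show False using s2 by (simp add: power2_eq_square)
  qed
  have "x powr (-1/3) = 1 / x powr (1/3)" for x :: real
    using powr_minus_divide[of x "1/3"] by simp
  then have "\<bar>tan \<theta>\<bar> powr (1/3) = sin \<theta> powr (1/3) * \<bar>cos \<theta>\<bar> powr (-1/3)"
    using s by (simp add: tan powr_divide)
  also have "sin \<theta> powr (1/3) \<le> 1 powr (1/3)" using s by (intro powr_mono2) auto
  also have "1 powr (1/3) \<le> 2 * sin \<theta>" using sp by simp
  finally have "\<bar>tan \<theta>\<bar> powr (1/3) \<le> 2 * sin \<theta> * \<bar>cos \<theta>\<bar> powr (-1/3)"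
    by (simp add: mult_right_mono)
  then show ?thesis by simp
qed

text \<open>Up to sign the antiderivative is (3/2) |cos|^(2/3). It is continuous at the singularity
  pi/2, but its sign changes there, so the interval is split at that point and differentiability is
  required only in the interiors.\<close>

lemma sin_cos_powr_integrable:
  "(\<lambda>\<theta>. sin \<theta> * \<bar>cos \<theta>\<bar> powr (-1/3)) integrable_on {0..pi}"
proof -
  define G where "G = (\<lambda>\<theta>::real. \<bar>cos \<theta>\<bar> powr (2/3))"
  have G: "continuous_on S G" for S
    unfolding G_def by (intro continuous_on_powr' continuous_intros) auto
  have 1: "((\<lambda>\<theta>. sin \<theta> * \<bar>cos \<theta>\<bar> powr (-1/3)) has_integral
      (-(3/2) * G (pi/2) - (-(3/2) * G 0))) {0..pi/2}"
  proof (rule fundamental_theorem_of_calculus_interior_strong[where S = "{}"])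
    fix x assume x: "x \<in> {0<..<pi/2} - {}"
    then have c: "0 < cos x" by (intro cos_gt_zero) auto
    have "((\<lambda>\<theta>. -(3/2) * cos \<theta> powr (2/3)) has_real_derivative sin x * \<bar>cos x\<bar> powr (-1/3)) (at x)"
      using c by (auto intro!: derivative_eq_intros simp: field_simps)
    moreover have "\<forall>\<^sub>F \<theta> in nhds x. -(3/2) * cos \<theta> powr (2/3) = -(3/2) * G \<theta>"
    proof -
      have "\<forall>\<^sub>F \<theta> in nhds x. \<theta> \<in> {0<..<pi/2}" using x by (intro eventually_nhds_in_open) auto
      then show ?thesis
      proof eventually_elim
        case (elim \<theta>)
        then have "0 < cos \<theta>" by (intro cos_gt_zero) auto
        then show ?case by (simp add: G_def)
      qed
    qed
    ultimately have "((\<lambda>\<theta>. -(3/2) * G \<theta>) has_real_derivative sin x * \<bar>cos x\<bar> powr (-1/3)) (at x)"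
      using DERIV_cong_ev[of x x "\<lambda>\<theta>. -(3/2) * cos \<theta> powr (2/3)" "\<lambda>\<theta>. -(3/2) * G \<theta>"] by blast
    then show "((\<lambda>\<theta>. -(3/2) * G \<theta>) has_vector_derivative sin x * \<bar>cos x\<bar> powr (-1/3)) (at x)"
      by (simp add: has_real_derivative_iff_has_vector_derivative)
  qed (auto intro!: continuous_intros G)
  have 2: "((\<lambda>\<theta>. sin \<theta> * \<bar>cos \<theta>\<bar> powr (-1/3)) has_integral
      ((3/2) * G pi - (3/2) * G (pi/2))) {pi/2..pi}"
  proof (rule fundamental_theorem_of_calculus_interior_strong[where S = "{}"])
    fix x assume x: "x \<in> {pi/2<..<pi} - {}"
    have neg: "cos \<theta> < 0" if "\<theta> \<in> {pi/2<..<pi}" for \<theta>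
    proof -
      have "0 < cos (pi - \<theta>)" using that by (intro cos_gt_zero) auto
      then show ?thesis by simp
    qed
    then have c: "cos x < 0" using x by auto
    have "((\<lambda>\<theta>. (3/2) * (- cos \<theta>) powr (2/3)) has_real_derivative sin x * \<bar>cos x\<bar> powr (-1/3)) (at x)"
      using c by (auto intro!: derivative_eq_intros simp: field_simps)
    moreover have "\<forall>\<^sub>F \<theta> in nhds x. (3/2) * (- cos \<theta>) powr (2/3) = (3/2) * G \<theta>"
    proof -
      have "\<forall>\<^sub>F \<theta> in nhds x. \<theta> \<in> {pi/2<..<pi}" using x by (intro eventually_nhds_in_open) auto
      then show ?thesis
      proof eventually_elim
        case (elim \<theta>)
        then show ?case using neg[of \<theta>] by (simp add: G_def)
      qed
    qed
    ultimately have "((\<lambda>\<theta>. (3/2) * G \<theta>) has_real_derivative sin x * \<bar>cos x\<bar> powr (-1/3)) (at x)"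
      using DERIV_cong_ev[of x x "\<lambda>\<theta>. (3/2) * (- cos \<theta>) powr (2/3)" "\<lambda>\<theta>. (3/2) * G \<theta>"] by blast
    then show "((\<lambda>\<theta>. (3/2) * G \<theta>) has_vector_derivative sin x * \<bar>cos x\<bar> powr (-1/3)) (at x)"
      by (simp add: has_real_derivative_iff_has_vector_derivative)
  qed (auto intro!: continuous_intros G)
  show ?thesis
    using has_integral_combine[OF _ _ 1 2] by (auto simp: integrable_on_def)
qed

lemma tan_powr_set_integrable:
  "set_integrable lborel {0..<pi} (\<lambda>\<theta>. \<bar>tan \<theta>\<bar> powr (1/3))"
proof -
  let ?D = "\<lambda>\<theta>. sin \<theta> * \<bar>cos \<theta>\<bar> powr (-1/3)"
  have "?D absolutely_integrable_on {0..pi}"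
    by (rule nonnegative_absolutely_integrable_1[OF sin_cos_powr_integrable]) (auto simp: sin_ge_zero)
  then have "integrable lborel (\<lambda>\<theta>. indicator {0..pi} \<theta> *\<^sub>R ?D \<theta>)"
    unfolding set_integrable_def by (subst (asm) integrable_completion) auto
  then have "integrable lborel (\<lambda>\<theta>. indicator {0..pi} \<theta> *\<^sub>R 1 + 2 * (indicator {0..pi} \<theta> *\<^sub>R ?D \<theta>))"
    by (intro Bochner_Integration.integrable_add integrable_mult_right) simp_all
  then show ?thesis
    unfolding set_integrable_def
    by (rule Bochner_Integration.integrable_bound)
       (use tan_powr_le in \<open>auto simp: indicator_def sin_ge_zero\<close>)
qed

definition tan_mass :: real where
  "tan_mass = (LINT \<theta>|lborel. indicator {0..<pi} \<theta> * \<bar>tan \<theta>\<bar> powr (1/3))"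

lemma kappa_eq: "kappa = 2 * pi * tan_mass"
proof -
  have "(LBINT \<theta>=ereal 0..ereal pi. \<bar>tan \<theta>\<bar> powr (1/3)) = tan_mass"
    by (subst interval_integral_Ico) (simp_all add: tan_mass_def set_lebesgue_integral_def)
  moreover have "2 * ereal pi = ereal (2 * pi)" by simp
  ultimately have "kappa = (LBINT \<phi>=ereal 0..ereal (2 * pi). tan_mass)"
    unfolding kappa_def by (simp only: zero_ereal_def)
  also have "\<dots> = tan_mass * (2 * pi - 0)" by (rule interval_integral_const)
  finally show ?thesis by (simp add: mult.commute)
qed

lemma nn_integral_tan:
  "(\<integral>\<^sup>+\<theta>. ennreal (indicator {0..<pi} \<theta> * \<bar>tan \<theta>\<bar> powr (1/3)) \<partial>lborel) = ennreal tan_mass"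
  unfolding tan_mass_def
  using tan_powr_set_integrable by (intro nn_integral_eq_integral) (auto simp: set_integrable_def)

lemma tan_mass_pos: "0 < tan_mass"
proof (rule ccontr)
  assume "\<not> ?thesis"
  then have "(\<integral>\<^sup>+\<theta>. ennreal (indicator {0..<pi} \<theta> * \<bar>tan \<theta>\<bar> powr (1/3)) \<partial>lborel) = 0"
    by (simp add: nn_integral_tan ennreal_neg)
  then have "AE \<theta> in lborel. indicator {0..<pi} \<theta> * \<bar>tan \<theta>\<bar> powr (1/3) = 0"
    by (subst (asm) nn_integral_0_iff_AE) simp_all
  moreover have "tan \<theta> \<noteq> 0" if "\<theta> \<in> {0<..<pi/2}" for \<theta> :: real
    using tan_gt_zero[of \<theta>] that by auto
  ultimately have "AE \<theta> in lborel. \<theta> \<notin> {0<..<pi/2}"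
    by (auto elim!: eventually_mono simp: indicator_def split: if_splits)
  then have "emeasure lborel {0<..<pi/2} = 0"
    by (subst (asm) AE_iff_measurable[where N = "{0<..<pi/2}"]) auto
  then show False by simp
qed

lemma kappa_pos: "0 < kappa"
  using tan_mass_pos by (simp add: kappa_eq)

section \<open>Integration against \<open>nu\<close> by Fubini\<close>

lemma sph_dom_sets [measurable]: "sph_dom \<in> sets borel"
proof -
  have "sph_dom \<in> sets (borel \<Otimes>\<^sub>M borel)" unfolding sph_dom_def by (intro pair_measureI) auto
  then show ?thesis unfolding borel_prod .
qed

lemma space_nu [simp]: "space nu = sph_dom"
  by (simp add: nu_def space_restrict_space)

lemma sets_nu: "sets nu = sets (restrict_space borel sph_dom)"
  unfolding nu_def sets_density by (rule sets_restrict_space_cong) simp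

lemma measurable_nu: "f \<in> borel_measurable borel \<Longrightarrow> f \<in> borel_measurable nu"
  unfolding measurable_cong_sets[OF sets_nu refl] by (rule measurable_restrict_space1)

definition nu_density :: "real \<times> real \<Rightarrow> real" where
  "nu_density = (\<lambda>(\<phi>, \<theta>). \<bar>tan \<theta>\<bar> powr (1/3) / kappa)"

lemma nu_eq: "nu = density (restrict_space lborel sph_dom) (\<lambda>p. ennreal (nu_density p))"
  by (simp add: nu_def nu_density_def case_prod_unfold)

lemma nu_density_measurable [measurable]: "nu_density \<in> borel_measurable borel"
proof -
  have "nu_density \<in> borel_measurable (borel \<Otimes>\<^sub>M borel)" unfolding nu_density_def by measurable
  then show ?thesis unfolding borel_prod .
qed

lemma nu_density_nonneg: "0 \<le> nu_density p"
  using kappa_pos by (auto simp: nu_density_def split: prod.split)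

lemma nu_integral_iff:
  fixes f :: "real \<times> real \<Rightarrow> 'b::{banach, second_countable_topology}"
  assumes f: "f \<in> borel_measurable borel"
  shows "integrable nu f \<longleftrightarrow> integrable lborel (\<lambda>p. (indicator sph_dom p * nu_density p) *\<^sub>R f p)"
    and "integral\<^sup>L nu f = (LINT p|lborel. (indicator sph_dom p * nu_density p) *\<^sub>R f p)"
proof -
  have f': "f \<in> borel_measurable (restrict_space lborel sph_dom)"
    and d': "nu_density \<in> borel_measurable (restrict_space lborel sph_dom)"
    using f by (simp_all add: measurable_restrict_space1)
  show "integrable nu f \<longleftrightarrow> integrable lborel (\<lambda>p. (indicator sph_dom p * nu_density p) *\<^sub>R f p)"
    unfolding nu_eq using f' d' nu_density_nonneg
    by (subst integrable_density) (auto simp: integrable_restrict_space)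
  show "integral\<^sup>L nu f = (LINT p|lborel. (indicator sph_dom p * nu_density p) *\<^sub>R f p)"
    unfolding nu_eq using f' d' nu_density_nonneg
    by (subst integral_density) (auto simp: integral_restrict_space)
qed

lemma lborel_integral_product:
  fixes u w :: "real \<Rightarrow> complex"
  assumes u: "integrable lborel u" and w: "integrable lborel w"
  shows "integrable lborel (\<lambda>p. u (fst p) * w (snd p))"
    and "(LINT p|lborel. u (fst p) * w (snd p)) = (LINT x|lborel. u x) * (LINT y|lborel. w y)"
proof -
  have [measurable]: "u \<in> borel_measurable borel" "w \<in> borel_measurable borel"
    using u w by (auto dest: borel_measurable_integrable)
  have int: "integrable (lborel \<Otimes>\<^sub>M lborel) (\<lambda>p. u (fst p) * w (snd p))"
  proof (rule lborel_pair.Fubini_integrable)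
    show "integrable lborel (\<lambda>x. LINT y|lborel. norm (u (fst (x, y)) * w (snd (x, y))))"
      using u by (simp add: norm_mult)
    show "AE x in lborel. integrable lborel (\<lambda>y. u (fst (x, y)) * w (snd (x, y)))"
      using w by simp
  qed measurable
  then show "integrable lborel (\<lambda>p. u (fst p) * w (snd p))" by (simp add: lborel_prod)
  show "(LINT p|lborel. u (fst p) * w (snd p)) = (LINT x|lborel. u x) * (LINT y|lborel. w y)"
    using lborel_pair.integral_fst'[OF int] by (simp add: lborel_prod)
qed

lemma nu_integral_product:
  fixes u w :: "real \<Rightarrow> complex"
  assumes [measurable]: "u \<in> borel_measurable borel" "w \<in> borel_measurable borel"
    and u: "integrable lborel (\<lambda>\<phi>. indicator {0..<2 * pi} \<phi> *\<^sub>R u \<phi>)"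
    and w: "integrable lborel (\<lambda>\<theta>. (indicator {0..<pi} \<theta> * (\<bar>tan \<theta>\<bar> powr (1/3) / kappa)) *\<^sub>R w \<theta>)"
  shows "integrable nu (\<lambda>p. u (fst p) * w (snd p))"
    and "(LINT p|nu. u (fst p) * w (snd p)) = (LINT \<phi>|lborel. indicator {0..<2 * pi} \<phi> *\<^sub>R u \<phi>) *
      (LINT \<theta>|lborel. (indicator {0..<pi} \<theta> * (\<bar>tan \<theta>\<bar> powr (1/3) / kappa)) *\<^sub>R w \<theta>)"
proof -
  have m: "(\<lambda>p. u (fst p) * w (snd p)) \<in> borel_measurable borel"
  proof -
    have "(\<lambda>p. u (fst p) * w (snd p)) \<in> borel_measurable (borel \<Otimes>\<^sub>M borel)" by measurable
    then show ?thesis unfolding borel_prod .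
  qed
  have eq: "(indicator sph_dom p * nu_density p) *\<^sub>R (u (fst p) * w (snd p)) =
      (indicator {0..<2 * pi} (fst p) *\<^sub>R u (fst p)) *
      ((indicator {0..<pi} (snd p) * (\<bar>tan (snd p)\<bar> powr (1/3) / kappa)) *\<^sub>R w (snd p))" for p
    by (cases p) (auto simp: sph_dom_def nu_density_def indicator_def)
  show "integrable nu (\<lambda>p. u (fst p) * w (snd p))"
    unfolding nu_integral_iff(1)[OF m] eq by (rule lborel_integral_product(1)[OF u w])
  show "(LINT p|nu. u (fst p) * w (snd p)) = (LINT \<phi>|lborel. indicator {0..<2 * pi} \<phi> *\<^sub>R u \<phi>) *
      (LINT \<theta>|lborel. (indicator {0..<pi} \<theta> * (\<bar>tan \<theta>\<bar> powr (1/3) / kappa)) *\<^sub>R w \<theta>)"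
    unfolding nu_integral_iff(2)[OF m] eq by (rule lborel_integral_product(2)[OF u w])
qed

section \<open>Orthogonality in azimuth and in polar angle\<close>

lemma cis_integral:
  "integrable lborel (\<lambda>\<phi>. indicator {0..<2 * pi} \<phi> *\<^sub>R cis (of_int k * \<phi>))"
  "(LINT \<phi>|lborel. indicator {0..<2 * pi} \<phi> *\<^sub>R cis (of_int k * \<phi>)) = (if k = 0 then 2 * of_real pi else 0)"
proof -
  have cont: "continuous_on S (\<lambda>\<phi>. cis (of_int k * \<phi>))" for S
    by (intro continuous_intros)
  have I: "set_integrable lborel {0..2 * pi} (\<lambda>\<phi>. cis (of_int k * \<phi>))"
    unfolding set_integrable_def by (rule borel_integrable_compact) (auto intro: cont)
  then have Ico: "set_integrable lborel {0..<2 * pi} (\<lambda>\<phi>. cis (of_int k * \<phi>))"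
    by (rule set_integrable_subset) auto
  then show "integrable lborel (\<lambda>\<phi>. indicator {0..<2 * pi} \<phi> *\<^sub>R cis (of_int k * \<phi>))"
    by (simp add: set_integrable_def)
  have "(LINT \<phi>:{0..<2 * pi}|lborel. cis (of_int k * \<phi>)) = (LINT \<phi>:{0..2 * pi}|lborel. cis (of_int k * \<phi>))"
    by (rule set_integral_discrete_difference[where X = "{2 * pi}"]) auto
  also have "\<dots> = integral {0..2 * pi} (\<lambda>\<phi>. cis (of_int k * \<phi>))"
    by (rule set_borel_integral_eq_integral(2)[OF I])
  also have "\<dots> = (if k = 0 then 2 * of_real pi else 0)"
  proof (cases "k = 0")
    case False
    have "((\<lambda>\<phi>. cis (of_int k * \<phi>)) has_integral
       (cis (of_int k * (2 * pi)) / (\<i> * of_int k) - cis (of_int k * 0) / (\<i> * of_int k))) {0..2 * pi}"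
    proof (rule fundamental_theorem_of_calculus)
      fix x :: real
      show "((\<lambda>\<phi>. cis (of_int k * \<phi>) / (\<i> * of_int k)) has_vector_derivative cis (of_int k * x)) (at x within {0..2 * pi})"
      proof -
        have "((\<lambda>\<phi>. (\<lambda>z. exp (\<i> * (of_int k * z)) / (\<i> * of_int k)) (complex_of_real \<phi>))
            has_vector_derivative exp (\<i> * (of_int k * of_real x))) (at x within {0..2 * pi})"
          by (rule has_vector_derivative_real_field)
             (use False in \<open>auto intro!: derivative_eq_intros simp: algebra_simps\<close>)
        then show ?thesis by (simp add: cis_conv_exp)
      qed
    qed auto
    moreover have "cis (of_int k * (2 * pi)) = 1"
      using cis_multiple_2pi[of "of_int k"] by (simp add: mult_ac)
    ultimately show ?thesis using False by (simp add: integral_unique)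
  qed (simp add: scaleR_conv_of_real)
  finally show "(LINT \<phi>|lborel. indicator {0..<2 * pi} \<phi> *\<^sub>R cis (of_int k * \<phi>)) = (if k = 0 then 2 * of_real pi else 0)"
    by (simp add: set_lebesgue_integral_def)
qed

lemma polar_integral:
  fixes f :: "real \<Rightarrow> real"
  assumes f: "continuous_on {-1..1} f"
  shows "integrable lborel (\<lambda>\<theta>. indicator {0..<pi} \<theta> * (sin \<theta> * f (cos \<theta>)))"
    and "(LINT \<theta>|lborel. indicator {0..<pi} \<theta> * (sin \<theta> * f (cos \<theta>))) = integral {-1..1} f"
proof -
  have cont: "continuous_on {0..pi} (\<lambda>\<theta>. sin \<theta> * f (cos \<theta>))"
    by (intro continuous_intros continuous_on_compose2[OF f]) auto
  then have I: "set_integrable lborel {0..pi} (\<lambda>\<theta>. sin \<theta> * f (cos \<theta>))"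
    unfolding set_integrable_def by (intro borel_integrable_compact) auto
  then have "set_integrable lborel {0..<pi} (\<lambda>\<theta>. sin \<theta> * f (cos \<theta>))"
    by (rule set_integrable_subset) auto
  then show "integrable lborel (\<lambda>\<theta>. indicator {0..<pi} \<theta> * (sin \<theta> * f (cos \<theta>)))"
    by (simp add: set_integrable_def)
  have "(LINT \<theta>:{0..<pi}|lborel. sin \<theta> * f (cos \<theta>)) = (LINT \<theta>:{0..pi}|lborel. sin \<theta> * f (cos \<theta>))"
    by (rule set_integral_discrete_difference[where X = "{pi}"]) auto
  also have "\<dots> = integral {0..pi} (\<lambda>\<theta>. sin \<theta> * f (cos \<theta>))"
    by (rule set_borel_integral_eq_integral(2)[OF I])
  also have "\<dots> = integral {-1..1} f"
  proof -
    \<comment> \<open>Since \<open>cos\<close> reverses orientation, the interval from cos 0 to cos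
      pi is empty and contributes 0; the whole value is the subtracted integral.\<close>
    have "((\<lambda>\<theta>. (- sin \<theta>) *\<^sub>R f (cos \<theta>)) has_integral
        (integral {cos 0..cos pi} f - integral {cos pi..cos 0} f)) {0..pi}"
      by (rule has_integral_substitution_general[where s = "{}" and c = "-1" and d = 1])
         (auto intro!: derivative_eq_intros continuous_intros f)
    then have "((\<lambda>\<theta>. - (sin \<theta> * f (cos \<theta>))) has_integral (- integral {-1..1} f)) {0..pi}" by simp
    then have "((\<lambda>\<theta>. sin \<theta> * f (cos \<theta>)) has_integral integral {-1..1} f) {0..pi}"
      by (simp only: has_integral_neg_iff minus_minus)
    then show ?thesis by (rule integral_unique)
  qed
  finally show "(LINT \<theta>|lborel. indicator {0..<pi} \<theta> * (sin \<theta> * f (cos \<theta>))) = integral {-1..1} f"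
    by (simp add: set_lebesgue_integral_def)
qed

text \<open>The real polar factor of \<open>sph_harm\<close> as a function of the cosine, so that
  complex conjugation affects the azimuthal factor only.\<close>

definition sph_amp :: "nat \<times> int \<Rightarrow> real \<Rightarrow> real" where
  "sph_amp = (\<lambda>(l, k) t. (if k < 0 then (-1) ^ nat \<bar>k\<bar> else 1)
     * sqrt ((2 * real l + 1) / (4 * pi) * (fact (l - nat \<bar>k\<bar>) / fact (l + nat \<bar>k\<bar>)))
     * assoc_legendre l (nat \<bar>k\<bar>) t)"

lemma continuous_on_assoc_legendre [continuous_intros]: "continuous_on S (assoc_legendre l m)"
  unfolding assoc_legendre_def[abs_def] by (intro continuous_intros)

lemma continuous_on_sph_amp [continuous_intros]: "continuous_on S (sph_amp i)"
  unfolding sph_amp_def by (cases i) (auto intro!: continuous_intros)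

lemma Ztilde_eq:
  "Ztilde i p = of_real (sqrt kappa * ((sin (snd p))\<^sup>2 * \<bar>cos (snd p)\<bar>) powr (1/6) * sph_amp i (cos (snd p)))
     * cis (of_int (snd i) * fst p)"
  by (cases i; cases p) (simp add: Ztilde_def sph_harm_def sph_amp_def Let_def mult_ac)

lemma Ztilde_measurable [measurable]: "Ztilde i \<in> borel_measurable borel"
proof -
  have [measurable]: "sph_amp i \<in> borel_measurable borel"
    by (intro borel_measurable_continuous_onI continuous_intros)
  have [measurable]: "cis \<in> borel_measurable borel"
    by (intro borel_measurable_continuous_onI continuous_intros)
  have "Ztilde i \<in> borel_measurable (borel \<Otimes>\<^sub>M borel)"
    unfolding Ztilde_eq[abs_def] by measurable
  then show ?thesis unfolding borel_prod .
qed

text \<open>Equal orders are enough, because different orders are already separated by the azimuthal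
  integral; that integral also supplies the missing factor 2 pi.\<close>

lemma sph_amp_orthogonal:
  assumes "(l, k) \<in> idx" "(l', k) \<in> idx"
  shows "integral {-1..1} (\<lambda>t. sph_amp (l, k) t * sph_amp (l', k) t) = (if l = l' then 1 / (2 * pi) else 0)"
proof -
  define a where "a = nat \<bar>k\<bar>"
  define c where "c = (\<lambda>l. (2 * real l + 1) / (4 * pi) * (fact (l - a) / fact (l + a)))"
  have a: "a \<le> l" "a \<le> l'" using assms by (auto simp: idx_def a_def)
  have sgn: "(if k < 0 then (-1) ^ a else (1::real)) * (if k < 0 then (-1) ^ a else 1) = 1"
    by (simp flip: power_mult_distrib)
  have "sph_amp (l, k) t * sph_amp (l', k) t =
     ((if k < 0 then (-1) ^ a else (1::real)) * (if k < 0 then (-1) ^ a else 1)) *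
     (sqrt (c l) * sqrt (c l')) * (assoc_legendre l a t * assoc_legendre l' a t)" for t
    by (simp add: sph_amp_def a_def c_def)
  then have "integral {-1..1} (\<lambda>t. sph_amp (l, k) t * sph_amp (l', k) t) = (sqrt (c l) * sqrt (c l')) *
     integral {-1..1} (\<lambda>t. assoc_legendre l a t * assoc_legendre l' a t)"
    unfolding sgn by simp
  also have "\<dots> = (if l = l' then 1 / (2 * pi) else 0)"
  proof (cases "l = l'")
    case True
    have "0 \<le> c l" by (simp add: c_def)
    then have "sqrt (c l) * sqrt (c l) * (2 / (2 * real l + 1) * (fact (l + a) / fact (l - a))) = 1 / (2 * pi)"
      by (simp add: c_def)
    then show ?thesis using True a by (simp add: integral_assoc_legendre_mult)
  qed (use a in \<open>simp add: integral_assoc_legendre_mult\<close>)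
  finally show ?thesis .
qed

text \<open>This is the purpose of the preconditioner: its square times the density of
  \<open>nu\<close> is, up to constants, the surface element of the sphere, because sin^2 |cos|
  |tan| = sin^3.\<close>

lemma sin_cos_tan_powr:
  fixes \<theta> :: real
  assumes "0 \<le> sin \<theta>" "cos \<theta> \<noteq> 0"
  shows "((sin \<theta>)\<^sup>2 * \<bar>cos \<theta>\<bar>) powr (1/3) * \<bar>tan \<theta>\<bar> powr (1/3) = sin \<theta>"
proof -
  have tan: "\<bar>tan \<theta>\<bar> = sin \<theta> / \<bar>cos \<theta>\<bar>"
    unfolding tan_def by (simp only: abs_divide abs_of_nonneg[OF assms(1)])
  have "((sin \<theta>)\<^sup>2 * \<bar>cos \<theta>\<bar>) powr (1/3) * \<bar>tan \<theta>\<bar> powr (1/3) = (sin \<theta> ^ 3) powr (1/3)"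
    using assms by (simp add: tan power2_eq_square power3_eq_cube mult.assoc flip: powr_mult)
  also have "\<dots> = sin \<theta>"
  proof (cases "sin \<theta> = 0")
    case False
    then have "(sin \<theta> ^ 3) powr (1/3) = (sin \<theta> powr 3) powr (1/3)"
      using assms powr_realpow[of "sin \<theta>" 3] by simp
    then show ?thesis using assms by (simp only: powr_powr) simp
  qed simp
  finally show ?thesis .
qed

lemma Ztilde_orthonormal:
  assumes "i \<in> idx" "j \<in> idx"
  shows "integrable nu (\<lambda>p. Ztilde i p * cnj (Ztilde j p))"
    and "(LINT p|nu. Ztilde i p * cnj (Ztilde j p)) = of_bool (i = j)"
proof -
  obtain l k l' k' where ij: "i = (l, k)" "j = (l', k')" by (cases i; cases j)
  let ?A = "\<lambda>t. sph_amp i t * sph_amp j t"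
  define u where "u = (\<lambda>\<phi>. cis (of_int (k - k') * \<phi>))"
  define w where "w = (\<lambda>\<theta>. complex_of_real (kappa * ((sin \<theta>)\<^sup>2 * \<bar>cos \<theta>\<bar>) powr (1/3) * ?A (cos \<theta>)))"
  have [measurable]: "sph_amp i \<in> borel_measurable borel" for i
    by (intro borel_measurable_continuous_onI continuous_intros)
  have [measurable]: "cis \<in> borel_measurable borel"
    by (intro borel_measurable_continuous_onI continuous_intros)
  have um[measurable]: "u \<in> borel_measurable borel" unfolding u_def by measurable
  have wm[measurable]: "w \<in> borel_measurable borel" unfolding w_def by measurable
  have cont: "continuous_on S ?A" for S by (intro continuous_intros)
  have eq: "Ztilde i p * cnj (Ztilde j p) = u (fst p) * w (snd p)" for p
  proof -
    define c where "c = ((sin (snd p))\<^sup>2 * \<bar>cos (snd p)\<bar>) powr (1/6)"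
    have c2: "c * c = ((sin (snd p))\<^sup>2 * \<bar>cos (snd p)\<bar>) powr (1/3)"
      unfolding c_def by (simp flip: powr_add)
    define r where "r = sqrt kappa"
    have k2: "r * r = kappa" using kappa_pos by (simp add: r_def)
    have cs: "cis (of_int k * fst p) * cnj (cis (of_int k' * fst p)) = u (fst p)"
      by (simp add: u_def cis_cnj cis_mult algebra_simps)
    have "Ztilde i p * cnj (Ztilde j p) = of_real ((r * r) * (c * c) * ?A (cos (snd p)))
        * (cis (of_int k * fst p) * cnj (cis (of_int k' * fst p)))"
      by (simp add: Ztilde_eq ij flip: c_def r_def)
    then show ?thesis unfolding c2 k2 cs by (simp add: w_def)
  qed
  \<comment> \<open>The equator is excluded: there the division by cos makes \<open>tan\<close>
    equal to 0, and the identity can fail.\<close>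
  have ae: "AE \<theta> in lborel. (indicator {0..<pi} \<theta> * (\<bar>tan \<theta>\<bar> powr (1/3) / kappa)) *\<^sub>R w \<theta>
      = complex_of_real (indicator {0..<pi} \<theta> * (sin \<theta> * ?A (cos \<theta>)))"
    using AE_lborel_singleton[of "pi / 2"]
  proof eventually_elim
    case (elim \<theta>)
    show ?case
    proof (cases "\<theta> \<in> {0..<pi}")
      case True
      have "cos \<theta> \<noteq> 0"
      proof
        assume "cos \<theta> = 0"
        then have "\<theta> = pi / 2"
          using True cos_inj_pi[of \<theta> "pi/2"] by auto
        then show False using elim by simp
      qed
      moreover have "0 \<le> sin \<theta>" using True by (auto intro: sin_ge_zero)
      ultimately have "\<bar>tan \<theta>\<bar> powr (1/3) * ((sin \<theta>)\<^sup>2 * \<bar>cos \<theta>\<bar>) powr (1/3) = sin \<theta>"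
        by (subst mult.commute) (simp add: sin_cos_tan_powr)
      then have "\<bar>tan \<theta>\<bar> powr (1/3) / kappa * (kappa * ((sin \<theta>)\<^sup>2 * \<bar>cos \<theta>\<bar>) powr (1/3) * ?A (cos \<theta>))
          = sin \<theta> * ?A (cos \<theta>)"
        using kappa_pos by (simp add: field_simps)
      then have "complex_of_real (\<bar>tan \<theta>\<bar> powr (1/3) / kappa * (kappa * ((sin \<theta>)\<^sup>2 * \<bar>cos \<theta>\<bar>) powr (1/3) * ?A (cos \<theta>)))
          = of_real (sin \<theta> * ?A (cos \<theta>))" by (rule arg_cong)
      then show ?thesis using True by (simp only: w_def scaleR_conv_of_real indicator_simps mult_1_left of_real_mult)
    qed simp
  qed
  have rI: "integrable lborel (\<lambda>\<theta>. complex_of_real (indicator {0..<pi} \<theta> * (sin \<theta> * ?A (cos \<theta>))))"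
    using polar_integral(1)[OF cont] by (rule integrable_of_real)
  have wI: "integrable lborel (\<lambda>\<theta>. (indicator {0..<pi} \<theta> * (\<bar>tan \<theta>\<bar> powr (1/3) / kappa)) *\<^sub>R w \<theta>)"
    by (rule integrable_cong_AE_imp[OF rI]) (use ae in \<open>auto elim: eventually_mono\<close>)
  have "(LINT \<theta>|lborel. (indicator {0..<pi} \<theta> * (\<bar>tan \<theta>\<bar> powr (1/3) / kappa)) *\<^sub>R w \<theta>)
      = (LINT \<theta>|lborel. complex_of_real (indicator {0..<pi} \<theta> * (sin \<theta> * ?A (cos \<theta>))))"
    by (rule integral_cong_AE) (use ae in auto)
  also have "\<dots> = of_real (integral {-1..1} ?A)"
    unfolding integral_complex_of_real polar_integral(2)[OF cont] ..
  finally have wint: "(LINT \<theta>|lborel. (indicator {0..<pi} \<theta> * (\<bar>tan \<theta>\<bar> powr (1/3) / kappa)) *\<^sub>R w \<theta>)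
      = of_real (integral {-1..1} ?A)" .
  have uI: "integrable lborel (\<lambda>\<phi>. indicator {0..<2 * pi} \<phi> *\<^sub>R u \<phi>)"
    and uint: "(LINT \<phi>|lborel. indicator {0..<2 * pi} \<phi> *\<^sub>R u \<phi>) = (if k = k' then 2 * of_real pi else 0)"
    using cis_integral[of "k - k'"] unfolding u_def by auto
  show "integrable nu (\<lambda>p. Ztilde i p * cnj (Ztilde j p))"
    unfolding eq by (rule nu_integral_product(1)[OF um wm uI wI])
  have "(LINT p|nu. Ztilde i p * cnj (Ztilde j p)) = (if k = k' then 2 * of_real pi else 0) * of_real (integral {-1..1} ?A)"
    unfolding eq nu_integral_product(2)[OF um wm uI wI] uint wint ..
  also have "\<dots> = of_bool (i = j)"
    using sph_amp_orthogonal[of l k l'] assms unfolding ij by auto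
  finally show "(LINT p|nu. Ztilde i p * cnj (Ztilde j p)) = of_bool (i = j)" .
qed

lemma prob_space_nu: "prob_space nu"
proof
  have u: "(\<integral>\<^sup>+\<phi>. ennreal (indicator {0..<2 * pi} \<phi>) \<partial>lborel) = ennreal (2 * pi)"
    by (simp add: ennreal_indicator)
  have m: "(\<lambda>p. ennreal (indicator {0..<2 * pi} (fst p)) * ennreal (indicator {0..<pi} (snd p) * \<bar>tan (snd p)\<bar> powr (1/3)))
     \<in> borel_measurable (lborel \<Otimes>\<^sub>M lborel)" by measurable
  have dom: "sph_dom \<in> sets (restrict_space lborel sph_dom)" by (simp add: sets_restrict_space_iff)
  have "emeasure nu (space nu) = (\<integral>\<^sup>+p. ennreal (nu_density p) \<partial>restrict_space lborel sph_dom)"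
    unfolding nu_eq by (subst emeasure_density)
      (auto intro!: nn_integral_cong measurable_restrict_space1 dom simp: space_restrict_space)
  also have "\<dots> = (\<integral>\<^sup>+p. ennreal (nu_density p) * indicator sph_dom p \<partial>lborel)"
    by (subst nn_integral_restrict_space) auto
  also have "\<dots> = (\<integral>\<^sup>+p. ennreal (1 / kappa) * (ennreal (indicator {0..<2 * pi} (fst p)) *
      ennreal (indicator {0..<pi} (snd p) * \<bar>tan (snd p)\<bar> powr (1/3))) \<partial>lborel)"
    using kappa_pos by (intro nn_integral_cong)
      (auto simp: sph_dom_def nu_density_def indicator_def ennreal_mult[symmetric] split: prod.split)
  also have "\<dots> = ennreal (1 / kappa) * (\<integral>\<^sup>+p. ennreal (indicator {0..<2 * pi} (fst p)) *
      ennreal (indicator {0..<pi} (snd p) * \<bar>tan (snd p)\<bar> powr (1/3)) \<partial>(lborel \<Otimes>\<^sub>M lborel))"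
    using m by (subst nn_integral_cmult) (auto simp: lborel_prod)
  also have "(\<integral>\<^sup>+p. ennreal (indicator {0..<2 * pi} (fst p)) *
      ennreal (indicator {0..<pi} (snd p) * \<bar>tan (snd p)\<bar> powr (1/3)) \<partial>(lborel \<Otimes>\<^sub>M lborel))
    = ennreal (2 * pi) * ennreal tan_mass"
    by (subst lborel.nn_integral_fst[symmetric, OF m])
       (simp add: nn_integral_cmult nn_integral_multc nn_integral_tan u)
  also have "ennreal (1 / kappa) * (ennreal (2 * pi) * ennreal tan_mass) = 1"
    using kappa_pos tan_mass_pos by (simp add: kappa_eq flip: ennreal_mult)
  finally show "emeasure nu (space nu) = 1" .
qed


section \<open>Empirical lower bounds over convex hulls\<close>

lemma exp_le_one_plus_quadratic:
  fixes u :: real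
  assumes "\<bar>u\<bar> \<le> 1"
  shows "exp u \<le> 1 + u + u\<^sup>2"
proof (cases "0 \<le> u")
  case True
  then show ?thesis using exp_bound[of u] assms by auto
next
  case False
  define v where "v = - u"
  have v: "0 < v" "v \<le> 1" using False assms by (auto simp: v_def)
  have "1 + v \<le> exp v" by (rule exp_ge_add_one_self)
  have "exp u = 1 / exp v" by (simp add: v_def exp_minus inverse_eq_divide)
  also have "\<dots> \<le> 1 / (1 + v)"
    using v \<open>1 + v \<le> exp v\<close> by (intro divide_left_mono) auto
  also have "\<dots> \<le> 1 - v + v\<^sup>2"
  proof -
    have "(1 - v + v\<^sup>2) * (1 + v) = 1 + v ^ 3" by (simp add: algebra_simps power2_eq_square power3_eq_cube)
    also have "\<dots> \<ge> 1" using v by simp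
    finally show ?thesis using v by (simp add: divide_le_eq)
  qed
  finally show ?thesis by (simp add: v_def)
qed

lemma exp_mult_le_chord:
  fixes x :: real
  assumes "0 \<le> x" "x \<le> 1"
  shows "exp (c * x) \<le> 1 + (exp c - 1) * x"
proof -
  have "convex_on UNIV (exp :: real \<Rightarrow> real)"
    by (rule f''_ge0_imp_convex[where f' = exp and f'' = exp]) (auto intro!: derivative_eq_intros)
  from convex_onD[OF this, of x 0 c]
  have "exp ((1 - x) *\<^sub>R 0 + x *\<^sub>R c) \<le> (1 - x) * exp 0 + x * exp c"
    using assms by auto
  then show ?thesis by (simp add: algebra_simps)
qed

text \<open>Markov's inequality for the product of the exponentials exp (c X). By convexity each
  factor has mean at most 1 + (exp c - 1) E X, hence at most exp \<mu>. The sign of c is free, so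
  both tails are covered.\<close>

lemma (in prob_space) iid_sum_tail:
  fixes X :: "'a \<Rightarrow> real"
  assumes I: "finite I" and X[measurable]: "X \<in> borel_measurable M"
    and X01: "\<And>x. x \<in> space M \<Longrightarrow> 0 \<le> X x \<and> X x \<le> 1"
    and mean: "(exp c - 1) * expectation X \<le> \<mu>"
  shows "measure (PiM I (\<lambda>_. M)) {t \<in> space (PiM I (\<lambda>_. M)). b \<le> c * (\<Sum>j\<in>I. X (t j))}
           \<le> exp (real (card I) * \<mu> - b)"
proof -
  interpret P: product_prob_space "\<lambda>_::'b. M" I by unfold_locales
  interpret F: finite_product_prob_space "\<lambda>_::'b. M" I using I by unfold_locales
  let ?P = "PiM I (\<lambda>_. M)"
  define Y where "Y = (\<lambda>x. exp (c * X x))"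
  have Y[measurable]: "Y \<in> borel_measurable M" unfolding Y_def by measurable
  have Yb: "\<bar>Y x\<bar> \<le> exp \<bar>c\<bar>" if "x \<in> space M" for x
  proof -
    have "c * X x \<le> \<bar>c\<bar> * 1" using X01[OF that] by (intro mult_mono) auto
    then show ?thesis by (auto simp: Y_def)
  qed
  have intX: "integrable M X"
    by (rule integrable_const_bound[where B = 1]) (use X01 in auto)
  have intY: "integrable M Y"
    by (rule integrable_const_bound[where B = "exp \<bar>c\<bar>"]) (use Yb in auto)
  have "expectation Y \<le> expectation (\<lambda>x. 1 + (exp c - 1) * X x)"
    unfolding Y_def
    by (intro integral_mono) (use intX intY X01 exp_mult_le_chord in \<open>auto simp: Y_def\<close>)
  also have "\<dots> = 1 + (exp c - 1) * expectation X"
    using intX by (simp add: prob_space)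
  also have "\<dots> \<le> exp \<mu>" using mean exp_ge_add_one_self[of \<mu>] by linarith
  finally have EY: "expectation Y \<le> exp \<mu>" .
  have EY0: "0 \<le> expectation Y" by (intro integral_nonneg_AE) (auto simp: Y_def)
  have prodY: "(\<Prod>j\<in>I. Y (t j)) = exp (c * (\<Sum>j\<in>I. X (t j)))" for t
    by (simp add: Y_def exp_sum[OF I] sum_distrib_left)
  have int: "integrable ?P (\<lambda>t. \<Prod>j\<in>I. Y (t j))"
    by (rule P.product_integrable_prod) (use I intY in auto)
  have "measure ?P {t \<in> space ?P. b \<le> c * (\<Sum>j\<in>I. X (t j))}
      = measure ?P {t \<in> space ?P. exp b \<le> (\<Prod>j\<in>I. Y (t j))}"
    by (simp add: prodY)
  also have "\<dots> \<le> (\<integral>t. (\<Prod>j\<in>I. Y (t j)) \<partial>?P) / exp b"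
    by (rule integral_Markov_inequality_measure[OF int, where A = "{}"])
       (auto simp: prodY)
  also have "(\<integral>t. (\<Prod>j\<in>I. Y (t j)) \<partial>?P) = (expectation Y) ^ card I"
    using P.product_integral_prod[OF I, of "\<lambda>_. Y"] intY by simp
  also have "(expectation Y) ^ card I / exp b \<le> exp \<mu> ^ card I / exp b"
    using EY EY0 by (intro divide_right_mono power_mono) auto
  also have "\<dots> = exp (real (card I) * \<mu> - b)"
    by (simp add: exp_diff exp_of_nat_mult)
  finally show ?thesis .
qed

text \<open>The choice c = -1 together with exp (-1) <= 1/2 gives -p/2 per sample, of which the
  threshold p/4 takes back half. The exponent is linear in p, where a variance-free additive bound
  would only give p^2; sets of small probability depend on this.\<close>

lemma (in prob_space) empirical_frequency_tail:
  assumes I: "finite I" and B[measurable]: "B \<in> sets M"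
  shows "measure (PiM I (\<lambda>_. M)) {t \<in> space (PiM I (\<lambda>_. M)).
            4 * (\<Sum>j\<in>I. indicat_real B (t j)) \<le> real (card I) * prob B}
          \<le> exp (- (real (card I) * prob B / 4))"
proof -
  have e: "exp (-1) \<le> (1/2::real)"
    using exp_ge_add_one_self[of "1::real"] by (simp add: exp_minus field_simps)
  have "measure (PiM I (\<lambda>_. M)) {t \<in> space (PiM I (\<lambda>_. M)).
            - (real (card I) * prob B / 4) \<le> (-1) * (\<Sum>j\<in>I. indicat_real B (t j))}
        \<le> exp (real (card I) * (- prob B / 2) - (- (real (card I) * prob B / 4)))"
  proof (rule iid_sum_tail[OF I])
    have "(exp (-1) - 1) * prob B \<le> (1/2 - 1) * prob B"
      using e by (intro mult_right_mono) auto
    then show "(exp (-1) - 1) * expectation (indicat_real B) \<le> - prob B / 2"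
      by simp
  qed (auto simp: indicator_def)
  then show ?thesis by (simp add: field_simps)
qed

section \<open>Maurey's empirical method over finite words\<close>

lemma weighted_mgf_le:
  fixes u :: "'j \<Rightarrow> real"
  assumes J: "finite J" and l: "\<And>j. j \<in> J \<Longrightarrow> 0 \<le> l j" "sum l J = 1"
    and u: "\<And>j. j \<in> J \<Longrightarrow> \<bar>u j\<bar> \<le> B" "(\<Sum>j\<in>J. l j * u j) = 0" and B: "0 \<le> B" "B \<le> 1"
  shows "(\<Sum>j\<in>J. l j * exp (u j)) \<le> exp (B\<^sup>2)"
proof -
  have "(\<Sum>j\<in>J. l j * exp (u j)) \<le> (\<Sum>j\<in>J. l j * (1 + u j + B\<^sup>2))"
  proof (intro sum_mono mult_left_mono)
    fix j assume j: "j \<in> J"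
    have "exp (u j) \<le> 1 + u j + (u j)\<^sup>2"
      using u(1)[OF j] B by (intro exp_le_one_plus_quadratic) auto
    also have "(u j)\<^sup>2 \<le> B\<^sup>2" using u(1)[OF j] B by (simp add: power2_le_iff_abs_le)
    finally show "exp (u j) \<le> 1 + u j + B\<^sup>2" by simp
  qed (use l in auto)
  also have "\<dots> = sum l J + (\<Sum>j\<in>J. l j * u j) + B\<^sup>2 * sum l J"
    by (simp add: sum.distrib algebra_simps sum_distrib_left sum_distrib_right)
  also have "\<dots> = 1 + B\<^sup>2" using l u by simp
  also have "\<dots> \<le> exp (B\<^sup>2)" by (rule exp_ge_add_one_self)
  finally show ?thesis .
qed

text \<open>The law of k independent draws from J with probabilities l, written as a weight on
  words. Maurey's random average thus becomes a finite weighted sum and lives on no additional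
  probability space.\<close>

definition word_weight :: "('j \<Rightarrow> real) \<Rightarrow> nat \<Rightarrow> (nat \<Rightarrow> 'j) \<Rightarrow> real" where
  "word_weight l k \<sigma> = (\<Prod>r<k. l (\<sigma> r))"

lemma word_weight_nonneg:
  "(\<And>j. j \<in> J \<Longrightarrow> 0 \<le> l j) \<Longrightarrow> \<sigma> \<in> {..<k} \<rightarrow>\<^sub>E J \<Longrightarrow> 0 \<le> word_weight l k \<sigma>"
  unfolding word_weight_def by (intro prod_nonneg) auto

lemma sum_word_weight:
  assumes "finite J" "sum l J = 1"
  shows "sum (word_weight l k) ({..<k} \<rightarrow>\<^sub>E J) = 1"
proof -
  have "sum (word_weight l k) ({..<k} \<rightarrow>\<^sub>E J) = (\<Prod>r<k. sum l J)"
    unfolding word_weight_def using assms(1) by (subst prod_sum_PiE) auto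
  then show ?thesis by (simp add: assms)
qed

lemma word_average_tail_real:
  fixes a :: "'j \<Rightarrow> real"
  assumes J: "finite J" and l: "\<And>j. j \<in> J \<Longrightarrow> 0 \<le> l j" "sum l J = 1"
    and a: "\<And>j. j \<in> J \<Longrightarrow> \<bar>a j\<bar> \<le> 1" and eps: "0 \<le> \<epsilon>" "\<epsilon> \<le> 4"
  shows "(\<Sum>\<sigma>\<in>{..<k} \<rightarrow>\<^sub>E J. word_weight l k \<sigma> *
            of_bool (real k * \<epsilon> < (\<Sum>r<k. a (\<sigma> r)) - real k * (\<Sum>j\<in>J. l j * a j)))
         \<le> exp (- (real k * \<epsilon>\<^sup>2 / 16))" (is "(\<Sum>\<sigma>\<in>_. _ * of_bool (?Q \<sigma>)) \<le> _")
proof -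
  define \<mu> where "\<mu> = (\<Sum>j\<in>J. l j * a j)"
  \<comment> \<open>This tilt makes (2 \<tau>)^2 - \<tau> \<epsilon> equal to -\<epsilon>^2 / 16,
    and \<epsilon> <= 4 keeps the exponents, bounded by 2 \<tau>, at most 1.\<close>
  define \<tau> where "\<tau> = \<epsilon> / 8"
  have mu: "\<bar>\<mu>\<bar> \<le> 1"
  proof -
    have "\<bar>\<mu>\<bar> \<le> (\<Sum>j\<in>J. \<bar>l j * a j\<bar>)" unfolding \<mu>_def by (rule sum_abs)
    also have "\<dots> \<le> (\<Sum>j\<in>J. l j * 1)"
      unfolding abs_mult using l a by (intro sum_mono mult_mono) auto
    finally show ?thesis using l by simp
  qed
  have "(\<Sum>\<sigma>\<in>{..<k} \<rightarrow>\<^sub>E J. word_weight l k \<sigma> * of_bool (?Q \<sigma>))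
      \<le> (\<Sum>\<sigma>\<in>{..<k} \<rightarrow>\<^sub>E J. word_weight l k \<sigma> *
            (exp (- (real k * \<tau> * \<epsilon>)) * (\<Prod>r<k. exp (\<tau> * (a (\<sigma> r) - \<mu>)))))"
  proof (intro sum_mono mult_left_mono word_weight_nonneg)
    fix \<sigma>
    have "exp (- (real k * \<tau> * \<epsilon>)) * (\<Prod>r<k. exp (\<tau> * (a (\<sigma> r) - \<mu>)))
        = exp (\<tau> * ((\<Sum>r<k. a (\<sigma> r)) - real k * \<mu> - real k * \<epsilon>))"
      by (simp add: exp_sum[symmetric] exp_add[symmetric] sum_distrib_left[symmetric]
          sum_subtractf algebra_simps)
    moreover have "1 \<le> exp (\<tau> * ((\<Sum>r<k. a (\<sigma> r)) - real k * \<mu> - real k * \<epsilon>))" if "?Q \<sigma>"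
      using that eps by (simp add: \<mu>_def \<tau>_def)
    ultimately show "of_bool (?Q \<sigma>) \<le>
        exp (- (real k * \<tau> * \<epsilon>)) * (\<Prod>r<k. exp (\<tau> * (a (\<sigma> r) - \<mu>)))"
      by auto
  qed (use l in auto)
  also have "\<dots> = exp (- (real k * \<tau> * \<epsilon>)) *
      (\<Sum>\<sigma>\<in>{..<k} \<rightarrow>\<^sub>E J. \<Prod>r<k. l (\<sigma> r) * exp (\<tau> * (a (\<sigma> r) - \<mu>)))"
    by (simp add: word_weight_def sum_distrib_left prod.distrib mult_ac)
  also have "\<dots> = exp (- (real k * \<tau> * \<epsilon>)) * (\<Prod>r<k. \<Sum>j\<in>J. l j * exp (\<tau> * (a j - \<mu>)))"
    using J by (subst prod_sum_PiE) auto
  also have "\<dots> \<le> exp (- (real k * \<tau> * \<epsilon>)) * (\<Prod>r<k. exp ((2 * \<tau>)\<^sup>2))"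
  proof (intro mult_left_mono prod_mono conjI)
    show "(\<Sum>j\<in>J. l j * exp (\<tau> * (a j - \<mu>))) \<le> exp ((2 * \<tau>)\<^sup>2)"
    proof (rule weighted_mgf_le[OF J l])
      fix j assume "j \<in> J"
      then have "\<bar>a j - \<mu>\<bar> \<le> 2" using a[of j] mu by auto
      then show "\<bar>\<tau> * (a j - \<mu>)\<bar> \<le> 2 * \<tau>"
        using eps mult_left_mono[of "\<bar>a j - \<mu>\<bar>" 2 \<tau>] by (simp add: \<tau>_def abs_mult)
    next
      have "(\<Sum>j\<in>J. l j * (\<tau> * (a j - \<mu>))) = \<tau> * ((\<Sum>j\<in>J. l j * a j) - \<mu> * sum l J)"
        by (simp add: sum_distrib_left sum_subtractf algebra_simps)
      then show "(\<Sum>j\<in>J. l j * (\<tau> * (a j - \<mu>))) = 0" using l by (simp add: \<mu>_def)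
    qed (use eps in \<open>auto simp: \<tau>_def\<close>)
  qed (use l in \<open>auto intro!: sum_nonneg mult_nonneg_nonneg\<close>)
  also have "\<dots> = exp (real k * ((2 * \<tau>)\<^sup>2 - \<tau> * \<epsilon>))"
    by (simp add: exp_of_nat_mult[symmetric] exp_add[symmetric] algebra_simps)
  also have "(2 * \<tau>)\<^sup>2 - \<tau> * \<epsilon> = - (\<epsilon>\<^sup>2 / 16)"
    by (simp add: \<tau>_def power2_eq_square field_simps)
  finally show ?thesis by (simp add: \<mu>_def)
qed

definition word_average :: "('j \<Rightarrow> complex) \<Rightarrow> nat \<Rightarrow> (nat \<Rightarrow> 'j) \<Rightarrow> complex" where
  "word_average z k \<sigma> = (\<Sum>r<k. z (\<sigma> r)) / of_nat k"

text \<open>A complex deviation above \<epsilon> forces one of the four numbers Re, -Re, Im, -Im of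
  the difference above \<epsilon> / 2, so four real tails with half the deviation suffice.\<close>

lemma word_average_tail:
  fixes z :: "'j \<Rightarrow> complex"
  assumes J: "finite J" and l: "\<And>j. j \<in> J \<Longrightarrow> 0 \<le> l j" "sum l J = 1"
    and z: "\<And>j. j \<in> J \<Longrightarrow> cmod (z j) \<le> 1" and eps: "0 \<le> \<epsilon>" "\<epsilon> \<le> 4" and k: "0 < k"
  shows "(\<Sum>\<sigma>\<in>{..<k} \<rightarrow>\<^sub>E J. word_weight l k \<sigma> *
            of_bool (\<epsilon> < cmod (word_average z k \<sigma> - (\<Sum>j\<in>J. of_real (l j) * z j))))
         \<le> 4 * exp (- (real k * \<epsilon>\<^sup>2 / 64))"
proof -
  define Q where "Q = (\<lambda>(a :: 'j \<Rightarrow> real) \<sigma>. (real k * (\<epsilon> / 2) <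
      (\<Sum>r<k. a (\<sigma> r)) - real k * (\<Sum>j\<in>J. l j * a j)))"
  define A where "A = [\<lambda>j. Re (z j), \<lambda>j. - Re (z j), \<lambda>j. Im (z j), \<lambda>j. - Im (z j)]"
  let ?S = "{..<k} \<rightarrow>\<^sub>E J"
  have tail: "(\<Sum>\<sigma>\<in>?S. word_weight l k \<sigma> * of_bool (Q a \<sigma>)) \<le> exp (- (real k * \<epsilon>\<^sup>2 / 64))"
    if "a \<in> set A" for a
  proof -
    have "\<bar>a j\<bar> \<le> 1" if "j \<in> J" for j
      using z[OF that] abs_Re_le_cmod[of "z j"] abs_Im_le_cmod[of "z j"] \<open>a \<in> set A\<close>
      by (auto simp: A_def)
    from word_average_tail_real[OF J l this, where \<epsilon> = "\<epsilon> / 2"]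
    show ?thesis using eps by (simp add: Q_def power_divide)
  qed
  have "(\<Sum>\<sigma>\<in>?S. word_weight l k \<sigma> *
            of_bool (\<epsilon> < cmod (word_average z k \<sigma> - (\<Sum>j\<in>J. of_real (l j) * z j))))
     \<le> (\<Sum>\<sigma>\<in>?S. word_weight l k \<sigma> * (\<Sum>a\<leftarrow>A. of_bool (Q a \<sigma>)))"
  proof (intro sum_mono mult_left_mono word_weight_nonneg)
    fix \<sigma>
    define d where "d = word_average z k \<sigma> - (\<Sum>j\<in>J. of_real (l j) * z j)"
    have Re: "real k * Re d = (\<Sum>r<k. Re (z (\<sigma> r))) - real k * (\<Sum>j\<in>J. l j * Re (z j))"
      using k by (simp add: d_def word_average_def Re_divide_of_nat algebra_simps)
    have Im: "real k * Im d = (\<Sum>r<k. Im (z (\<sigma> r))) - real k * (\<Sum>j\<in>J. l j * Im (z j))"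
      using k by (simp add: d_def word_average_def Im_divide_of_nat algebra_simps)
    have "\<exists>a\<in>set A. Q a \<sigma>" if "\<epsilon> < cmod d"
    proof -
      have "\<epsilon> < \<bar>Re d\<bar> + \<bar>Im d\<bar>" using that cmod_le[of d] by linarith
      then have "\<epsilon> / 2 < Re d \<or> \<epsilon> / 2 < - Re d \<or> \<epsilon> / 2 < Im d \<or> \<epsilon> / 2 < - Im d" by linarith
      then have "real k * (\<epsilon> / 2) < real k * Re d \<or> real k * (\<epsilon> / 2) < - (real k * Re d) \<or>
          real k * (\<epsilon> / 2) < real k * Im d \<or> real k * (\<epsilon> / 2) < - (real k * Im d)"
        using k by (metis mult_minus_right mult_strict_left_mono of_nat_0_less_iff)
      then show ?thesis unfolding Re Im by (auto simp: A_def Q_def sum_negf)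
    qed
    then show "of_bool (\<epsilon> < cmod (word_average z k \<sigma> - (\<Sum>j\<in>J. of_real (l j) * z j)))
        \<le> (\<Sum>a\<leftarrow>A. of_bool (Q a \<sigma>) :: real)"
      unfolding d_def[symmetric] by (auto simp: A_def)
  qed (use l in auto)
  also have "\<dots> = (\<Sum>a\<leftarrow>A. \<Sum>\<sigma>\<in>?S. word_weight l k \<sigma> * of_bool (Q a \<sigma>))"
    by (simp add: A_def sum.distrib algebra_simps)
  also have "\<dots> \<le> (\<Sum>a\<leftarrow>A. exp (- (real k * \<epsilon>\<^sup>2 / 64)))"
    by (rule sum_list_mono) (rule tail)
  also have "\<dots> = 4 * exp (- (real k * \<epsilon>\<^sup>2 / 64))" by (simp add: A_def)
  finally show ?thesis .
qed


lemma borel_measurable_word_average [measurable]: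
  assumes "\<And>j. j \<in> J \<Longrightarrow> \<psi> j \<in> borel_measurable M" "\<sigma> \<in> {..<k} \<rightarrow>\<^sub>E J"
  shows "(\<lambda>p. word_average (\<lambda>j. \<psi> j p) k \<sigma>) \<in> borel_measurable M"
proof -
  have [measurable]: "\<psi> (\<sigma> r) \<in> borel_measurable M" if "r < k" for r
    using assms that by (auto simp: PiE_iff)
  show ?thesis unfolding word_average_def by measurable
qed

text \<open>At every single point the weight of the bad words is at most half of the claimed bound.
  Averaging this over the law and over the sample and exchanging sums shows that a random word is
  good for both on average, hence some word is good for both at once. That word depends on the
  sample \<open>t\<close>, so later estimates have to be uniform over all words.\<close>

lemma (in prob_space) word_average_approximation:
  fixes \<psi> :: "'j \<Rightarrow> 'a \<Rightarrow> complex"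
  assumes J: "finite J" and l: "\<And>j. j \<in> J \<Longrightarrow> 0 \<le> l j" "sum l J = 1"
    and meas: "\<And>j. j \<in> J \<Longrightarrow> \<psi> j \<in> borel_measurable M"
    and bd: "\<And>j p. j \<in> J \<Longrightarrow> p \<in> space M \<Longrightarrow> cmod (\<psi> j p) \<le> 1"
    and eps: "0 \<le> \<epsilon>" "\<epsilon> \<le> 4" and k: "0 < k"
    and I: "finite I" "I \<noteq> {}" and t: "\<And>j. j \<in> I \<Longrightarrow> t j \<in> space M"
  defines "g \<equiv> \<lambda>p. \<Sum>j\<in>J. of_real (l j) * \<psi> j p"
  defines "bad \<equiv> \<lambda>\<sigma> p. \<epsilon> < cmod (word_average (\<lambda>j. \<psi> j p) k \<sigma> - g p)"
  shows "\<exists>\<sigma>\<in>{..<k} \<rightarrow>\<^sub>E J. prob {p \<in> space M. bad \<sigma> p} + (\<Sum>j\<in>I. of_bool (bad \<sigma> (t j))) / card I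
           \<le> 8 * exp (- (real k * \<epsilon>\<^sup>2 / 64))"
proof (rule ccontr)
  define b where "b = 4 * exp (- (real k * \<epsilon>\<^sup>2 / 64))"
  let ?S = "{..<k} \<rightarrow>\<^sub>E J"
  let ?F = "\<lambda>\<sigma>. prob {p \<in> space M. bad \<sigma> p} + (\<Sum>j\<in>I. of_bool (bad \<sigma> (t j))) / card I"
  assume "\<not> ?thesis"
  then have less: "2 * b < ?F \<sigma>" if "\<sigma> \<in> ?S" for \<sigma>
    using that by (auto simp: b_def not_le)
  have g[measurable]: "g \<in> borel_measurable M"
    unfolding g_def using meas by measurable
  have pt: "(\<Sum>\<sigma>\<in>?S. word_weight l k \<sigma> * of_bool (bad \<sigma> p)) \<le> b" if "p \<in> space M" for p
    unfolding bad_def b_def g_def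
    by (rule word_average_tail) (use J l bd[OF _ that] eps k in auto)
  have badm: "{p \<in> space M. bad \<sigma> p} \<in> sets M" if "\<sigma> \<in> ?S" for \<sigma>
  proof -
    have [measurable]: "(\<lambda>p. word_average (\<lambda>j. \<psi> j p) k \<sigma>) \<in> borel_measurable M"
      using meas that by (rule borel_measurable_word_average)
    show ?thesis unfolding bad_def by measurable
  qed
  have "(\<Sum>\<sigma>\<in>?S. word_weight l k \<sigma> * prob {p \<in> space M. bad \<sigma> p})
      = (\<Sum>\<sigma>\<in>?S. word_weight l k \<sigma> * expectation (indicat_real {p \<in> space M. bad \<sigma> p}))"
    using badm by (intro sum.cong) auto
  also have "\<dots> = expectation (\<lambda>p. \<Sum>\<sigma>\<in>?S. word_weight l k \<sigma> * indicat_real {p \<in> space M. bad \<sigma> p} p)"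
    using badm by (subst Bochner_Integration.integral_sum) (auto simp: emeasure_eq_measure)
  also have "\<dots> \<le> expectation (\<lambda>p. b)"
  proof (rule integral_mono)
    show "integrable M (\<lambda>p. \<Sum>\<sigma>\<in>?S. word_weight l k \<sigma> * indicat_real {p \<in> space M. bad \<sigma> p} p)"
      using badm by (intro Bochner_Integration.integrable_sum) (auto simp: emeasure_eq_measure)
    fix p assume "p \<in> space M"
    then show "(\<Sum>\<sigma>\<in>?S. word_weight l k \<sigma> * indicat_real {p \<in> space M. bad \<sigma> p} p) \<le> b"
      using pt[of p] by (simp add: indicator_def of_bool_def)
  qed simp
  finally have 1: "(\<Sum>\<sigma>\<in>?S. word_weight l k \<sigma> * prob {p \<in> space M. bad \<sigma> p}) \<le> b"
    by (simp add: prob_space)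
  have "(\<Sum>\<sigma>\<in>?S. word_weight l k \<sigma> * ((\<Sum>j\<in>I. of_bool (bad \<sigma> (t j))) / card I))
     = (\<Sum>j\<in>I. \<Sum>\<sigma>\<in>?S. word_weight l k \<sigma> * of_bool (bad \<sigma> (t j))) / card I"
    by (subst sum.swap) (simp add: sum_distrib_left sum_divide_distrib)
  also have "\<dots> \<le> (\<Sum>j\<in>I. b) / card I"
    by (intro divide_right_mono sum_mono pt t) auto
  also have "\<dots> = b" using I by simp
  finally have 2: "(\<Sum>\<sigma>\<in>?S. word_weight l k \<sigma> * ((\<Sum>j\<in>I. of_bool (bad \<sigma> (t j))) / card I)) \<le> b" .
  have "2 * b = (\<Sum>\<sigma>\<in>?S. word_weight l k \<sigma> * (2 * b))"
    using sum_word_weight[OF J l(2), of k] by (simp add: sum_distrib_right[symmetric])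
  also have "\<dots> < (\<Sum>\<sigma>\<in>?S. word_weight l k \<sigma> * ?F \<sigma>)"
  proof -
    obtain \<tau> where \<tau>: "\<tau> \<in> ?S" "0 < word_weight l k \<tau>"
    proof (rule ccontr)
      assume "\<not> thesis"
      with that have "\<not> (\<exists>\<sigma>\<in>?S. 0 < word_weight l k \<sigma>)" by blast
      then have "sum (word_weight l k) ?S \<le> 0" by (intro sum_nonpos) (auto simp: not_less)
      then show False using sum_word_weight[OF J l(2), of k] by simp
    qed
    show ?thesis
    proof (rule sum_strict_mono_ex1)
      show "\<forall>\<sigma>\<in>?S. word_weight l k \<sigma> * (2 * b) \<le> word_weight l k \<sigma> * ?F \<sigma>"
        using less l by (intro ballI mult_left_mono word_weight_nonneg[of J]) (auto simp: less_imp_le)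
      show "\<exists>\<sigma>\<in>?S. word_weight l k \<sigma> * (2 * b) < word_weight l k \<sigma> * ?F \<sigma>"
        using less[OF \<tau>(1)] \<tau> by (intro bexI[of _ \<tau>] mult_strict_left_mono) auto
    qed (use J in \<open>auto intro: finite_PiE\<close>)
  qed
  also have "\<dots> \<le> 2 * b" using 1 2 by (simp add: distrib_left sum.distrib)
  finally show False by simp
qed

section \<open>Dyadic level sets and the lower bound over a hull\<close>

lemma quarter_power_eq: "(1/4::real) ^ n = ((1/2) ^ n)\<^sup>2"
  by (simp add: power2_eq_square flip: power_mult_distrib)

text \<open>The first level i with (1/2)^(i+1) < y already contributes enough, since y <= (1/2)^i;
  if no level up to q qualifies, the cutoff term bounds y^2. The thresholds here are twice those in
  \<open>dyadic_sum_le_square\<close>; this gap leaves room for replacing y by an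
  approximation.\<close>

lemma square_le_dyadic_sum:
  fixes y :: real
  assumes "0 \<le> y" "y \<le> 1"
  shows "y\<^sup>2 \<le> (1/4) ^ (q + 1) + (\<Sum>i\<le>q. (1/4) ^ i * of_bool ((1/2) ^ (i + 1) < y))"
proof -
  have small: "y\<^sup>2 \<le> (1/4) ^ n" if "\<not> (1/2) ^ n < y" for n
  proof -
    have "y\<^sup>2 \<le> ((1/2) ^ n)\<^sup>2" using that assms by (intro power_mono) auto
    then show ?thesis by (simp add: quarter_power_eq)
  qed
  define T where "T = (\<lambda>q. \<Sum>i\<le>q. (1/4) ^ i * (of_bool ((1/2) ^ (i + 1) < y) :: real))"
  have "y\<^sup>2 \<le> (1/4) ^ (q + 1) + T q"
  proof (induction q)
    case 0
    have "y\<^sup>2 \<le> 1" using assms by (simp add: power_le_one)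
    moreover have "T 0 = of_bool ((1/2) ^ 1 < y)"
      unfolding T_def by (simp only: atMost_0 sum.insert finite.emptyI empty_iff simp_thms sum.empty) simp
    ultimately show ?case using small[of 1] by (cases "(1/2) ^ 1 < y") auto
  next
    case (Suc q)
    have T: "T (Suc q) = T q + (1/4) ^ Suc q * of_bool ((1/2) ^ (Suc q + 1) < y)"
      unfolding T_def by (simp only: sum.atMost_Suc)
    show ?case
    proof (cases "(1/2) ^ (Suc q + 1) < y")
      case True
      then have "T (Suc q) = T q + (1/4) ^ Suc q" using T by (simp only: of_bool_eq mult_1_right)
      moreover have "(0::real) \<le> (1/4) ^ q" by simp
      ultimately show ?thesis using Suc unfolding power_Suc add_Suc_right add_0_right One_nat_def by linarith
    next
      case False
      have "0 \<le> T (Suc q)" unfolding T_def by (intro sum_nonneg) auto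
      then show ?thesis using small[OF False] by linarith
    qed
  qed
  then show ?thesis by (simp only: T_def)
qed

text \<open>If j is the first level that contributes, the sum is at most the geometric series 4/3 *
  (1/4)^j, and (1/4)^j is below 16 y^2.\<close>

lemma dyadic_sum_le_square:
  fixes y :: real
  assumes "0 \<le> y"
  shows "(\<Sum>i\<le>q. (1/4) ^ i * of_bool ((1/2) ^ (i + 2) < y)) \<le> 64 / 3 * y\<^sup>2"
proof -
  have large: "(1/4) ^ n \<le> y\<^sup>2" if "(1/2) ^ n < y" for n
  proof -
    have "((1/2) ^ n)\<^sup>2 \<le> y\<^sup>2" using that by (intro power_mono) auto
    then show ?thesis by (simp add: quarter_power_eq)
  qed
  define T where "T = (\<lambda>q. \<Sum>i\<le>q. (1/4) ^ i * (of_bool ((1/2) ^ (i + 2) < y) :: real))"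
  \<comment> \<open>The subtracted term is the remaining tail of the geometric series; a bound
    without it would not be inductive.\<close>
  have "T q = 0 \<or> T q \<le> 64 / 3 * y\<^sup>2 - (1/4) ^ q / 3"
  proof (induction q)
    case 0
    then show ?case using large[of 2] by (auto simp: T_def power2_eq_square)
  next
    case (Suc q)
    have T: "T (Suc q) = T q + (1/4) ^ Suc q * of_bool ((1/2) ^ (Suc q + 2) < y)" unfolding T_def by (simp only: sum.atMost_Suc)
    show ?case
    proof (cases "(1/2) ^ (Suc q + 2) < y")
      case True
      then have "T (Suc q) = T q + (1/4) ^ Suc q" using T by (simp only: of_bool_eq mult_1_right)
      moreover have "(1/4) ^ (Suc q + 2) \<le> y\<^sup>2" using large[OF True] .
      ultimately show ?thesis using Suc by auto
    next
      case False
      have "(0::real) \<le> (1/4) ^ q" by simp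
      moreover have "T (Suc q) = T q" using T False by (simp only: of_bool_eq mult_zero_right add_0_right)
      ultimately show ?thesis using Suc unfolding power_Suc by linarith
    qed
  qed
  then have "T q \<le> 64 / 3 * y\<^sup>2"
  proof
    assume "T q \<le> 64 / 3 * y\<^sup>2 - (1/4) ^ q / 3"
    moreover have "(0::real) \<le> (1/4) ^ q" by simp
    ultimately show ?thesis by linarith
  qed simp
  then show ?thesis by (simp only: T_def)
qed

text \<open>The cutoff of the dyadic resolution at level \<open>q\<close>, the Chernoff threshold of a union bound over
  the averages of \<open>k i\<close> out of \<open>M\<close> functions, and the error of replacing a convex combination by
  such an average, for \<open>m\<close> samples.\<close>

definition level_error :: "(nat \<Rightarrow> nat) \<Rightarrow> nat \<Rightarrow> real \<Rightarrow> real \<Rightarrow> real \<Rightarrow> real" where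
  "level_error k q \<Gamma> M m = (1/4) ^ (q + 1) + (\<Sum>i\<le>q. (1/4) ^ i *
     (4 * (real (k i) * ln M + \<Gamma>) / m + 32 * exp (- (real (k i) * (1/4) ^ (i + 6)))))"

text \<open>The event is fixed by finitely many words, before the weights l are given, and is
  therefore uniform over the hull. On it each level set of g is compared with that of an average,
  the average with its empirical frequency, and that frequency with a lower level set of g. The
  constant is 4 from the Chernoff bound times 64/3 from the dyadic sum.\<close>

lemma (in prob_space) convex_hull_empirical_lower_bound:
  fixes \<psi> :: "'j \<Rightarrow> 'a \<Rightarrow> complex" and k :: "nat \<Rightarrow> nat"
  assumes J: "finite J" "J \<noteq> {}"
    and meas: "\<And>j. j \<in> J \<Longrightarrow> \<psi> j \<in> borel_measurable M"
    and bd: "\<And>j p. j \<in> J \<Longrightarrow> p \<in> space M \<Longrightarrow> cmod (\<psi> j p) \<le> 1"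
    and I: "finite I" "I \<noteq> {}" and k: "\<And>i. 0 < k i" and Gam: "0 \<le> \<Gamma>"
  shows "\<exists>E\<in>sets (PiM I (\<lambda>_. M)).
     measure (PiM I (\<lambda>_. M)) (space (PiM I (\<lambda>_. M)) - E) \<le> real (q + 1) * exp (- \<Gamma>) \<and>
     (\<forall>t\<in>E. \<forall>l. (\<forall>j\<in>J. 0 \<le> l j) \<longrightarrow> sum l J = 1 \<longrightarrow>
       expectation (\<lambda>p. (cmod (\<Sum>j\<in>J. of_real (l j) * \<psi> j p))\<^sup>2)
       \<le> 256 / 3 * ((\<Sum>i\<in>I. (cmod (\<Sum>j\<in>J. of_real (l j) * \<psi> j (t i)))\<^sup>2) / card I)
         + level_error k q \<Gamma> (card J) (card I))"
proof -
  let ?P = "PiM I (\<lambda>_. M)"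
  interpret PP: prob_space ?P by (rule prob_space_PiM) (rule prob_space_axioms)
  define W where "W = (\<lambda>i. {..<k i} \<rightarrow>\<^sub>E J)"
  define m where "m = real (card I)"
  have m: "0 < m" using I by (auto simp: m_def card_gt_0_iff)
  \<comment> \<open>With this threshold, m * c i / 4 pays both for \<Gamma> and for the logarithm of
    the number card J ^ k i of words. If \<open>prob (B i \<sigma>)\<close> is at most c i, the
    failure event is empty.\<close>
  define c where "c = (\<lambda>i. 4 * (real (k i) * ln (card J) + \<Gamma>) / m)"
  \<comment> \<open>The threshold is the midpoint between (1/2)^(i+1) and (1/2)^(i+2), at distance
    (1/2)^(i+3) from each; this distance is the accuracy required of the averages.\<close>
  define B where "B = (\<lambda>i \<sigma>. {p \<in> space M. 3 / 4 * (1/2) ^ (i + 1) < cmod (word_average (\<lambda>j. \<psi> j p) (k i) \<sigma>)})"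
  define F where "F = (\<lambda>i \<sigma>. {t \<in> space ?P. 4 * (\<Sum>j\<in>I. indicat_real (B i \<sigma>) (t j)) / m + c i < prob (B i \<sigma>)})"
  have finW: "finite (W i)" for i unfolding W_def using J by (intro finite_PiE) auto
  have B[measurable]: "B i \<sigma> \<in> sets M" if "\<sigma> \<in> W i" for i \<sigma>
  proof -
    have [measurable]: "(\<lambda>p. word_average (\<lambda>j. \<psi> j p) (k i) \<sigma>) \<in> borel_measurable M"
      using meas that[unfolded W_def] by (rule borel_measurable_word_average)
    show ?thesis unfolding B_def by measurable
  qed
  have F[measurable]: "F i \<sigma> \<in> sets ?P" if "\<sigma> \<in> W i" for i \<sigma>
    using B[OF that] I unfolding F_def by measurable
  have Fle: "measure ?P (F i \<sigma>) \<le> exp (- \<Gamma>) / real (card (W i))" if \<sigma>: "\<sigma> \<in> W i" for i \<sigma>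
  proof (cases "c i < prob (B i \<sigma>)")
    case False
    have "F i \<sigma> = {}"
    proof -
      have "0 \<le> 4 * (\<Sum>j\<in>I. indicat_real (B i \<sigma>) (t j)) / m" for t
        using m by (intro divide_nonneg_nonneg mult_nonneg_nonneg sum_nonneg) auto
      then show ?thesis using False unfolding F_def by (auto simp: not_less) (smt (verit))
    qed
    then show ?thesis by simp
  next
    case True
    have cW: "real (card (W i)) = real (card J) ^ k i" by (simp add: W_def card_PiE)
    have cJ: "0 < real (card J)" using J by (simp add: card_gt_0_iff)
    have c0: "0 \<le> c i" using m J Gam by (auto simp: c_def Suc_le_eq card_gt_0_iff)
    have "measure ?P (F i \<sigma>) \<le> measure ?P {t \<in> space ?P. 4 * (\<Sum>j\<in>I. indicat_real (B i \<sigma>) (t j)) \<le> real (card I) * prob (B i \<sigma>)}"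
    proof (rule PP.finite_measure_mono)
      have "4 * x \<le> m * b" if "4 * x / m + c i < b" for x b :: real
      proof -
        have "4 * x / m \<le> b" using that c0 by simp
        then show ?thesis using m by (simp add: divide_le_eq mult.commute)
      qed
      then show "F i \<sigma> \<subseteq> {t \<in> space ?P. 4 * (\<Sum>j\<in>I. indicat_real (B i \<sigma>) (t j)) \<le> real (card I) * prob (B i \<sigma>)}"
        by (auto simp: F_def m_def)
      show "{t \<in> space ?P. 4 * (\<Sum>j\<in>I. indicat_real (B i \<sigma>) (t j)) \<le> real (card I) * prob (B i \<sigma>)} \<in> sets ?P"
        using B[OF \<sigma>] by measurable
    qed
    also have "\<dots> \<le> exp (- (real (card I) * prob (B i \<sigma>) / 4))"
      by (rule empirical_frequency_tail[OF I(1) B[OF \<sigma>]])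
    also have "\<dots> \<le> exp (- (m * c i / 4))"
      using True m by (simp add: m_def mult_left_mono less_imp_le)
    also have "m * c i / 4 = real (k i) * ln (card J) + \<Gamma>"
      using m by (simp add: c_def)
    also have "exp (- \<dots>) = exp (- \<Gamma>) / real (card (W i))"
      unfolding cW using cJ by (simp add: exp_minus exp_add exp_of_nat_mult field_simps exp_diff)
    finally show ?thesis .
  qed
  define E where "E = space ?P - (\<Union>i\<le>q. \<Union>\<sigma>\<in>W i. F i \<sigma>)"
  have E: "E \<in> sets ?P"
    unfolding E_def using finW F by (intro sets.Diff sets.top sets.finite_UN) auto
  have "measure ?P (space ?P - E) \<le> (\<Sum>i\<le>q. \<Sum>\<sigma>\<in>W i. measure ?P (F i \<sigma>))"
  proof -
    have "space ?P - E = (\<Union>i\<le>q. \<Union>\<sigma>\<in>W i. F i \<sigma>)"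
      unfolding E_def F_def by auto
    also have "measure ?P \<dots> \<le> (\<Sum>i\<le>q. measure ?P (\<Union>\<sigma>\<in>W i. F i \<sigma>))"
      using finW F by (intro PP.finite_measure_subadditive_finite) (auto intro!: sets.finite_UN)
    also have "\<dots> \<le> (\<Sum>i\<le>q. \<Sum>\<sigma>\<in>W i. measure ?P (F i \<sigma>))"
      using finW F by (intro sum_mono PP.finite_measure_subadditive_finite) auto
    finally show ?thesis .
  qed
  also have "\<dots> \<le> (\<Sum>i\<le>q. \<Sum>\<sigma>\<in>W i. exp (- \<Gamma>) / real (card (W i)))"
    by (intro sum_mono Fle)
  also have "\<dots> \<le> (\<Sum>i\<le>q. exp (- \<Gamma>))"
    by (intro sum_mono) simp
  finally have mE: "measure ?P (space ?P - E) \<le> real (q + 1) * exp (- \<Gamma>)" by simp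
  have "expectation (\<lambda>p. (cmod (\<Sum>j\<in>J. of_real (l j) * \<psi> j p))\<^sup>2)
       \<le> 256 / 3 * ((\<Sum>i\<in>I. (cmod (\<Sum>j\<in>J. of_real (l j) * \<psi> j (t i)))\<^sup>2) / card I)
         + level_error k q \<Gamma> (card J) (card I)"
    if tE: "t \<in> E" and l: "\<forall>j\<in>J. 0 \<le> l j" "sum l J = 1" for t l
  proof -
    define g where "g = (\<lambda>p. \<Sum>j\<in>J. of_real (l j) * \<psi> j p)"
    have t: "t j \<in> space M" if "j \<in> I" for j
      using tE that by (auto simp: E_def space_PiM PiE_iff)
    have g[measurable]: "g \<in> borel_measurable M" unfolding g_def using meas by measurable
    have g1: "cmod (g p) \<le> 1" if "p \<in> space M" for p
    proof -
      have "cmod (g p) \<le> (\<Sum>j\<in>J. l j * 1)"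
        unfolding g_def using l bd[OF _ that]
        by (intro sum_norm_le) (auto simp: norm_mult intro!: mult_left_le)
      then show ?thesis using l by simp
    qed
    define G where "G = (\<lambda>n. {p \<in> space M. (1/2) ^ n < cmod (g p)})"
    have Gm[measurable]: "G n \<in> sets M" for n unfolding G_def by measurable
    have intG: "integrable M (\<lambda>p. (1/4) ^ i * indicat_real (G (i + 1)) p)" for i
      by (intro integrable_mult_right integrable_real_indicator) (auto simp: emeasure_eq_measure)
    have level: "prob (G (i + 1)) \<le> 4 * ((\<Sum>j\<in>I. of_bool ((1/2) ^ (i + 2) < cmod (g (t j)))) / m)
        + c i + 32 * exp (- (real (k i) * (1/4) ^ (i + 6)))" if i: "i \<le> q" for i
    proof -
      define bad where "bad = (\<lambda>\<sigma> p. (1/2) ^ (i + 3) < cmod (word_average (\<lambda>j. \<psi> j p) (k i) \<sigma> - g p))"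
      have eps4: "(1/2::real) ^ (i + 3) \<le> 4"
        using power_le_one[of "1/2::real" "i + 3"] by simp
      have "\<exists>\<sigma>\<in>{..<k i} \<rightarrow>\<^sub>E J. prob {p \<in> space M. bad \<sigma> p} + (\<Sum>j\<in>I. of_bool (bad \<sigma> (t j))) / card I
           \<le> 8 * exp (- (real (k i) * ((1/2) ^ (i + 3))\<^sup>2 / 64))"
        unfolding bad_def g_def
        by (rule word_average_approximation) (use J l meas bd k I t eps4 in auto)
      moreover have "((1/2::real) ^ (i + 3))\<^sup>2 / 64 = (1/4) ^ (i + 6)"
        by (simp add: quarter_power_eq power_add power_mult_distrib power_divide power2_eq_square flip: power_mult_distrib)
      ultimately obtain \<sigma> where \<sigma>: "\<sigma> \<in> W i" and
        ap: "prob {p \<in> space M. bad \<sigma> p} + (\<Sum>j\<in>I. of_bool (bad \<sigma> (t j))) / m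
           \<le> 8 * exp (- (real (k i) * (1/4) ^ (i + 6)))"
        unfolding m_def W_def by auto
      have [measurable]: "(\<lambda>p. word_average (\<lambda>j. \<psi> j p) (k i) \<sigma>) \<in> borel_measurable M"
        using meas \<sigma>[unfolded W_def] by (rule borel_measurable_word_average)
      have badm[measurable]: "{p \<in> space M. bad \<sigma> p} \<in> sets M" unfolding bad_def by measurable
      have s1: "G (i + 1) \<subseteq> B i \<sigma> \<union> {p \<in> space M. bad \<sigma> p}"
      proof
        fix p assume "p \<in> G (i + 1)"
        then have p: "p \<in> space M" "(1/2) ^ (i + 1) < cmod (g p)" by (auto simp: G_def)
        have "cmod (g p) \<le> cmod (word_average (\<lambda>j. \<psi> j p) (k i) \<sigma>)
            + cmod (word_average (\<lambda>j. \<psi> j p) (k i) \<sigma> - g p)"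
          by (metis add.commute norm_minus_commute norm_triangle_sub)
        then show "p \<in> B i \<sigma> \<union> {p \<in> space M. bad \<sigma> p}"
          using p by (auto simp: B_def bad_def power_add power3_eq_cube)
      qed
      have "prob (G (i + 1)) \<le> prob (B i \<sigma> \<union> {p \<in> space M. bad \<sigma> p})"
        using B[OF \<sigma>] by (intro finite_measure_mono s1) auto
      also have "\<dots> \<le> prob (B i \<sigma>) + prob {p \<in> space M. bad \<sigma> p}"
        using B[OF \<sigma>] by (intro measure_Un_le) auto
      also have "prob (B i \<sigma>) \<le> 4 * (\<Sum>j\<in>I. indicat_real (B i \<sigma>) (t j)) / m + c i"
      proof -
        \<comment> \<open>The word was chosen after the sample; this is legitimate because E
          excludes the failure events of all words.\<close>
        have "t \<notin> F i \<sigma>" "t \<in> space ?P" using tE i \<sigma> by (auto simp: E_def)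
        then show ?thesis by (auto simp: F_def not_less)
      qed
      also have "(\<Sum>j\<in>I. indicat_real (B i \<sigma>) (t j)) \<le>
         (\<Sum>j\<in>I. of_bool ((1/2) ^ (i + 2) < cmod (g (t j))) + of_bool (bad \<sigma> (t j)))"
      proof (rule sum_mono)
        fix j assume "j \<in> I"
        have "cmod (word_average (\<lambda>j'. \<psi> j' (t j)) (k i) \<sigma>) \<le> cmod (g (t j))
            + cmod (word_average (\<lambda>j'. \<psi> j' (t j)) (k i) \<sigma> - g (t j))"
          by (metis norm_triangle_sub)
        then show "indicat_real (B i \<sigma>) (t j) \<le>
            of_bool ((1/2) ^ (i + 2) < cmod (g (t j))) + of_bool (bad \<sigma> (t j))"
          by (auto simp: B_def bad_def power_add power3_eq_cube power2_eq_square indicator_def)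
      qed
      finally have "prob (G (i + 1)) \<le> 4 * ((\<Sum>j\<in>I. of_bool ((1/2) ^ (i + 2) < cmod (g (t j)))) / m)
          + c i + 4 * ((\<Sum>j\<in>I. of_bool (bad \<sigma> (t j))) / m) + prob {p \<in> space M. bad \<sigma> p}"
        using m by (simp add: sum.distrib divide_right_mono add_divide_distrib distrib_left)
      \<comment> \<open>The probability of the bad set also receives the coefficient 4, so that the
        joint bound on the two bad frequencies applies; 4 * 8 is the constant 32 of
        \<open>level_error\<close>.\<close>
      also have "\<dots> \<le> 4 * ((\<Sum>j\<in>I. of_bool ((1/2) ^ (i + 2) < cmod (g (t j)))) / m)
          + c i + 4 * (prob {p \<in> space M. bad \<sigma> p} + (\<Sum>j\<in>I. of_bool (bad \<sigma> (t j))) / m)"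
        using measure_nonneg[of M "{p \<in> space M. bad \<sigma> p}"] unfolding distrib_left by linarith
      also have "4 * (prob {p \<in> space M. bad \<sigma> p} + (\<Sum>j\<in>I. of_bool (bad \<sigma> (t j))) / m)
          \<le> 4 * (8 * exp (- (real (k i) * (1/4) ^ (i + 6))))"
        by (intro mult_left_mono ap) simp
      finally show ?thesis by simp
    qed
    have "expectation (\<lambda>p. (cmod (g p))\<^sup>2)
      \<le> expectation (\<lambda>p. (1/4) ^ (q + 1) + (\<Sum>i\<le>q. (1/4) ^ i * indicat_real (G (i + 1)) p))"
    proof (rule integral_mono)
      show "integrable M (\<lambda>p. (cmod (g p))\<^sup>2)"
        by (rule integrable_const_bound[where B = 1]) (use g1 in \<open>auto intro!: power_le_one\<close>)
      show "integrable M (\<lambda>p. (1/4) ^ (q + 1) + (\<Sum>i\<le>q. (1/4) ^ i * indicat_real (G (i + 1)) p))"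
        by (intro Bochner_Integration.integrable_add Bochner_Integration.integrable_sum intG) simp
      fix p assume p: "p \<in> space M"
      have "indicat_real (G (i + 1)) p = of_bool ((1/2) ^ (i + 1) < cmod (g p))" for i
        using p by (simp add: G_def indicator_def)
      then show "(cmod (g p))\<^sup>2 \<le> (1/4) ^ (q + 1) + (\<Sum>i\<le>q. (1/4) ^ i * indicat_real (G (i + 1)) p)"
        using square_le_dyadic_sum[of "cmod (g p)" q] g1[OF p] by simp
    qed
    also have "\<dots> = (1/4) ^ (q + 1) + (\<Sum>i\<le>q. (1/4) ^ i * prob (G (i + 1)))"
    proof -
      have "expectation (\<lambda>p. \<Sum>i\<le>q. (1/4) ^ i * indicat_real (G (i + 1)) p)
          = (\<Sum>i\<le>q. expectation (\<lambda>p. (1/4) ^ i * indicat_real (G (i + 1)) p))"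
        by (rule Bochner_Integration.integral_sum) (rule intG)
      moreover have "expectation (\<lambda>p. (1/4) ^ i * indicat_real (G (i + 1)) p) = (1/4) ^ i * prob (G (i + 1))" for i
        by (subst integral_mult_right_zero) simp
      moreover have "expectation (\<lambda>p. (1/4) ^ (q + 1)) = ((1/4) ^ (q + 1) :: real)"
        by (simp add: prob_space)
      ultimately show ?thesis
        by (subst Bochner_Integration.integral_add)
           (auto simp only: intro!: Bochner_Integration.integrable_sum intG integrable_const)
    qed
    also have "\<dots> \<le> (1/4) ^ (q + 1) + (\<Sum>i\<le>q. (1/4) ^ i *
        (4 * ((\<Sum>j\<in>I. of_bool ((1/2) ^ (i + 2) < cmod (g (t j)))) / m)
        + c i + 32 * exp (- (real (k i) * (1/4) ^ (i + 6)))))"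
      using level by (intro add_left_mono sum_mono mult_left_mono) auto
    also have "\<dots> = (1/4) ^ (q + 1) +
        4 * ((\<Sum>j\<in>I. \<Sum>i\<le>q. (1/4) ^ i * of_bool ((1/2) ^ (i + 2) < cmod (g (t j)))) / m)
        + (\<Sum>i\<le>q. (1/4) ^ i * (c i + 32 * exp (- (real (k i) * (1/4) ^ (i + 6)))))"
      by (subst sum.swap) (simp add: sum.distrib sum_distrib_left sum_divide_distrib distrib_left mult_ac)
    also have "\<dots> \<le> (1/4) ^ (q + 1) + 4 * ((\<Sum>j\<in>I. 64 / 3 * (cmod (g (t j)))\<^sup>2) / m)
        + (\<Sum>i\<le>q. (1/4) ^ i * (c i + 32 * exp (- (real (k i) * (1/4) ^ (i + 6)))))"
      using m by (intro add_mono order_refl mult_left_mono divide_right_mono sum_mono dyadic_sum_le_square) auto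
    also have "4 * ((\<Sum>j\<in>I. 64 / 3 * (cmod (g (t j)))\<^sup>2) / m) = 256 / 3 * ((\<Sum>j\<in>I. (cmod (g (t j)))\<^sup>2) / m)"
      unfolding sum_distrib_left[symmetric] by simp
    finally show ?thesis unfolding g_def m_def c_def level_error_def by linarith
  qed
  then show ?thesis using E mE by blast
qed


section \<open>Bounded orthonormal systems and infinite expansions\<close>

lemma has_sum_ennreal:
  assumes "(f has_sum l) A" "\<And>x. x \<in> A \<Longrightarrow> 0 \<le> f x"
  shows "((\<lambda>x. ennreal (f x)) has_sum ennreal l) A"
proof -
  have "((\<lambda>F. ennreal (sum f F)) \<longlongrightarrow> ennreal l) (finite_subsets_at_top A)"
    using assms(1) unfolding has_sum_def by (rule tendsto_ennrealI)
  moreover have "\<forall>\<^sub>F F in finite_subsets_at_top A. ennreal (sum f F) = (\<Sum>x\<in>F. ennreal (f x))"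
  proof (rule eventually_finite_subsets_at_top_weakI)
    fix F assume "finite F" "F \<subseteq> A"
    then show "ennreal (sum f F) = (\<Sum>x\<in>F. ennreal (f x))"
      using assms(2) by (intro sum_ennreal[symmetric]) auto
  qed
  ultimately show ?thesis
    unfolding has_sum_def by (rule Lim_transform_eventually)
qed

lemma infsum_ennreal:
  assumes "f summable_on A" "\<And>x. x \<in> A \<Longrightarrow> 0 \<le> f x"
  shows "(\<Sum>\<^sub>\<infinity>x\<in>A. ennreal (f x)) = ennreal (infsum f A)"
  using has_sum_ennreal[OF has_sum_infsum[OF assms(1)] assms(2)] by (rule infsumI)

lemma summable_on_if_infsum_ennreal_finite:
  assumes "(\<Sum>\<^sub>\<infinity>x\<in>A. ennreal (f x)) < \<infinity>" "\<And>x. x \<in> A \<Longrightarrow> 0 \<le> f x"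
  shows "f summable_on A"
proof (rule nonneg_bdd_above_summable_on)
  let ?T = "\<Sum>\<^sub>\<infinity>x\<in>A. ennreal (f x)"
  have "sum f F \<le> enn2real ?T" if F: "finite F" "F \<subseteq> A" for F
  proof -
    have "ennreal (sum f F) = (\<Sum>\<^sub>\<infinity>x\<in>F. ennreal (f x))"
      using F assms(2) by (simp add: sum_ennreal subset_iff)
    also have "\<dots> \<le> ?T"
      using F by (intro infsum_mono_neutral nonneg_summable_on_complete) auto
    finally have "enn2real (ennreal (sum f F)) \<le> enn2real ?T"
      using assms(1) by (intro enn2real_mono) auto
    then show ?thesis using F assms(2) by (simp add: sum_nonneg subset_iff)
  qed
  then show "bdd_above (sum f ` {F. F \<subseteq> A \<and> finite F})" by (auto intro!: bdd_aboveI)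
qed (use assms in auto)

lemma infsum_tail_small:
  fixes f :: "'a \<Rightarrow> real"
  assumes f: "f summable_on A" "\<And>x. x \<in> A \<Longrightarrow> 0 \<le> f x" and e: "0 < e"
  shows "\<exists>F. finite F \<and> F \<subseteq> A \<and> infsum f (A - F) < e"
proof -
  have "(sum f \<longlongrightarrow> infsum f A) (finite_subsets_at_top A)"
    using has_sum_infsum[OF f(1)] by (simp add: has_sum_def)
  then have "\<forall>\<^sub>F F in finite_subsets_at_top A. dist (sum f F) (infsum f A) < e"
    using e by (rule tendstoD)
  then obtain F where F: "finite F" "F \<subseteq> A" "dist (sum f F) (infsum f A) < e"
    unfolding eventually_finite_subsets_at_top by blast
  have "infsum f A = infsum f (F \<union> (A - F))" using F by (intro arg_cong[where f = "infsum f"]) auto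
  also have "\<dots> = infsum f F + infsum f (A - F)"
    using F f(1) by (intro infsum_Un_disjoint summable_on_subset[OF f(1)]) auto
  finally have "infsum f (A - F) = infsum f A - sum f F" using F by simp
  then show ?thesis using F by (intro exI[of _ F]) (auto simp: dist_real_def)
qed

lemma sum_squares_le_square_sum:
  fixes a :: "'a \<Rightarrow> real"
  assumes "finite F" "\<And>i. i \<in> F \<Longrightarrow> 0 \<le> a i"
  shows "(\<Sum>i\<in>F. (a i)\<^sup>2) \<le> (sum a F)\<^sup>2"
proof -
  have "(\<Sum>i\<in>F. (a i)\<^sup>2) \<le> (\<Sum>i\<in>F. a i * sum a F)"
    unfolding power2_eq_square using assms by (intro sum_mono mult_left_mono member_le_sum) auto
  then show ?thesis by (simp add: power2_eq_square sum_distrib_right)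
qed

text \<open>Orthonormality is used through the identity of Parseval for finite sums only; infinite
  expansions are uniform limits because the weights dominate the sup norms.\<close>

locale bounded_orthonormal = prob_space M for M :: "'p measure" +
  fixes \<phi> :: "'i \<Rightarrow> 'p \<Rightarrow> complex" and A :: "'i set" and w :: "'i \<Rightarrow> real"
  assumes meas [measurable]: "\<And>i. \<phi> i \<in> borel_measurable M"
    and bound: "\<And>i p. i \<in> A \<Longrightarrow> p \<in> space M \<Longrightarrow> cmod (\<phi> i p) \<le> w i"
    and w_ge_1: "\<And>i. i \<in> A \<Longrightarrow> 1 \<le> w i"
    and orth_int: "\<And>i j. i \<in> A \<Longrightarrow> j \<in> A \<Longrightarrow> integrable M (\<lambda>p. \<phi> i p * cnj (\<phi> j p))"
    and orth: "\<And>i j. i \<in> A \<Longrightarrow> j \<in> A \<Longrightarrow> (LINT p|M. \<phi> i p * cnj (\<phi> j p)) = of_bool (i = j)"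
begin

lemma w_pos: "i \<in> A \<Longrightarrow> 0 < w i"
  using w_ge_1[of i] by simp

lemma weighted_nonneg: "i \<in> A \<Longrightarrow> 0 \<le> w i * cmod z"
  using w_pos[of i] by simp

lemma term_bound: "i \<in> A \<Longrightarrow> p \<in> space M \<Longrightarrow> norm (z * \<phi> i p) \<le> w i * cmod z"
  using mult_left_mono[OF bound[of i p], of "cmod z"] by (simp add: norm_mult mult.commute)

lemma parseval:
  assumes F: "finite F" "F \<subseteq> A"
  shows "integrable M (\<lambda>p. (cmod (\<Sum>i\<in>F. v i * \<phi> i p))\<^sup>2)"
    and "expectation (\<lambda>p. (cmod (\<Sum>i\<in>F. v i * \<phi> i p))\<^sup>2) = (\<Sum>i\<in>F. (cmod (v i))\<^sup>2)"
proof -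
  have eq: "complex_of_real ((cmod (\<Sum>i\<in>F. v i * \<phi> i p))\<^sup>2)
      = (\<Sum>i\<in>F. \<Sum>j\<in>F. (v i * cnj (v j)) * (\<phi> i p * cnj (\<phi> j p)))" for p
    unfolding complex_norm_square cnj_sum sum_product by (simp add: mult_ac)
  have int: "integrable M (\<lambda>p. (v i * cnj (v j)) * (\<phi> i p * cnj (\<phi> j p)))" if "i \<in> F" "j \<in> F" for i j
    using orth_int[of i j] that F by (intro integrable_mult_right) auto
  have "integrable M (\<lambda>p. \<Sum>i\<in>F. \<Sum>j\<in>F. (v i * cnj (v j)) * (\<phi> i p * cnj (\<phi> j p)))"
    by (intro Bochner_Integration.integrable_sum int)
  then have I: "integrable M (\<lambda>p. complex_of_real ((cmod (\<Sum>i\<in>F. v i * \<phi> i p))\<^sup>2))"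
    unfolding eq .
  from integrable_Re[OF this] show I': "integrable M (\<lambda>p. (cmod (\<Sum>i\<in>F. v i * \<phi> i p))\<^sup>2)"
    by (simp only: Re_complex_of_real)
  have "complex_of_real (expectation (\<lambda>p. (cmod (\<Sum>i\<in>F. v i * \<phi> i p))\<^sup>2))
      = (LINT p|M. (\<Sum>i\<in>F. \<Sum>j\<in>F. (v i * cnj (v j)) * (\<phi> i p * cnj (\<phi> j p))))"
    unfolding eq[symmetric] by (rule integral_complex_of_real[symmetric])
  also have "\<dots> = (\<Sum>i\<in>F. \<Sum>j\<in>F. (v i * cnj (v j)) * (LINT p|M. \<phi> i p * cnj (\<phi> j p)))"
    by (subst Bochner_Integration.integral_sum, intro Bochner_Integration.integrable_sum int, assumption+)
       (intro sum.cong refl, subst Bochner_Integration.integral_sum, rule int, assumption+, simp)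
  also have "\<dots> = (\<Sum>i\<in>F. \<Sum>j\<in>F. (v i * cnj (v j)) * of_bool (i = j))"
    using F by (intro sum.cong refl) (auto simp: orth subset_iff)
  also have "\<dots> = (\<Sum>i\<in>F. v i * cnj (v i))"
    using F(1) by (simp add: of_bool_def if_distrib sum.delta cong: if_cong)
  also have "\<dots> = of_real (\<Sum>i\<in>F. (cmod (v i))\<^sup>2)"
    by (simp only: of_real_sum complex_norm_square)
  finally show "expectation (\<lambda>p. (cmod (\<Sum>i\<in>F. v i * \<phi> i p))\<^sup>2) = (\<Sum>i\<in>F. (cmod (v i))\<^sup>2)"
    by (simp only: of_real_eq_iff)
qed

lemma expansion_abs_summable:
  assumes "(\<lambda>i. w i * cmod (x i)) summable_on B" "B \<subseteq> A" "p \<in> space M"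
  shows "(\<lambda>i. norm (x i * \<phi> i p)) summable_on B"
proof (rule summable_on_comparison_test[OF assms(1)])
  fix i assume "i \<in> B"
  then show "norm (x i * \<phi> i p) \<le> w i * cmod (x i)"
    using assms by (intro term_bound) auto
qed simp

lemma expansion_bound:
  assumes "(\<lambda>i. w i * cmod (x i)) summable_on B" "B \<subseteq> A" "p \<in> space M"
  shows "cmod (\<Sum>\<^sub>\<infinity>i\<in>B. x i * \<phi> i p) \<le> (\<Sum>\<^sub>\<infinity>i\<in>B. w i * cmod (x i))"
proof -
  have "cmod (\<Sum>\<^sub>\<infinity>i\<in>B. x i * \<phi> i p) \<le> (\<Sum>\<^sub>\<infinity>i\<in>B. norm (x i * \<phi> i p))"
    by (rule norm_infsum_bound[OF expansion_abs_summable[OF assms]])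
  also have "\<dots> \<le> (\<Sum>\<^sub>\<infinity>i\<in>B. w i * cmod (x i))"
  proof (rule infsum_mono[OF expansion_abs_summable[OF assms] assms(1)])
    fix i assume "i \<in> B"
    then show "norm (x i * \<phi> i p) \<le> w i * cmod (x i)"
      using assms by (intro term_bound) auto
  qed
  finally show ?thesis .
qed

lemma expansion_split:
  assumes "(\<lambda>i. w i * cmod (x i)) summable_on B" "B \<subseteq> A" "p \<in> space M" "finite F" "F \<subseteq> B"
  shows "(\<Sum>\<^sub>\<infinity>i\<in>B. x i * \<phi> i p) = (\<Sum>i\<in>F. x i * \<phi> i p) + (\<Sum>\<^sub>\<infinity>i\<in>B - F. x i * \<phi> i p)"
proof -
  have s: "(\<lambda>i. x i * \<phi> i p) summable_on B"
    by (rule abs_summable_summable[OF expansion_abs_summable]) fact+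
  have "(\<Sum>\<^sub>\<infinity>i\<in>B. x i * \<phi> i p) = (\<Sum>\<^sub>\<infinity>i\<in>F \<union> (B - F). x i * \<phi> i p)"
    using assms by (intro arg_cong[where f = "infsum _"]) auto
  also have "\<dots> = (\<Sum>\<^sub>\<infinity>i\<in>F. x i * \<phi> i p) + (\<Sum>\<^sub>\<infinity>i\<in>B - F. x i * \<phi> i p)"
    using assms by (intro infsum_Un_disjoint summable_on_subset[OF s]) auto
  finally show ?thesis using assms(4) by simp
qed

lemma expansion_uniform_approx:
  assumes x: "(\<lambda>i. w i * cmod (x i)) summable_on B" "B \<subseteq> A" and e: "0 < e"
  shows "\<exists>F. finite F \<and> F \<subseteq> B \<and>
    (\<forall>p\<in>space M. cmod ((\<Sum>\<^sub>\<infinity>i\<in>B. x i * \<phi> i p) - (\<Sum>i\<in>F. x i * \<phi> i p)) < e)"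
proof -
  have "\<exists>F. finite F \<and> F \<subseteq> B \<and> (\<Sum>\<^sub>\<infinity>i\<in>B - F. w i * cmod (x i)) < e"
    using x e by (intro infsum_tail_small weighted_nonneg) auto
  then obtain F where F: "finite F" "F \<subseteq> B" "(\<Sum>\<^sub>\<infinity>i\<in>B - F. w i * cmod (x i)) < e" by blast
  have "cmod ((\<Sum>\<^sub>\<infinity>i\<in>B. x i * \<phi> i p) - (\<Sum>i\<in>F. x i * \<phi> i p)) < e" if p: "p \<in> space M" for p
  proof -
    have "cmod (\<Sum>\<^sub>\<infinity>i\<in>B - F. x i * \<phi> i p) \<le> (\<Sum>\<^sub>\<infinity>i\<in>B - F. w i * cmod (x i))"
      using x p by (intro expansion_bound summable_on_subset[OF x(1)]) auto
    then show ?thesis using expansion_split[OF x p F(1,2)] F(3) by simp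
  qed
  then show ?thesis using F by blast
qed

lemma expansion_measurable:
  assumes x: "(\<lambda>i. w i * cmod (x i)) summable_on B" "B \<subseteq> A"
  shows "(\<lambda>p. \<Sum>\<^sub>\<infinity>i\<in>B. x i * \<phi> i p) \<in> borel_measurable M"
proof -
  have "\<forall>n. \<exists>F. finite F \<and> F \<subseteq> B \<and>
    (\<forall>p\<in>space M. cmod ((\<Sum>\<^sub>\<infinity>i\<in>B. x i * \<phi> i p) - (\<Sum>i\<in>F. x i * \<phi> i p)) < 1 / real (Suc n))"
    using expansion_uniform_approx[OF x] by simp
  then obtain F where F: "\<And>n p. p \<in> space M \<Longrightarrow>
      cmod ((\<Sum>\<^sub>\<infinity>i\<in>B. x i * \<phi> i p) - (\<Sum>i\<in>F n. x i * \<phi> i p)) < 1 / real (Suc n)"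
    by metis
  show ?thesis
  proof (rule borel_measurable_LIMSEQ_metric)
    show "(\<lambda>p. \<Sum>i\<in>F n. x i * \<phi> i p) \<in> borel_measurable M" for n by measurable
    fix p assume p: "p \<in> space M"
    have "(\<lambda>n. (\<Sum>i\<in>F n. x i * \<phi> i p) - (\<Sum>\<^sub>\<infinity>i\<in>B. x i * \<phi> i p)) \<longlonglongrightarrow> 0"
    proof (rule Lim_null_comparison)
      show "\<forall>\<^sub>F n in sequentially. norm ((\<Sum>i\<in>F n. x i * \<phi> i p) - (\<Sum>\<^sub>\<infinity>i\<in>B. x i * \<phi> i p)) \<le> 1 / real (Suc n)"
        using F[OF p] by (auto simp: norm_minus_commute intro!: always_eventually less_imp_le)
      show "(\<lambda>n. 1 / real (Suc n)) \<longlonglongrightarrow> 0"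
        by (rule LIMSEQ_Suc[OF lim_1_over_n])
    qed
    then show "(\<lambda>n. \<Sum>i\<in>F n. x i * \<phi> i p) \<longlonglongrightarrow> (\<Sum>\<^sub>\<infinity>i\<in>B. x i * \<phi> i p)"
      by (simp add: LIM_zero_iff)
  qed
qed

text \<open>Parseval for a uniformly close finite part, followed by the crude passage from squares
  to the square of the sum. The plain l1 norm is enough here, because on a tail it is smaller than
  the weighted one by the factor that is wanted.\<close>

lemma expansion_L2_bound:
  assumes x: "(\<lambda>i. w i * cmod (x i)) summable_on B" "B \<subseteq> A"
  shows "expectation (\<lambda>p. (cmod (\<Sum>\<^sub>\<infinity>i\<in>B. x i * \<phi> i p))\<^sup>2) \<le> (\<Sum>\<^sub>\<infinity>i\<in>B. cmod (x i))\<^sup>2"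
proof (rule field_le_epsilon)
  fix e :: real assume e: "0 < e"
  define r where "r = (\<lambda>p. \<Sum>\<^sub>\<infinity>i\<in>B. x i * \<phi> i p)"
  define \<eta> where "\<eta> = (\<Sum>\<^sub>\<infinity>i\<in>B. w i * cmod (x i))"
  have eta0: "0 \<le> \<eta>" unfolding \<eta>_def
    using x(2) by (intro infsum_nonneg weighted_nonneg) auto
  \<comment> \<open>The finite part is at most \<eta> + d <= \<eta> + 1, so changing it by d alters
    its square by at most d * (2 * \<eta> + 3).\<close>
  define d where "d = min 1 (e / (2 * \<eta> + 3))"
  have d: "0 < d" "d \<le> 1" "d * (2 * \<eta> + 3) \<le> e"
  proof -
    have "d * (2 * \<eta> + 3) \<le> e / (2 * \<eta> + 3) * (2 * \<eta> + 3)"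
      using eta0 by (intro mult_right_mono) (auto simp: d_def)
    then show "d * (2 * \<eta> + 3) \<le> e" using eta0 by simp
  qed (use e eta0 in \<open>auto simp: d_def\<close>)
  obtain F where F: "finite F" "F \<subseteq> B"
      "\<And>p. p \<in> space M \<Longrightarrow> cmod (r p - (\<Sum>i\<in>F. x i * \<phi> i p)) < d"
    unfolding r_def using expansion_uniform_approx[OF x d(1)] by blast
  have FA: "F \<subseteq> A" using F x by blast
  have rm[measurable]: "r \<in> borel_measurable M" unfolding r_def by (rule expansion_measurable[OF x])
  have rb: "cmod (r p) \<le> \<eta>" if "p \<in> space M" for p
    unfolding r_def \<eta>_def by (rule expansion_bound[OF x that])
  have xs: "(\<lambda>i. cmod (x i)) summable_on B"
  proof (rule summable_on_comparison_test[OF x(1)])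
    fix i assume "i \<in> B"
    then have "1 * cmod (x i) \<le> w i * cmod (x i)"
      using w_ge_1[of i] x(2) by (intro mult_right_mono) auto
    then show "cmod (x i) \<le> w i * cmod (x i)" by simp
  qed simp
  have "expectation (\<lambda>p. (cmod (r p))\<^sup>2) \<le> expectation (\<lambda>p. (cmod (\<Sum>i\<in>F. x i * \<phi> i p))\<^sup>2 + e)"
  proof (rule integral_mono)
    show "integrable M (\<lambda>p. (cmod (r p))\<^sup>2)"
    proof (rule integrable_const_bound[where B = "\<eta>\<^sup>2"])
      show "AE p in M. norm ((cmod (r p))\<^sup>2) \<le> \<eta>\<^sup>2"
        using rb by (auto intro!: AE_I2 power_mono)
    qed measurable
    show "integrable M (\<lambda>p. (cmod (\<Sum>i\<in>F. x i * \<phi> i p))\<^sup>2 + e)"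
      using parseval(1)[OF F(1) FA] by simp
    fix p assume p: "p \<in> space M"
    let ?g = "\<Sum>i\<in>F. x i * \<phi> i p"
    have "cmod (r p) \<le> cmod ?g + d" "cmod ?g \<le> cmod (r p) + d"
      using F(3)[OF p] norm_triangle_ineq2[of "r p" ?g] norm_triangle_ineq2[of ?g "r p"]
      by (auto simp: norm_minus_commute)
    have "(cmod (r p))\<^sup>2 \<le> (cmod ?g + d)\<^sup>2"
      using \<open>cmod (r p) \<le> cmod ?g + d\<close> by (intro power_mono) auto
    also have "\<dots> = (cmod ?g)\<^sup>2 + d * (2 * cmod ?g + d)" by (simp add: power2_eq_square algebra_simps)
    also have "d * (2 * cmod ?g + d) \<le> d * (2 * \<eta> + 3)"
      using d rb[OF p] \<open>cmod ?g \<le> cmod (r p) + d\<close> by (intro mult_left_mono) auto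
    finally show "(cmod (r p))\<^sup>2 \<le> (cmod ?g)\<^sup>2 + e" using d by linarith
  qed
  also have "\<dots> = (\<Sum>i\<in>F. (cmod (x i))\<^sup>2) + e"
    using parseval[OF F(1) FA, of x] by (simp add: prob_space)
  also have "(\<Sum>i\<in>F. (cmod (x i))\<^sup>2) \<le> (\<Sum>i\<in>F. cmod (x i))\<^sup>2"
    by (rule sum_squares_le_square_sum) (use F in auto)
  also have "(\<Sum>i\<in>F. cmod (x i))\<^sup>2 \<le> (\<Sum>\<^sub>\<infinity>i\<in>B. cmod (x i))\<^sup>2"
    using F xs by (intro power_mono finite_sum_le_infsum sum_nonneg) auto
  finally show "expectation (\<lambda>p. (cmod (\<Sum>\<^sub>\<infinity>i\<in>B. x i * \<phi> i p))\<^sup>2) \<le> (\<Sum>\<^sub>\<infinity>i\<in>B. cmod (x i))\<^sup>2 + e"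
    unfolding r_def by simp
qed

end

text \<open>A sublevel set of the objective lies in a product of closed discs on L and of the point
  0 elsewhere. That product is compact by Tychonoff although the index type may be infinite, and the
  objective depends continuously on finitely many coordinates.\<close>

lemma finite_support_minimizer:
  fixes F :: "('i \<Rightarrow> complex) set"
  assumes L: "finite L" and w: "\<And>i. i \<in> L \<Longrightarrow> 0 < w i"
    and F: "closed F" "F \<noteq> {}" "\<And>u i. u \<in> F \<Longrightarrow> i \<notin> L \<Longrightarrow> u i = 0"
  shows "\<exists>u\<in>F. \<forall>v\<in>F. (\<Sum>i\<in>L. w i * cmod (u i)) \<le> (\<Sum>i\<in>L. w i * cmod (v i))"
proof -
  obtain u0 where u0: "u0 \<in> F" using F by blast
  define B where "B = (\<Sum>i\<in>L. w i * cmod (u0 i))"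
  define N where "N = (\<lambda>u :: 'i \<Rightarrow> complex. \<Sum>i\<in>L. w i * cmod (u i))"
  define S where "S = (\<lambda>i. if i \<in> L then cball (0::complex) (B / w i) else {0})"
  have "compactin (product_topology (\<lambda>_. euclidean) UNIV) (PiE UNIV S)"
    by (subst compactin_PiE) (auto simp: S_def)
  then have K: "compact (PiE UNIV S)"
    by (simp add: euclidean_product_topology flip: compactin_euclidean_iff)
  have in_K: "u \<in> PiE UNIV S" if "u \<in> F" "N u \<le> B" for u
  proof -
    have "cmod (u i) \<le> B / w i" if i: "i \<in> L" for i
    proof -
      have "w i * cmod (u i) \<le> N u"
        unfolding N_def using i L w by (intro member_le_sum) (auto simp: less_imp_le)
      then show ?thesis using \<open>N u \<le> B\<close> w[OF i] by (simp add: field_simps)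
    qed
    then show ?thesis using F(3)[OF \<open>u \<in> F\<close>] by (auto simp: S_def PiE_iff)
  qed
  have cN: "continuous_on X N" for X
    unfolding N_def
    by (intro continuous_intros continuous_on_subset[OF continuous_on_product_coordinates]) auto
  have "compact (PiE UNIV S \<inter> F)" using K F(1) by (rule compact_Int_closed)
  moreover have "PiE UNIV S \<inter> F \<noteq> {}" using in_K[OF u0] u0 by (auto simp: N_def B_def)
  ultimately have "\<exists>u\<in>PiE UNIV S \<inter> F. \<forall>v\<in>PiE UNIV S \<inter> F. N u \<le> N v"
    by (rule continuous_attains_inf[OF _ _ cN])
  then obtain u where u: "u \<in> PiE UNIV S \<inter> F" "\<And>v. v \<in> PiE UNIV S \<inter> F \<Longrightarrow> N u \<le> N v"
    by metis
  have NB: "N u0 = B" by (simp add: N_def B_def)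
  then have "u0 \<in> PiE UNIV S \<inter> F" using in_K[OF u0] u0 by simp
  then have "N u \<le> B" using u(2) NB by metis
  have "N u \<le> N v" if "v \<in> F" for v
  proof (cases "N v \<le> B")
    case True
    then show ?thesis using u(2) in_K[OF that] that by blast
  next
    case False
    then show ?thesis using \<open>N u \<le> B\<close> by simp
  qed
  then show ?thesis using u(1) unfolding N_def by blast
qed


section \<open>Restricted lower isometry and weighted minimization\<close>

text \<open>Halving z guarantees that the four directions need total weight (|Re z| + |Im z|) / 2 <=
  |z|. The slack is spread equally over them, which changes nothing because 1, i, -1, -i add up to
  0. Total weight exactly |z| is what a convex combination requires.\<close>

lemma complex_as_quarter_turns:
  fixes z :: complex
  obtains c :: "nat \<Rightarrow> real" where "\<And>a. 0 \<le> c a" "(\<Sum>a<4. c a) = cmod z"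
    "(\<Sum>a<4. of_real (c a) * \<i> ^ a) = z / 2"
proof -
  define e where "e = (cmod z - (\<bar>Re z\<bar> + \<bar>Im z\<bar>) / 2) / 4"
  define c where "c = (\<lambda>a::nat. e + (if a = 0 then \<bar>Re z\<bar> + Re z else if a = 1 then \<bar>Im z\<bar> + Im z
     else if a = 2 then \<bar>Re z\<bar> - Re z else \<bar>Im z\<bar> - Im z) / 4)"
  have "0 \<le> e" using abs_Re_le_cmod[of z] abs_Im_le_cmod[of z] by (simp add: e_def)
  then have 1: "0 \<le> c a" for a by (auto simp: c_def)
  have set4: "{..<4::nat} = {0, 1, 2, 3}" by auto
  have 2: "(\<Sum>a<4. c a) = cmod z" by (simp add: set4 c_def e_def) (simp add: field_simps)
  have 3: "(\<Sum>a<4. of_real (c a) * \<i> ^ a) = z / 2"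
    by (simp add: set4 c_def complex_eq_iff power3_eq_cube) (simp add: field_simps)
  show thesis by (rule that[OF 1 2 3])
qed

text \<open>Minimality puts the error \<open>y - x\<close> into a cone around \<open>S\<close>; there the restricted lower bound
  \<open>rip\<close> closes because the constant of its weighted term is below \<open>1/2\<close>.\<close>

lemma weighted_l1_recovery:
  fixes x y :: "'i \<Rightarrow> complex"
  assumes L: "finite L" "S \<subseteq> L" and w: "\<And>i. i \<in> L \<Longrightarrow> 0 \<le> w i"
    and s: "0 < s" "(\<Sum>i\<in>S. (w i)\<^sup>2) \<le> s"
    and min: "(\<Sum>i\<in>L. w i * cmod (y i)) \<le> (\<Sum>i\<in>L. w i * cmod (x i))"
    and rip: "sqrt (\<Sum>i\<in>L. (cmod (y i - x i))\<^sup>2) \<le> b / sqrt s + (\<Sum>i\<in>L. w i * cmod (y i - x i)) / (4 * sqrt s)"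
  shows "(\<Sum>i\<in>L. w i * cmod (y i - x i)) \<le> 4 * b + 4 * (\<Sum>i\<in>L - S. w i * cmod (x i))"
    and "sqrt (\<Sum>i\<in>L. (cmod (y i - x i))\<^sup>2) \<le> (2 * b + (\<Sum>i\<in>L - S. w i * cmod (x i))) / sqrt s"
proof -
  define v where "v = (\<lambda>i. y i - x i)"
  define N where "N = sqrt (\<Sum>i\<in>L. (cmod (v i))\<^sup>2)"
  define V where "V = (\<Sum>i\<in>L. w i * cmod (v i))"
  define \<tau> where "\<tau> = (\<Sum>i\<in>L - S. w i * cmod (x i))"
  define VS where "VS = (\<Sum>i\<in>S. w i * cmod (v i))"
  have split: "(\<Sum>i\<in>L. f i) = (\<Sum>i\<in>L - S. f i) + (\<Sum>i\<in>S. f i)" for f :: "'i \<Rightarrow> real"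
    using L by (rule sum.subset_diff[rotated])
  have "(\<Sum>i\<in>S. w i * cmod (x i)) - VS \<le> (\<Sum>i\<in>S. w i * cmod (y i))"
    unfolding VS_def sum_subtractf[symmetric]
  proof (intro sum_mono)
    fix i assume "i \<in> S"
    then have "w i * (cmod (x i) - cmod (v i)) \<le> w i * cmod (y i)"
      using w[of i] L norm_triangle_ineq2[of "x i" "y i"]
      by (intro mult_left_mono) (auto simp: v_def norm_minus_commute)
    then show "w i * cmod (x i) - w i * cmod (v i) \<le> w i * cmod (y i)" by (simp add: algebra_simps)
  qed
  moreover have "(\<Sum>i\<in>L - S. w i * cmod (v i)) - \<tau> \<le> (\<Sum>i\<in>L - S. w i * cmod (y i))"
    unfolding \<tau>_def sum_subtractf[symmetric]
  proof (intro sum_mono)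
    fix i assume "i \<in> L - S"
    then have "w i * (cmod (v i) - cmod (x i)) \<le> w i * cmod (y i)"
      using w[of i] norm_triangle_ineq4[of "y i" "x i"]
      by (intro mult_left_mono) (auto simp: v_def)
    then show "w i * cmod (v i) - w i * cmod (x i) \<le> w i * cmod (y i)" by (simp add: algebra_simps)
  qed
  ultimately have "(\<Sum>i\<in>L - S. w i * cmod (v i)) \<le> VS + 2 * \<tau>"
    using min split[of "\<lambda>i. w i * cmod (x i)"] split[of "\<lambda>i. w i * cmod (y i)"] by (simp add: \<tau>_def)
  then have V: "V \<le> 2 * VS + 2 * \<tau>"
    using split[of "\<lambda>i. w i * cmod (v i)"] by (simp add: V_def VS_def)
  have "VS \<le> sqrt (\<Sum>i\<in>S. (w i)\<^sup>2) * sqrt (\<Sum>i\<in>S. (cmod (v i))\<^sup>2)"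
    using L2_set_mult_ineq[of w "\<lambda>i. cmod (v i)" S] w L unfolding VS_def L2_set_def
    by (simp add: subset_iff)
  also have "\<dots> \<le> sqrt s * N"
    unfolding N_def using s L
    by (intro mult_mono real_sqrt_le_mono sum_mono2 sum_nonneg real_sqrt_ge_zero) auto
  finally have "VS \<le> sqrt s * N" .
  moreover have N: "N \<le> b / sqrt s + V / (4 * sqrt s)"
    using rip by (simp add: N_def V_def v_def)
  moreover have "sqrt s * (b / sqrt s + V / (4 * sqrt s)) = b + V / 4"
    using s by (simp add: distrib_left)
  ultimately have "VS \<le> b + V / 4"
    using mult_left_mono[OF N, of "sqrt s"] s by simp
  then have V4: "V \<le> 4 * b + 4 * \<tau>" using V by simp
  then show "(\<Sum>i\<in>L. w i * cmod (y i - x i)) \<le> 4 * b + 4 * (\<Sum>i\<in>L - S. w i * cmod (x i))"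
    by (simp add: V_def v_def \<tau>_def)
  have "b / sqrt s + V / (4 * sqrt s) = (b + V / 4) / sqrt s" by (simp add: add_divide_distrib)
  also have "\<dots> \<le> (2 * b + \<tau>) / sqrt s" using V4 s by (intro divide_right_mono) auto
  finally show "sqrt (\<Sum>i\<in>L. (cmod (y i - x i))\<^sup>2) \<le> (2 * b + (\<Sum>i\<in>L - S. w i * cmod (x i))) / sqrt s"
    using N by (simp add: N_def v_def \<tau>_def)
qed

context bounded_orthonormal
begin

text \<open>The hull has the vertices i^a \<phi>_j / w_j with four quarter turns each. A family of
  weighted norm V gives 2 * V times a hull point, the 2 coming from
  \<open>complex_as_quarter_turns\<close>; undoing this scaling in squares multiplies the hull error
  by 4 V^2.\<close>

lemma lower_isometry_event:
  fixes k :: "nat \<Rightarrow> nat" and q :: nat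
  assumes L: "finite L" "L \<noteq> {}" "L \<subseteq> A" and I: "finite I" "I \<noteq> {}"
    and k: "\<And>i. 0 < k i" and Gam: "0 \<le> \<Gamma>"
  shows "\<exists>E\<in>sets (PiM I (\<lambda>_. M)).
     measure (PiM I (\<lambda>_. M)) (space (PiM I (\<lambda>_. M)) - E) \<le> real (q + 1) * exp (- \<Gamma>) \<and>
     (\<forall>t\<in>E. \<forall>v. (\<Sum>i\<in>L. (cmod (v i))\<^sup>2)
       \<le> 256 / 3 * ((\<Sum>j\<in>I. (cmod (\<Sum>i\<in>L. v i * \<phi> i (t j)))\<^sup>2) / card I)
         + 4 * level_error k q \<Gamma> (4 * card L) (card I) * (\<Sum>i\<in>L. w i * cmod (v i))\<^sup>2)"
proof -
  define J where "J = L \<times> {..<4::nat}"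
  define \<psi> where "\<psi> = (\<lambda>(i, a) p. \<i> ^ a * \<phi> i p / of_real (w i))"
  obtain i0 where "i0 \<in> L" using L by blast
  then have "(i0, 0) \<in> J" by (simp add: J_def)
  then have J: "finite J" "J \<noteq> {}" using L(1) unfolding J_def by (blast intro: finite_cartesian_product)+
  define \<rho> where "\<rho> = level_error k q \<Gamma> (4 * card L) (card I)"
  have cJ: "real (card J) = 4 * card L" unfolding J_def card_cartesian_product by simp
  have meas\<psi>: "\<psi> j \<in> borel_measurable M" for j
    unfolding \<psi>_def by (cases j) simp
  have bd\<psi>: "cmod (\<psi> j p) \<le> 1" if "j \<in> J" "p \<in> space M" for j p
    using that bound[of "fst j" p] w_pos[of "fst j"] L
    by (auto simp: \<psi>_def J_def norm_divide norm_mult norm_power subset_iff)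
  have "\<exists>E\<in>sets (PiM I (\<lambda>_. M)).
     measure (PiM I (\<lambda>_. M)) (space (PiM I (\<lambda>_. M)) - E) \<le> real (q + 1) * exp (- \<Gamma>) \<and>
     (\<forall>t\<in>E. \<forall>l. (\<forall>j\<in>J. 0 \<le> l j) \<longrightarrow> sum l J = 1 \<longrightarrow>
       expectation (\<lambda>p. (cmod (\<Sum>j\<in>J. of_real (l j) * \<psi> j p))\<^sup>2)
       \<le> 256 / 3 * ((\<Sum>i\<in>I. (cmod (\<Sum>j\<in>J. of_real (l j) * \<psi> j (t i)))\<^sup>2) / card I)
         + level_error k q \<Gamma> (card J) (card I))"
    by (rule convex_hull_empirical_lower_bound[OF J meas\<psi> bd\<psi> I k Gam])
  then obtain E where E: "E \<in> sets (PiM I (\<lambda>_. M))"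
      "measure (PiM I (\<lambda>_. M)) (space (PiM I (\<lambda>_. M)) - E) \<le> real (q + 1) * exp (- \<Gamma>)"
    and hull': "\<forall>t\<in>E. \<forall>l. (\<forall>j\<in>J. 0 \<le> l j) \<longrightarrow> sum l J = 1 \<longrightarrow>
       expectation (\<lambda>p. (cmod (\<Sum>j\<in>J. of_real (l j) * \<psi> j p))\<^sup>2)
       \<le> 256 / 3 * ((\<Sum>i\<in>I. (cmod (\<Sum>j\<in>J. of_real (l j) * \<psi> j (t i)))\<^sup>2) / card I)
         + level_error k q \<Gamma> (card J) (card I)"
    by (elim bexE conjE)
  have hull: "expectation (\<lambda>p. (cmod (\<Sum>j\<in>J. of_real (l j) * \<psi> j p))\<^sup>2)
       \<le> 256 / 3 * ((\<Sum>i\<in>I. (cmod (\<Sum>j\<in>J. of_real (l j) * \<psi> j (t i)))\<^sup>2) / card I) + \<rho>"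
    if "t \<in> E" "\<And>j. j \<in> J \<Longrightarrow> 0 \<le> l j" "sum l J = 1" for t l
    unfolding \<rho>_def cJ[symmetric]
    by (rule hull'[rule_format, OF that(1) _ that(3)]) (rule that(2))
  have "(\<Sum>i\<in>L. (cmod (v i))\<^sup>2)
       \<le> 256 / 3 * ((\<Sum>j\<in>I. (cmod (\<Sum>i\<in>L. v i * \<phi> i (t j)))\<^sup>2) / card I)
         + 4 * level_error k q \<Gamma> (4 * card L) (card I) * (\<Sum>i\<in>L. w i * cmod (v i))\<^sup>2" if t: "t \<in> E" for t v
  proof (cases "(\<Sum>i\<in>L. w i * cmod (v i)) = 0")
    case True
    have "v i = 0" if "i \<in> L" for i
    proof -
      have "\<forall>i\<in>L. w i * cmod (v i) = 0"
        using True L weighted_nonneg by (subst (asm) sum_nonneg_eq_0_iff) auto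
      moreover have "w i \<noteq> 0" using that L w_pos[of i] by auto
      ultimately show ?thesis using that by auto
    qed
    then show ?thesis by simp
  next
    case False
    define V where "V = (\<Sum>i\<in>L. w i * cmod (v i))"
    have V: "0 < V"
    proof -
      have "0 \<le> V" unfolding V_def using L weighted_nonneg by (intro sum_nonneg) auto
      then show ?thesis using False by (simp add: V_def)
    qed
    define z where "z = (\<lambda>i. of_real (w i / V) * v i)"
    have "\<forall>i. \<exists>c. (\<forall>a::nat. 0 \<le> c a) \<and> (\<Sum>a<4. c a) = cmod (z i) \<and>
        (\<Sum>a<4. of_real (c a) * \<i> ^ a) = z i / 2"
      by (metis complex_as_quarter_turns)
    then obtain c where c: "\<And>i (a::nat). 0 \<le> c i a" "\<And>i. (\<Sum>a<4. c i a) = cmod (z i)"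
      "\<And>i. (\<Sum>a<4. of_real (c i a) * \<i> ^ a) = z i / 2" by metis
    define l where "l = (\<lambda>(i, a). c i a)"
    have suml: "sum l J = 1"
    proof -
      have "sum l J = (\<Sum>i\<in>L. cmod (z i))"
        unfolding J_def l_def by (simp add: c(2) flip: sum.cartesian_product)
      also have "\<dots> = (\<Sum>i\<in>L. w i * cmod (v i) / V)"
        using L V w_pos by (intro sum.cong) (auto simp: z_def norm_mult norm_divide abs_of_pos subset_iff)
      also have "\<dots> = 1" using V by (simp add: V_def flip: sum_divide_distrib)
      finally show ?thesis .
    qed
    have g: "(\<Sum>j\<in>J. of_real (l j) * \<psi> j p) = (\<Sum>i\<in>L. v i * \<phi> i p) / of_real (2 * V)" for p
    proof -
      have "(\<Sum>j\<in>J. of_real (l j) * \<psi> j p)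
          = (\<Sum>i\<in>L. \<Sum>a<4. of_real (c i a) * (\<i> ^ a * \<phi> i p / of_real (w i)))"
        unfolding J_def l_def \<psi>_def by (simp add: sum.cartesian_product case_prod_unfold)
      also have "\<dots> = (\<Sum>i\<in>L. (\<Sum>a<4. of_real (c i a) * \<i> ^ a) * (\<phi> i p / of_real (w i)))"
        unfolding sum_distrib_right by (intro sum.cong refl) (simp add: mult_ac)
      also have "\<dots> = (\<Sum>i\<in>L. v i * \<phi> i p / of_real (2 * V))"
      proof (rule sum.cong[OF refl])
        fix i assume "i \<in> L"
        then have "w i \<noteq> 0" using L w_pos[of i] by auto
        then show "(\<Sum>a<4. of_real (c i a) * \<i> ^ a) * (\<phi> i p / of_real (w i)) = v i * \<phi> i p / of_real (2 * V)"
          using V unfolding c(3) z_def by (simp add: field_simps)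
      qed
      finally show ?thesis by (simp add: sum_divide_distrib)
    qed
    have sq: "(cmod (u / of_real (2 * V)))\<^sup>2 = (cmod u)\<^sup>2 / (4 * V\<^sup>2)" for u
      using V by (simp add: norm_divide norm_mult power_divide power_mult_distrib)
    have "expectation (\<lambda>p. (cmod (\<Sum>j\<in>J. of_real (l j) * \<psi> j p))\<^sup>2)
       \<le> 256 / 3 * ((\<Sum>i\<in>I. (cmod (\<Sum>j\<in>J. of_real (l j) * \<psi> j (t i)))\<^sup>2) / card I) + \<rho>"
      by (rule hull[OF t _ suml]) (use c(1) in \<open>auto simp: l_def\<close>)
    then have "(\<Sum>i\<in>L. (cmod (v i))\<^sup>2) / (4 * V\<^sup>2)
       \<le> 256 / 3 * ((\<Sum>j\<in>I. (cmod (\<Sum>i\<in>L. v i * \<phi> i (t j)))\<^sup>2) / (4 * V\<^sup>2) / card I) + \<rho>"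
      unfolding g sq using parseval(2)[OF L(1,3), of v] by (simp add: sum_divide_distrib)
    then have "4 * V\<^sup>2 * ((\<Sum>i\<in>L. (cmod (v i))\<^sup>2) / (4 * V\<^sup>2))
       \<le> 4 * V\<^sup>2 * (256 / 3 * ((\<Sum>j\<in>I. (cmod (\<Sum>i\<in>L. v i * \<phi> i (t j)))\<^sup>2) / (4 * V\<^sup>2) / card I) + \<rho>)"
      using V by (intro mult_left_mono) auto
    then show ?thesis using V unfolding V_def[symmetric] \<rho>_def[symmetric] by (simp add: distrib_left mult_ac)
  qed
  then show ?thesis using E by blast
qed

text \<open>After division by \<eta>^2 the squared tail lies in [0, 1] and has mean at most 1 / (C^2
  s), whereas the event asks for an empirical mean above 1/s. The ratio C^2 > 1 is the entire
  gain.\<close>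

lemma residual_event:
  assumes x: "(\<lambda>i. w i * cmod (x i)) summable_on B" "B \<subseteq> A" and C: "1 < C" and s: "0 < s"
    and W: "\<And>i. i \<in> B \<Longrightarrow> C * sqrt s \<le> w i" and I: "finite I"
  defines "\<eta> \<equiv> (\<Sum>\<^sub>\<infinity>i\<in>B. w i * cmod (x i))"
  shows "(\<Sum>\<^sub>\<infinity>i\<in>B. cmod (x i)) \<le> \<eta> / (C * sqrt s)"
    and "measure (PiM I (\<lambda>_. M)) {t \<in> space (PiM I (\<lambda>_. M)).
       real (card I) * \<eta>\<^sup>2 / s < (\<Sum>j\<in>I. (cmod (\<Sum>\<^sub>\<infinity>i\<in>B. x i * \<phi> i (t j)))\<^sup>2)}
     \<le> exp (- (real (card I) / s * (ln (C\<^sup>2) - 1 + 1 / C\<^sup>2)))"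
proof -
  interpret P: prob_space "PiM I (\<lambda>_. M)" by (rule prob_space_PiM) (rule prob_space_axioms)
  define r where "r = (\<lambda>p. \<Sum>\<^sub>\<infinity>i\<in>B. x i * \<phi> i p)"
  have rm[measurable]: "r \<in> borel_measurable M" unfolding r_def by (rule expansion_measurable[OF x])
  have rb: "cmod (r p) \<le> \<eta>" if "p \<in> space M" for p
    unfolding r_def \<eta>_def by (rule expansion_bound[OF x that])
  have eta0: "0 \<le> \<eta>" unfolding \<eta>_def
    using x(2) by (intro infsum_nonneg weighted_nonneg) auto
  have Cs: "0 < C * sqrt s" using C s by simp
  have le: "cmod (x i) \<le> (w i * cmod (x i)) / (C * sqrt s)" if "i \<in> B" for i
    using mult_right_mono[OF W[OF that], of "cmod (x i)"] Cs by (simp add: field_simps)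
  have xd: "(\<lambda>i. (w i * cmod (x i)) / (C * sqrt s)) summable_on B"
    using x(1) by (simp only: divide_inverse) (rule summable_on_cmult_left)
  have xs: "(\<lambda>i. cmod (x i)) summable_on B"
    by (rule summable_on_comparison_test[OF xd le]) auto
  have "(\<Sum>\<^sub>\<infinity>i\<in>B. cmod (x i)) \<le> (\<Sum>\<^sub>\<infinity>i\<in>B. (w i * cmod (x i)) / (C * sqrt s))"
    by (rule infsum_mono[OF xs xd le])
  also have "\<dots> = \<eta> / (C * sqrt s)"
    unfolding \<eta>_def divide_inverse by (rule infsum_cmult_left) (use x in auto)
  finally show A1: "(\<Sum>\<^sub>\<infinity>i\<in>B. cmod (x i)) \<le> \<eta> / (C * sqrt s)" .
  show "measure (PiM I (\<lambda>_. M)) {t \<in> space (PiM I (\<lambda>_. M)).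
       real (card I) * \<eta>\<^sup>2 / s < (\<Sum>j\<in>I. (cmod (\<Sum>\<^sub>\<infinity>i\<in>B. x i * \<phi> i (t j)))\<^sup>2)}
     \<le> exp (- (real (card I) / s * (ln (C\<^sup>2) - 1 + 1 / C\<^sup>2)))"
  proof (cases "\<eta> = 0")
    case True
    have "r (t j) = 0" if "t \<in> space (PiM I (\<lambda>_. M))" "j \<in> I" for t j
      using rb[of "t j"] True that by (auto simp: space_PiM PiE_iff)
    then have "{t \<in> space (PiM I (\<lambda>_. M)). real (card I) * \<eta>\<^sup>2 / s < (\<Sum>j\<in>I. (cmod (r (t j)))\<^sup>2)} = {}"
      using True by auto
    from this[unfolded r_def] show ?thesis by (simp only: measure_empty exp_ge_zero)
  next
    case False
    then have eta: "0 < \<eta>" using eta0 by simp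
    define X where "X = (\<lambda>p. (cmod (r p))\<^sup>2 / \<eta>\<^sup>2)"
    have Xm[measurable]: "X \<in> borel_measurable M" unfolding X_def by measurable
    have X01: "0 \<le> X p \<and> X p \<le> 1" if "p \<in> space M" for p
      using rb[OF that] eta by (auto simp: X_def divide_le_eq intro!: power_mono)
    have C2: "1 < C\<^sup>2" using C by (simp add: one_less_power)
    have "expectation X = expectation (\<lambda>p. (cmod (r p))\<^sup>2) / \<eta>\<^sup>2"
      unfolding X_def by simp
    also have "\<dots> \<le> (\<eta> / (C * sqrt s))\<^sup>2 / \<eta>\<^sup>2"
    proof (intro divide_right_mono)
      have "expectation (\<lambda>p. (cmod (r p))\<^sup>2) \<le> (\<Sum>\<^sub>\<infinity>i\<in>B. cmod (x i))\<^sup>2"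
        unfolding r_def by (rule expansion_L2_bound[OF x])
      also have "\<dots> \<le> (\<eta> / (C * sqrt s))\<^sup>2"
        using A1 by (intro power_mono infsum_nonneg) auto
      finally show "expectation (\<lambda>p. (cmod (r p))\<^sup>2) \<le> (\<eta> / (C * sqrt s))\<^sup>2" .
    qed simp
    also have "\<dots> = 1 / (C\<^sup>2 * s)"
      using eta s by (simp add: power_divide power_mult_distrib)
    finally have EX: "expectation X \<le> 1 / (C\<^sup>2 * s)" .
    \<comment> \<open>Here ln C^2 is the minimizer over c of (exp c - 1) / (C^2 s) - c / s.\<close>
    have "(exp (ln (C\<^sup>2)) - 1) * expectation X \<le> (C\<^sup>2 - 1) * (1 / (C\<^sup>2 * s))"
      using C2 EX by (simp only: exp_ln) (intro mult_left_mono, auto)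
    from iid_sum_tail[OF I Xm X01 this, of "ln (C\<^sup>2) * (real (card I) / s)"]
    have "measure (PiM I (\<lambda>_. M)) {t \<in> space (PiM I (\<lambda>_. M)).
        ln (C\<^sup>2) * (real (card I) / s) \<le> ln (C\<^sup>2) * (\<Sum>j\<in>I. X (t j))}
      \<le> exp (real (card I) * ((C\<^sup>2 - 1) * (1 / (C\<^sup>2 * s))) - ln (C\<^sup>2) * (real (card I) / s))"
      by simp
    also have "real (card I) * ((C\<^sup>2 - 1) * (1 / (C\<^sup>2 * s))) - ln (C\<^sup>2) * (real (card I) / s)
      = - (real (card I) / s * (ln (C\<^sup>2) - 1 + 1 / C\<^sup>2))"
    proof -
      have "(D - 1) * (1 / (D * s)) = 1 / s * (1 - 1 / D)" if "1 < D" for D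
        using that s by (simp add: field_simps)
      from this[OF C2] show ?thesis by (simp add: algebra_simps diff_divide_distrib add_divide_distrib)
    qed
    finally have "measure (PiM I (\<lambda>_. M)) {t \<in> space (PiM I (\<lambda>_. M)).
        ln (C\<^sup>2) * (real (card I) / s) \<le> ln (C\<^sup>2) * (\<Sum>j\<in>I. X (t j))}
      \<le> exp (- (real (card I) / s * (ln (C\<^sup>2) - 1 + 1 / C\<^sup>2)))" .
    moreover have "measure (PiM I (\<lambda>_. M)) {t \<in> space (PiM I (\<lambda>_. M)).
          real (card I) * \<eta>\<^sup>2 / s < (\<Sum>j\<in>I. (cmod (r (t j)))\<^sup>2)}
      \<le> measure (PiM I (\<lambda>_. M)) {t \<in> space (PiM I (\<lambda>_. M)).
        ln (C\<^sup>2) * (real (card I) / s) \<le> ln (C\<^sup>2) * (\<Sum>j\<in>I. X (t j))}"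
    proof (rule P.finite_measure_mono)
      have "ln (C\<^sup>2) * (real (card I) / s) \<le> ln (C\<^sup>2) * (\<Sum>j\<in>I. X (t j))"
        if "real (card I) * \<eta>\<^sup>2 / s < (\<Sum>j\<in>I. (cmod (r (t j)))\<^sup>2)" for t
      proof (rule mult_left_mono)
        have "real (card I) / s = real (card I) * \<eta>\<^sup>2 / s / \<eta>\<^sup>2" using eta by simp
        also have "\<dots> \<le> (\<Sum>j\<in>I. (cmod (r (t j)))\<^sup>2) / \<eta>\<^sup>2" using that by (intro divide_right_mono) auto
        finally show "real (card I) / s \<le> (\<Sum>j\<in>I. X (t j))" by (simp add: X_def sum_divide_distrib)
      qed (use C2 in simp)
      then show "{t \<in> space (PiM I (\<lambda>_. M)). real (card I) * \<eta>\<^sup>2 / s < (\<Sum>j\<in>I. (cmod (r (t j)))\<^sup>2)}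
        \<subseteq> {t \<in> space (PiM I (\<lambda>_. M)). ln (C\<^sup>2) * (real (card I) / s) \<le> ln (C\<^sup>2) * (\<Sum>j\<in>I. X (t j))}"
        by auto
    qed measurable
    ultimately show ?thesis unfolding r_def by simp
  qed
qed

end


section \<open>Spherical parameters\<close>

lemma spherical_bounded_orthonormal:
  assumes C: "C \<ge> 1"
    and sup: "\<forall>l k. \<bar>k\<bar> \<le> int l \<longrightarrow>
           sup_norm (Ztilde (l, k)) \<le> ennreal (C * max 1 (real l) powr (1/6))"
  shows "bounded_orthonormal nu Ztilde idx (weight C)"
proof -
  have p1: "1 \<le> max 1 (real l) powr (1/6)" for l by (rule ge_one_powr_ge_zero) auto
  interpret prob_space nu by (rule prob_space_nu)
  show ?thesis
  proof
    show "Ztilde i \<in> borel_measurable nu" for i by (intro measurable_nu Ztilde_measurable)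
    show "cmod (Ztilde i p) \<le> weight C i" if "i \<in> idx" "p \<in> space nu" for i p
    proof -
      obtain l k where i: "i = (l, k)" by (cases i)
      have "ennreal (cmod (Ztilde (l, k) p)) \<le> sup_norm (Ztilde (l, k))"
        unfolding sup_norm_def using that by (intro SUP_upper) auto
      also have "\<dots> \<le> ennreal (weight C i)"
        using sup that i by (simp add: weight_def idx_def)
      finally show ?thesis using C by (simp add: i weight_def)
    qed
    show "1 \<le> weight C i" if "i \<in> idx" for i
      using mult_mono[OF C p1] C by (cases i) (auto simp: weight_def)
  qed (use Ztilde_orthonormal in auto)
qed

text \<open>Zonal functions share the preconditioner, so their quotients are Legendre polynomials in
  the cosine; only degrees 0 to 2 enter the proof of C > 1.\<close>

lemma Ztilde_zonal:
  "Ztilde (1, 0) p = of_real (sqrt 3 * cos (snd p)) * Ztilde (0, 0) p"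
  "Ztilde (2, 0) p = of_real (sqrt 5 / 2 * (3 * (cos (snd p))\<^sup>2 - 1)) * Ztilde (0, 0) p"
proof -
  have a0: "assoc_legendre 0 0 t = 1" for t by (simp add: assoc_legendre_def)
  have a1: "assoc_legendre 1 0 t = t" for t
    by (simp add: assoc_legendre_def pderiv_pCons)
  have a2: "assoc_legendre 2 0 t = (3 * t\<^sup>2 - 1) / 2" for t
    by (simp add: assoc_legendre_def numeral_2_eq_2 pderiv_pCons pderiv_mult field_simps power2_eq_square)
  have s: "sqrt (3 / (4 * pi)) = sqrt 3 * sqrt (1 / (4 * pi))" "sqrt (5 / (4 * pi)) = sqrt 5 * sqrt (1 / (4 * pi))"
    by (simp_all add: real_sqrt_divide)
  show "Ztilde (1, 0) p = of_real (sqrt 3 * cos (snd p)) * Ztilde (0, 0) p"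
    unfolding Ztilde_eq by (simp add: sph_amp_def a0 a1[simplified] s)
  show "Ztilde (2, 0) p = of_real (sqrt 5 / 2 * (3 * (cos (snd p))\<^sup>2 - 1)) * Ztilde (0, 0) p"
    unfolding Ztilde_eq by (simp add: sph_amp_def a0 a2 s)
qed

text \<open>If the uniform bound were \<open>1\<close> in degrees \<open>0\<close> and \<open>1\<close>, normalization would force
  \<open>3 cos\<^sup>2 \<theta> = 1\<close> almost everywhere, and the zonal function of degree \<open>2\<close> would vanish.\<close>

lemma uniform_bound_gt_one:
  assumes C: "C \<ge> 1"
    and sup: "\<forall>l k. \<bar>k\<bar> \<le> int l \<longrightarrow>
           sup_norm (Ztilde (l, k)) \<le> ennreal (C * max 1 (real l) powr (1/6))"
  shows "C > 1"
proof (rule ccontr)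
  assume "\<not> C > 1"
  then have C1: "C = 1" using C by simp
  interpret bounded_orthonormal nu Ztilde idx "weight C"
    by (rule spherical_bounded_orthonormal[OF assms])
  have norm1: "integrable nu (\<lambda>p. (cmod (Ztilde i p))\<^sup>2)" "(LINT p|nu. (cmod (Ztilde i p))\<^sup>2) = 1"
    if "i \<in> idx" for i
    using parseval[of "{i}" "\<lambda>_. 1"] that by simp_all
  have ae: "AE p in nu. (cmod (Ztilde i p))\<^sup>2 = 1" if i: "i \<in> idx" "weight C i = 1" for i
  proof -
    have le: "(cmod (Ztilde i p))\<^sup>2 \<le> 1" if "p \<in> space nu" for p
      using bound[OF i(1) that] i(2) by (simp add: power_le_one)
    \<comment> \<open>Nonnegative with integral 0: a function bounded by 1 with mean square 1 has
      modulus 1 almost everywhere.\<close>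
    have "(LINT p|nu. 1 - (cmod (Ztilde i p))\<^sup>2) = 0"
      using norm1[OF i(1)] by (subst Bochner_Integration.integral_diff) (auto simp: prob_space[simplified])
    then have "AE p in nu. 1 - (cmod (Ztilde i p))\<^sup>2 = 0"
      using norm1[OF i(1)] le by (subst (asm) integral_nonneg_eq_0_iff_AE) auto
    then show ?thesis by simp
  qed
  have ae0: "AE p in nu. (cmod (Ztilde (0, 0) p))\<^sup>2 = 1"
    and ae1: "AE p in nu. (cmod (Ztilde (1, 0) p))\<^sup>2 = 1"
    by (rule ae; simp add: idx_def weight_def C1)+
  have "AE p in nu. (cmod (Ztilde (2, 0) p))\<^sup>2 = 0"
    using ae0 ae1
  proof eventually_elim
    case (elim p)
    then have "3 * (cos (snd p))\<^sup>2 = 1"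
      unfolding Ztilde_zonal by (simp add: norm_mult power_mult_distrib)
    then show ?case unfolding Ztilde_zonal by simp
  qed
  then have "(LINT p|nu. (cmod (Ztilde (2, 0) p))\<^sup>2) = (LINT p|nu. 0)"
    by (intro integral_cong_AE) auto
  then show False using norm1(2)[of "(2, 0)"] by (simp add: idx_def)
qed

section \<open>Size of the index set and choice of parameters\<close>

lemma Lambda0_subset: "Lambda0 s \<subseteq> idx"
  by (auto simp: Lambda0_def idx_def)

lemma finite_Lambda0: "finite (Lambda0 s)"
  and card_Lambda0_le: "0 \<le> s \<Longrightarrow> real (card (Lambda0 s)) \<le> (s ^ 3 + 1)\<^sup>2"
  and card_Lambda0_pos: "0 \<le> s \<Longrightarrow> 0 < card (Lambda0 s)"
proof -
  define n where "n = nat \<lfloor>s ^ 3\<rfloor>"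
  define T where "T = (SIGMA l:{..n}. {- int l..int l})"
  have sub: "Lambda0 s \<subseteq> T"
    by (auto simp: Lambda0_def T_def n_def le_nat_floor abs_le_iff le_floor_iff)
  have fT: "finite T" by (auto simp: T_def)
  show fin: "finite (Lambda0 s)" using sub fT by (rule finite_subset)
  have "card T = (\<Sum>l\<le>n. 2 * l + 1)" unfolding T_def by (subst card_SigmaI) (auto intro!: sum.cong)
  also have "\<dots> = (n + 1)\<^sup>2" by (induction n) (auto simp: power2_eq_square)
  finally have cT: "card T = (n + 1)\<^sup>2" .
  assume s: "0 \<le> s"
  have "real (card (Lambda0 s)) \<le> (real n + 1)\<^sup>2"
    using card_mono[OF fT sub] unfolding cT by (metis of_nat_1 of_nat_add of_nat_le_iff of_nat_power)
  also have "\<dots> \<le> (s ^ 3 + 1)\<^sup>2" using s by (intro power_mono add_right_mono) (auto simp: n_def)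
  finally show "real (card (Lambda0 s)) \<le> (s ^ 3 + 1)\<^sup>2" .
  have "(0, 0) \<in> Lambda0 s" using s by (simp add: Lambda0_def)
  then show "0 < card (Lambda0 s)" using fin by (auto simp: card_gt_0_iff)
qed

lemma ln_card_bound:
  fixes N :: real
  assumes s: "1 \<le> s" and N: "1 \<le> N" "N \<le> (s ^ 3 + 1)\<^sup>2"
  shows "0 \<le> ln N" "ln N \<le> 6 * ln s + 2"
proof -
  show "0 \<le> ln N" using N by simp
  have l2: "ln 2 \<le> (1::real)" using ln_add_one_self_le_self[of "1::real"] by simp
  have "N \<le> (2 * s ^ 3)\<^sup>2"
    using N(2) s by (elim order_trans) (intro power_mono, auto)
  then have "ln N \<le> ln ((2 * s ^ 3)\<^sup>2)" using N s by (subst ln_le_cancel_iff) auto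
  also have "\<dots> = 2 * ln (2 * s ^ 3)" using s ln_realpow[of "2 * s ^ 3" 2] by simp
  also have "ln (2 * s ^ 3) = ln 2 + 3 * ln s" using s by (simp add: ln_mult ln_realpow)
  finally show "ln N \<le> 6 * ln s + 2" using l2 by simp
qed

text \<open>Turns the allowed failure probability into a quartic exponent in ln s, against which the
  Chernoff exponents can be compared.\<close>

lemma card_powr_lower_bound:
  fixes N :: real
  assumes "1 \<le> s" "1 \<le> N" "N \<le> (s ^ 3 + 1)\<^sup>2"
  shows "exp (- (ln s ^ 3 * (6 * ln s + 2))) \<le> N powr (- (ln s ^ 3))"
proof -
  have "ln s ^ 3 * ln N \<le> ln s ^ 3 * (6 * ln s + 2)"
    using assms ln_card_bound[OF assms] by (intro mult_left_mono) auto
  then show ?thesis using assms by (simp add: powr_def mult.commute)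
qed

text \<open>For small ln s the bound in terms of ln^4 s says nothing, but m >= 1 and s <= 3 give m/s
  >= 1/3, more than the tiny required exponent. Otherwise ln s exceeds a fixed positive number and
  the quartic bound dominates.\<close>

lemma residual_failure_small:
  fixes \<kappa> :: real
  assumes k: "0 < \<kappa>"
  shows "\<exists>c>0. \<forall>s m N. 1 \<le> s \<longrightarrow> 1 \<le> m \<longrightarrow> c * s * ln s ^ 4 \<le> m \<longrightarrow> 1 \<le> N \<longrightarrow> N \<le> (s ^ 3 + 1)\<^sup>2 \<longrightarrow>
     exp (- (m / s * \<kappa>)) < N powr (- (ln s ^ 3))"
proof -
  \<comment> \<open>The required exponent is then at most 8 * x1, and 8/25 < 1/3.\<close>
  define x1 where "x1 = min 1 (\<kappa> / 25)"
  have x1: "0 < x1" "x1 \<le> 1" "25 * x1 \<le> \<kappa>" using k by (auto simp: x1_def)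
  define c where "c = (9 + 2 / x1) / \<kappa>"
  have c: "0 < c" using x1 k by (auto simp: c_def intro!: divide_pos_pos add_pos_pos)
  have "exp (- (m / s * \<kappa>)) < N powr (- (ln s ^ 3))"
    if s: "1 \<le> s" and m: "1 \<le> m" "c * s * ln s ^ 4 \<le> m" and N: "1 \<le> N" "N \<le> (s ^ 3 + 1)\<^sup>2" for s m N
  proof -
    define x where "x = ln s"
    have x0: "0 \<le> x" using s by (simp add: x_def)
    have "x ^ 3 * (6 * x + 2) < m / s * \<kappa>"
    proof (cases "x \<le> x1")
      case True
      have "x ^ 3 * (6 * x + 2) \<le> x * (6 * 1 + 2)"
      proof (rule mult_mono)
        have "x ^ 3 \<le> x ^ 1" using x0 True x1 by (intro power_decreasing) auto
        then show "x ^ 3 \<le> x" by simp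
      qed (use x0 True x1 in auto)
      also have "\<dots> \<le> 8 * x1" using True by simp
      also have "\<dots> < 1 / 3 * \<kappa>" using x1 by simp
      also have "\<dots> \<le> m / s * \<kappa>"
      proof (rule mult_right_mono)
        have "s = exp x" using s by (simp add: x_def)
        also have "\<dots> \<le> exp 1" using True x1 by simp
        also have "\<dots> \<le> 3" by (rule exp_le)
        finally have "s \<le> 3" .
        then have "1 / 3 \<le> 1 / s" using s by (intro divide_left_mono) auto
        also have "\<dots> \<le> m / s" using m s by (intro divide_right_mono) auto
        finally show "1 / 3 \<le> m / s" .
      qed (use k in simp)
      finally show ?thesis .
    next
      case False
      then have x: "0 < x" "x1 < x" using x1 by auto
      have "2 \<le> (2 / x1) * x" using x x1 by (simp add: field_simps)
      then have "6 * x + 2 < (9 + 2 / x1) * x" using x by (simp add: distrib_right)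
      also have "\<dots> = c * \<kappa> * x" using k by (simp add: c_def)
      finally have "x ^ 3 * (6 * x + 2) < x ^ 3 * (c * \<kappa> * x)" using x by simp
      also have "\<dots> = c * s * x ^ 4 / s * \<kappa>" using s by (simp add: power4_eq_xxxx power3_eq_cube)
      also have "\<dots> \<le> m / s * \<kappa>" using m s k unfolding x_def by (intro mult_right_mono divide_right_mono) auto
      finally show ?thesis .
    qed
    then have "exp (- (m / s * \<kappa>)) < exp (- (x ^ 3 * (6 * x + 2)))" by simp
    also have "\<dots> \<le> N powr (- (ln s ^ 3))"
      unfolding x_def by (rule card_powr_lower_bound[OF s N])
    finally show ?thesis .
  qed
  then show ?thesis using c by blast
qed

text \<open>The cubic term is (number of levels) times \<open>4^(-i) k i\<close> times the logarithm of the number of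
  functions, where \<open>8192 = 2 * 4^6\<close> comes from rounding \<open>k i\<close>; the rest is the failure exponent.\<close>

definition level_sum :: "real \<Rightarrow> real" where
  "level_sum x = 8192 * ((x + 10) * (x + 13) * (6 * x + 4)) + 4/3 * (x ^ 3 * (6 * x + 2) + x + 12)"

text \<open>Away from 0 lower powers can be charged to the fourth one: x is replaced by y = D * x,
  which is at least 1 and at least x.\<close>

lemma level_sum_dominated:
  assumes L: "0 < L"
  shows "\<exists>K>0. \<forall>x\<ge>L. x ^ 3 * (6 * x + 2) + 2 \<le> K * x ^ 4 \<and> level_sum x \<le> K * x ^ 4"
proof -
  define D where "D = max 1 (1 / L)"
  \<comment> \<open>1540 = 11 * 14 * 10 bounds the three linear factors, and 28 = 4/3 * (8 + 1 + 12)
    the failure exponent.\<close>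
  define K where "K = (8192 * 1540 + 28) * D ^ 4"
  have D: "1 \<le> D" by (simp add: D_def)
  have "x ^ 3 * (6 * x + 2) + 2 \<le> K * x ^ 4 \<and> level_sum x \<le> K * x ^ 4" if x: "L \<le> x" for x
  proof -
    define y where "y = D * x"
    have x0: "0 < x" using L x by simp
    have "1 \<le> 1 / L * x" using x L by (simp add: field_simps)
    also have "\<dots> \<le> y" unfolding y_def using x0 by (intro mult_right_mono) (auto simp: D_def)
    finally have y1: "1 \<le> y" .
    have xy: "x \<le> y" using D x0 by (simp add: y_def)
    have x3: "x ^ 3 \<le> y ^ 3" using xy x0 by (intro power_mono) auto
    have y4: "1 \<le> y ^ 4" "y \<le> y ^ 4" "y ^ 3 \<le> y ^ 4"
      using y1 power_increasing[of 1 4 y] power_increasing[of 3 4 y] by auto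
    have cube: "x ^ 3 * (6 * x + 2) \<le> 8 * y ^ 4"
    proof -
      have "x ^ 3 * (6 * x + 2) \<le> y ^ 3 * (8 * y)"
        using x3 xy y1 x0 by (intro mult_mono) auto
      then show ?thesis by (simp add: power4_eq_xxxx power3_eq_cube)
    qed
    have quad: "(x + 10) * (x + 13) * (6 * x + 4) \<le> 1540 * y ^ 4"
    proof -
      have "(x + 10) * (x + 13) * (6 * x + 4) \<le> (11 * y) * (14 * y) * (10 * y)"
        using xy y1 x0 by (intro mult_mono mult_nonneg_nonneg) auto
      also have "\<dots> = 1540 * y ^ 3" by (simp add: power3_eq_cube)
      finally show ?thesis using y4 by simp
    qed
    have Ky: "K * x ^ 4 = (8192 * 1540 + 28) * y ^ 4" by (simp add: K_def y_def power_mult_distrib)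
    show ?thesis unfolding Ky level_sum_def using cube quad y4 xy by (auto simp: algebra_simps)
  qed
  moreover have "0 < K" using D by (simp add: K_def)
  ultimately show ?thesis by blast
qed

text \<open>The budget 1 / (64 * s) for \<open>level_error\<close> is split into three equal shares
  1 / (192 * s). The cutoff meets its share because 4^(q+1) >= exp (x + 8) and exp 8 >= 192. The
  replacement by averages costs 32 * exp (-(x + 13)) <= 1 / (256 * s) per level, times 4/3 from the
  geometric weights. Sampling gets the third share from m, as 768 = 4 * 192. In \<Gamma> the
  logarithm cancels the number of levels, and the final 2 leaves room for adding the failure of the
  tail bound.\<close>

lemma level_parameters:
  fixes s m N :: real
  assumes s: "1 \<le> s" and N: "1 \<le> N" "N \<le> (s ^ 3 + 1)\<^sup>2" and m: "0 < m" "768 * s * level_sum (ln s) \<le> m"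
  defines "x \<equiv> ln s"
  defines "q \<equiv> nat \<lceil>x + 8\<rceil>" and "k \<equiv> \<lambda>i. nat \<lceil>4 ^ (i + 6) * (x + 13)\<rceil>"
    and "\<Gamma> \<equiv> x ^ 3 * (6 * x + 2) + ln (real (nat \<lceil>x + 8\<rceil> + 1)) + 2"
  shows "4 * level_error k q \<Gamma> (4 * N) m \<le> 1 / (16 * s)"
    and "0 < k i" and "0 \<le> \<Gamma>"
    and "real (q + 1) * exp (- \<Gamma>) = exp (- (x ^ 3 * (6 * x + 2) + 2))"
proof -
  have x0: "0 \<le> x" using s by (simp add: x_def)
  have sx: "s = exp x" using s by (simp add: x_def)
  have "1 < 4 ^ (i + 6) * (x + 13)" for i
  proof -
    have "1 * 1 < (4::real) ^ (i + 6) * (x + 13)"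
      using x0 by (intro mult_le_less_imp_less) auto
    then show ?thesis by simp
  qed
  note k1 = this
  show k0: "0 < k i" for i using k1[of i] unfolding k_def by simp
  show G0: "0 \<le> \<Gamma>" using x0 unfolding \<Gamma>_def by (intro add_nonneg_nonneg mult_nonneg_nonneg) auto
  have q: "x + 8 \<le> real q" "real q + 1 \<le> x + 10" using x0 unfolding q_def by linarith+
  show "real (q + 1) * exp (- \<Gamma>) = exp (- (x ^ 3 * (6 * x + 2) + 2))"
  proof -
    have "- \<Gamma> = - (x ^ 3 * (6 * x + 2) + 2) - ln (real (q + 1))"
      unfolding \<Gamma>_def q_def by simp
    then have "exp (- \<Gamma>) = exp (- (x ^ 3 * (6 * x + 2) + 2)) / exp (ln (real (q + 1)))"
      by (simp only: exp_diff)
    also have "exp (ln (real (q + 1))) = real (q + 1)" by (rule exp_ln) simp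
    finally show ?thesis by simp
  qed
  have "ln (real (q + 1)) \<le> x + 10" using ln_add_one_self_le_self[of "real q"] q by (simp add: add.commute)
  then have G: "\<Gamma> \<le> x ^ 3 * (6 * x + 2) + x + 12" unfolding \<Gamma>_def q_def[symmetric] by simp
  have e2: "2 \<le> exp (1::real)" using exp_ge_add_one_self[of "1::real"] by simp
  have pe: "2 ^ n \<le> exp (real n)" for n
    using power_mono[OF e2, of n] by (simp add: exp_of_nat_mult[symmetric])
  have A: "(1/4) ^ (q + 1) \<le> 1 / (192 * s)"
  proof -
    have "192 * s \<le> exp 8 * exp x" unfolding sx using pe[of 8] by (intro mult_right_mono) auto
    also have "\<dots> = exp (x + 8)" by (simp add: exp_add)
    also have "\<dots> \<le> exp (real q)" using q by simp
    also have "\<dots> = exp 1 ^ q" by (simp add: exp_of_nat_mult[symmetric])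
    also have "\<dots> \<le> 4 ^ q" using exp_le by (intro power_mono) auto
    also have "\<dots> \<le> 4 ^ (q + 1)" by simp
    finally have "1 / 4 ^ (q + 1) \<le> 1 / (192 * s)" using s by (intro divide_left_mono) auto
    then show ?thesis by (simp add: power_one_over)
  qed
  have B: "32 * exp (- (real (k i) * (1/4) ^ (i + 6))) \<le> 1 / (256 * s)" for i
  proof -
    have "4 ^ (i + 6) * (x + 13) \<le> real (k i)" using k1[of i] unfolding k_def by linarith
    then have "4 ^ (i + 6) * (x + 13) * (1/4) ^ (i + 6) \<le> real (k i) * (1/4) ^ (i + 6)"
      by (intro mult_right_mono) auto
    moreover have "4 ^ (i + 6) * (x + 13) * (1/4) ^ (i + 6) = x + 13"
      by (simp add: power_one_over)
    ultimately have "exp (- (real (k i) * (1/4) ^ (i + 6))) \<le> exp (- (x + 13))" by simp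
    also have "\<dots> = 1 / (exp 13 * s)" unfolding sx by (simp add: exp_minus exp_add exp_diff field_simps)
    also have "\<dots> \<le> 1 / (8192 * s)" using pe[of 13] s by (intro divide_left_mono mult_right_mono) auto
    finally show ?thesis by simp
  qed
  have lnM: "0 \<le> ln (4 * N)" "ln (4 * N) \<le> 6 * x + 4"
  proof -
    have "ln (4::real) \<le> 2"
      using ln_add_one_self_le_self[of "1::real"] ln_realpow[of "2::real" 2] by simp
    then show "ln (4 * N) \<le> 6 * x + 4" using ln_card_bound[OF s N] N by (simp add: ln_mult x_def)
    show "0 \<le> ln (4 * N)" using N by simp
  qed
  have ki: "(1/4) ^ i * real (k i) \<le> 8192 * (x + 13)" for i
  proof -
    have "real (k i) \<le> 2 * (4 ^ (i + 6) * (x + 13))" using k1[of i] unfolding k_def by linarith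
    then have "(1/4) ^ i * real (k i) \<le> (1/4) ^ i * (2 * (4 ^ (i + 6) * (x + 13)))"
      by (intro mult_left_mono) auto
    also have "\<dots> = 8192 * (x + 13)" by (simp add: power_add power_one_over)
    finally show ?thesis .
  qed
  have geo: "(\<Sum>i\<le>q. (1/4) ^ i) \<le> (4/3 :: real)"
  proof -
    have "(\<Sum>i\<le>n. (1/4) ^ i) = 4/3 - (1/4::real) ^ n / 3" for n by (induction n) auto
    then show ?thesis by simp
  qed
  define U where "U = 4 / m * (8192 * (x + 13) * (6 * x + 4))"
  define W where "W = 4 * \<Gamma> / m + 1 / (256 * s)"
  have U0: "0 \<le> U" unfolding U_def using m x0 by (intro mult_nonneg_nonneg divide_nonneg_nonneg) auto
  have W0: "0 \<le> W" using G0 m s by (simp add: W_def)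
  have "(\<Sum>i\<le>q. (1/4) ^ i * (4 * (real (k i) * ln (4 * N) + \<Gamma>) / m
              + 32 * exp (- (real (k i) * (1/4) ^ (i + 6))))) \<le> (\<Sum>i\<le>q. U + (1/4) ^ i * W)"
  proof (rule sum_mono)
    fix i
    have "(1/4) ^ i * (4 * (real (k i) * ln (4 * N) + \<Gamma>) / m + 32 * exp (- (real (k i) * (1/4) ^ (i + 6))))
      = 4 / m * (((1/4) ^ i * real (k i)) * ln (4 * N)) + (1/4) ^ i * (4 * \<Gamma> / m + 32 * exp (- (real (k i) * (1/4) ^ (i + 6))))"
      by (simp add: algebra_simps add_divide_distrib)
    also have "\<dots> \<le> 4 / m * ((8192 * (x + 13)) * (6 * x + 4)) + (1/4) ^ i * W"
      unfolding W_def using m x0 lnM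
      by (intro add_mono mult_left_mono mult_mono ki B order_refl) auto
    finally show "(1/4) ^ i * (4 * (real (k i) * ln (4 * N) + \<Gamma>) / m + 32 * exp (- (real (k i) * (1/4) ^ (i + 6))))
      \<le> U + (1/4) ^ i * W" by (simp add: U_def)
  qed
  also have "\<dots> = (real q + 1) * U + (\<Sum>i\<le>q. (1/4) ^ i) * W"
    by (simp add: sum.distrib sum_distrib_right)
  also have "\<dots> \<le> (x + 10) * U + 4/3 * W"
    by (intro add_mono mult_right_mono q geo W0 U0)
  finally have S: "(\<Sum>i\<le>q. (1/4) ^ i * (4 * (real (k i) * ln (4 * N) + \<Gamma>) / m
              + 32 * exp (- (real (k i) * (1/4) ^ (i + 6))))) \<le> (x + 10) * U + 4/3 * W" .
  have "(x + 10) * U + 4/3 * W = 4 / m * (8192 * ((x + 10) * (x + 13) * (6 * x + 4)) + 4/3 * \<Gamma>) + 1 / (192 * s)"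
    by (simp add: U_def W_def algebra_simps add_divide_distrib)
  also have "\<dots> \<le> 4 / m * level_sum x + 1 / (192 * s)"
    unfolding level_sum_def using G m by (intro add_right_mono mult_left_mono add_left_mono) auto
  also have "4 / m * level_sum x \<le> 1 / (192 * s)"
    using m s unfolding x_def[symmetric] by (simp add: field_simps)
  finally have T: "(x + 10) * U + 4/3 * W \<le> 1 / (192 * s) + 1 / (192 * s)" by simp
  have "1 / (16 * s) = 4 * (1 / (192 * s) + (1 / (192 * s) + 1 / (192 * s)))" by (simp add: field_simps)
  moreover have "4 * (a + S') \<le> e" if "e = 4 * (d + (d + d))" "S' \<le> X" "a \<le> d" "X \<le> d + d"
    for a S' d e X :: real using that by simp
  ultimately show "4 * level_error k q \<Gamma> (4 * N) m \<le> 1 / (16 * s)"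
    unfolding level_error_def using S A T by blast
qed


section \<open>Recovery from a good sample\<close>

text \<open>The infimum defining \<open>best_approx\<close> need not be attained, so error bounds
  are proved for each sparse competitor and passed on by this lemma.\<close>

lemma ennreal_le_mult_INF:
  fixes X :: ennreal
  assumes K: "0 < K" and le: "\<And>z. z \<in> S \<Longrightarrow> X \<le> ennreal K * g z"
  shows "X \<le> ennreal K * (INF z\<in>S. g z)"
proof -
  have "X / ennreal K \<le> (INF z\<in>S. g z)"
  proof (rule INF_greatest)
    fix z assume "z \<in> S"
    from le[OF this] show "X / ennreal K \<le> g z"
      using K by (intro divide_le_posI_ennreal) (auto simp: mult.commute)
  qed
  then have "ennreal K * (X / ennreal K) \<le> ennreal K * (INF z\<in>S. g z)"
    by (rule mult_left_mono) simp
  moreover have "ennreal K * (X / ennreal K) = X"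
    using K by (subst mult.commute) (simp add: ennreal_divide_times ennreal_mult_divide_eq)
  ultimately show ?thesis by simp
qed

locale spherical_recovery =
  fixes C s :: real and m :: nat and x :: "nat \<times> int \<Rightarrow> complex"
  assumes bo: "bounded_orthonormal nu Ztilde idx (weight C)" and C: "1 < C" and s: "1 \<le> s"
    and x_finite: "wl1_norm (weight C) x < \<infinity>"
begin

sublocale bounded_orthonormal nu Ztilde idx "weight C" by (rule bo)

abbreviation "L \<equiv> Lambda0 s"
abbreviation "w \<equiv> weight C"

text \<open>The tail norm as a real number; \<open>wl1_tail\<close> identifies it with the extended
  one of the theorem.\<close>

definition \<eta> :: real where "\<eta> = (\<Sum>\<^sub>\<infinity>i\<in>idx - L. w i * cmod (x i))"

definition r :: "real \<times> real \<Rightarrow> complex" where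
  "r p = (\<Sum>\<^sub>\<infinity>i\<in>idx - L. x i * Ztilde i p)"

text \<open>After square roots the coefficient 1 / (16 * s) becomes the 1 / (4 * sqrt s) that
  \<open>weighted_l1_recovery\<close> asks for.\<close>

definition isometric :: "(nat \<Rightarrow> real \<times> real) \<Rightarrow> bool" where
  "isometric t \<longleftrightarrow> (\<forall>v. (\<Sum>i\<in>L. (cmod (v i))\<^sup>2)
       \<le> 256 / 3 * ((\<Sum>j\<in>{1..m}. (cmod (\<Sum>i\<in>L. v i * Ztilde i (t j)))\<^sup>2) / real m)
         + 1 / (16 * s) * (\<Sum>i\<in>L. w i * cmod (v i))\<^sup>2)"

text \<open>All that the deterministic part demands of a sample: the expansion is valid at its
  points, the true coefficients are feasible, and from s = C^2 on, the lower isometry holds.\<close>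

definition good :: "(nat \<Rightarrow> real \<times> real) \<Rightarrow> bool" where
  "good t \<longleftrightarrow> (\<forall>j\<in>{1..m}. t j \<in> sph_dom) \<and> (\<Sum>j\<in>{1..m}. (cmod (r (t j)))\<^sup>2) \<le> real m * \<eta>\<^sup>2 / s \<and>
     (C\<^sup>2 \<le> s \<longrightarrow> 0 < m \<and> isometric t)"

lemma finL: "finite L" by (rule finite_Lambda0)

lemma L_sub: "L \<subseteq> idx" by (rule Lambda0_subset)

lemma x_summable: "(\<lambda>i. w i * cmod (x i)) summable_on idx"
  using x_finite unfolding wl1_norm_def
  by (rule summable_on_if_infsum_ennreal_finite) (rule weighted_nonneg)

lemma x_summable': "B \<subseteq> idx \<Longrightarrow> (\<lambda>i. w i * cmod (x i)) summable_on B"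
  using x_summable by (rule summable_on_subset)

lemma eta_nonneg: "0 \<le> \<eta>"
  unfolding \<eta>_def by (intro infsum_nonneg weighted_nonneg) auto

lemma weight_ge: "C \<le> w i"
proof -
  have "1 \<le> max 1 (real (fst i)) powr (1/6)" by (rule ge_one_powr_ge_zero) auto
  then show ?thesis using C mult_left_mono[of 1 "max 1 (real (fst i)) powr (1/6)" C]
    by (cases i) (simp add: weight_def)
qed

text \<open>The cutoff degree s^3 is made for this: its sixth root is sqrt s. The bound gives both
  the small mean square of the tail and the exclusion of high degrees from sparse supports.\<close>

lemma weight_outside:
  assumes "i \<in> idx - L"
  shows "C * sqrt s \<le> w i"
proof -
  obtain l k where i: "i = (l, k)" by (cases i)
  have l: "s ^ 3 < real l" using assms by (auto simp: i idx_def Lambda0_def)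
  have "sqrt s = s powr (3 * (1/6))" using s by (simp add: powr_half_sqrt)
  also have "\<dots> = (s powr 3) powr (1/6)" by (rule powr_powr[symmetric])
  also have "\<dots> = (s ^ 3) powr (1/6)" using s powr_realpow[of s 3] by simp
  also have "\<dots> \<le> max 1 (real l) powr (1/6)" using l s by (intro powr_mono2) auto
  finally show ?thesis using C by (simp add: i weight_def)
qed

lemma wl1_tail: "wl1_norm w (\<lambda>i. x i - trunc L x i) = ennreal \<eta>"
proof -
  have "wl1_norm w (\<lambda>i. x i - trunc L x i) = (\<Sum>\<^sub>\<infinity>i\<in>idx - L. ennreal (w i * cmod (x i)))"
    unfolding wl1_norm_def by (rule infsum_cong_neutral) (auto simp: trunc_def)
  also have "\<dots> = ennreal \<eta>"
    unfolding \<eta>_def by (intro infsum_ennreal x_summable' weighted_nonneg) auto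
  finally show ?thesis .
qed

lemma expansion_eq:
  assumes "p \<in> sph_dom"
  shows "expansion x p = partial_expansion L x p + r p"
  unfolding expansion_def partial_expansion_def r_def
  by (rule expansion_split[OF x_summable order_refl]) (use assms finL L_sub in auto)

lemma r_bound: "p \<in> sph_dom \<Longrightarrow> cmod (r p) \<le> \<eta>"
  unfolding r_def \<eta>_def by (rule expansion_bound) (auto intro: x_summable')

lemma r_measurable [measurable]: "r \<in> borel_measurable nu"
  unfolding r_def by (rule expansion_measurable) (auto intro: x_summable')

lemma feasible_iff:
  "feasible s m (ennreal \<eta>) t y u \<longleftrightarrow> (\<forall>i. i \<notin> L \<longrightarrow> u i = 0) \<and>
     (\<Sum>j=1..m. (cmod (partial_expansion L u (t j) - y j))\<^sup>2) \<le> real m * \<eta>\<^sup>2 / s"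
proof -
  have "of_nat m * (ennreal \<eta>)\<^sup>2 / ennreal s = ennreal (real m * \<eta>\<^sup>2 / s)"
    using s eta_nonneg
    by (simp add: ennreal_of_nat_eq_real_of_nat ennreal_power divide_ennreal flip: ennreal_mult)
  then show ?thesis using s by (simp add: feasible_def)
qed

lemma truth_feasible:
  assumes "good t"
  shows "feasible s m (ennreal \<eta>) t (\<lambda>j. expansion x (t j)) (trunc L x)"
proof -
  have "partial_expansion L (trunc L x) p = partial_expansion L x p" for p
    unfolding partial_expansion_def by (rule sum.cong) (auto simp: trunc_def)
  then have "(\<Sum>j=1..m. (cmod (partial_expansion L (trunc L x) (t j) - expansion x (t j)))\<^sup>2)
      = (\<Sum>j\<in>{1..m}. (cmod (r (t j)))\<^sup>2)"
    using assms by (intro sum.cong) (auto simp: good_def expansion_eq)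
  then show ?thesis using assms unfolding feasible_iff by (simp add: good_def trunc_def)
qed

lemma solution_exists:
  assumes "good t"
  shows "\<exists>u. is_solution w s m (ennreal \<eta>) t (\<lambda>j. expansion x (t j)) u"
proof -
  let ?F = "{u. feasible s m (ennreal \<eta>) t (\<lambda>j. expansion x (t j)) u}"
  have coord: "continuous_on UNIV (\<lambda>u :: nat \<times> int \<Rightarrow> complex. u i)" for i
    by (rule continuous_on_product_coordinates)
  have "closed ?F"
    unfolding feasible_iff partial_expansion_def
    by (intro closed_Collect_conj closed_Collect_all closed_Collect_imp open_Collect_const
        closed_Collect_eq closed_Collect_le continuous_intros coord)
  then have "\<exists>u\<in>?F. \<forall>v\<in>?F. (\<Sum>i\<in>L. w i * cmod (u i)) \<le> (\<Sum>i\<in>L. w i * cmod (v i))"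
    using truth_feasible[OF assms] L_sub
    by (intro finite_support_minimizer[OF finL] w_pos) (auto simp: feasible_iff)
  then show ?thesis unfolding is_solution_def is_arg_min_def by (auto simp: not_less)
qed

text \<open>An index outside L would alone contribute C^2 s > s to the squared weights, and any
  index contributes at least C^2, so none fits when s < C^2. On the complement of S the competitor
  is 0, so it pays the full weighted mass of x there.\<close>

lemma sparse_support:
  assumes z: "wl0_norm w z \<le> ennreal s"
  defines "S \<equiv> {i \<in> idx. z i \<noteq> 0}"
  shows "S \<subseteq> L" and "(\<Sum>i\<in>S. (w i)\<^sup>2) \<le> s" and "s < C\<^sup>2 \<Longrightarrow> S = {}"
    and "ennreal (\<Sum>\<^sub>\<infinity>i\<in>idx - S. w i * cmod (x i)) \<le> wl1_norm w (\<lambda>i. x i - z i)"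
proof -
  have wC: "C\<^sup>2 \<le> (w i)\<^sup>2" for i using weight_ge[of i] C by (intro power_mono) auto
  have C2: "1 \<le> C\<^sup>2" using C by simp
  have fS: "finite S"
  proof (rule ccontr)
    assume "\<not> ?thesis"
    then have "(\<Sum>\<^sub>\<infinity>i\<in>S. ennreal ((w i)\<^sup>2)) = \<infinity>"
      using order_trans[OF C2 wC] by (intro infsum_superconst_infinite_ennreal[where b = 1]) (auto simp: ennreal_ge_1)
    then show False using z by (simp add: wl0_norm_def S_def[symmetric] top_unique)
  qed
  then have "ennreal (\<Sum>i\<in>S. (w i)\<^sup>2) \<le> ennreal s"
    using z by (simp add: wl0_norm_def S_def[symmetric])
  then show le: "(\<Sum>i\<in>S. (w i)\<^sup>2) \<le> s" using s by simp
  have each: "(w i)\<^sup>2 \<le> s" if "i \<in> S" for i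
    using member_le_sum[OF that, of "\<lambda>i. (w i)\<^sup>2"] fS le by simp
  show "S \<subseteq> L"
  proof
    fix i assume i: "i \<in> S"
    show "i \<in> L"
    proof (rule ccontr)
      assume "i \<notin> L"
      then have "C * sqrt s \<le> w i" using i by (intro weight_outside) (auto simp: S_def)
      then have "(C * sqrt s)\<^sup>2 \<le> (w i)\<^sup>2" using C s by (intro power_mono) auto
      then have "C\<^sup>2 * s \<le> (w i)\<^sup>2" using s by (simp add: power_mult_distrib)
      moreover have "1 * s < C\<^sup>2 * s" using C s by (intro mult_strict_right_mono) (auto simp: one_less_power)
      ultimately show False using each[OF i] by linarith
    qed
  qed
  show "S = {}" if "s < C\<^sup>2"
    using each wC that by (metis ex_in_conv leD order_trans)
  have "ennreal (\<Sum>\<^sub>\<infinity>i\<in>idx - S. w i * cmod (x i)) = (\<Sum>\<^sub>\<infinity>i\<in>idx - S. ennreal (w i * cmod (x i)))"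
    by (intro infsum_ennreal[symmetric] x_summable' weighted_nonneg) auto
  also have "\<dots> \<le> wl1_norm w (\<lambda>i. x i - z i)"
    unfolding wl1_norm_def
    by (intro infsum_mono_neutral nonneg_summable_on_complete) (auto simp: S_def)
  finally show "ennreal (\<Sum>\<^sub>\<infinity>i\<in>idx - S. w i * cmod (x i)) \<le> wl1_norm w (\<lambda>i. x i - z i)" .
qed

section \<open>Error of a minimizer for a good sample\<close>

context
  fixes t and u :: "nat \<times> int \<Rightarrow> complex"
  assumes good: "good t" and sol: "is_solution w s m (ennreal \<eta>) t (\<lambda>j. expansion x (t j)) u"
begin

definition err1 :: real where "err1 = (\<Sum>i\<in>L. w i * cmod (u i - x i))"
definition err2 :: real where "err2 = sqrt (\<Sum>i\<in>L. (cmod (u i - x i))\<^sup>2)"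

lemma u_zero: "i \<notin> L \<Longrightarrow> u i = 0"
  using sol unfolding is_solution_def is_arg_min_def feasible_iff by blast

lemma u_minimal: "(\<Sum>i\<in>L. w i * cmod (u i)) \<le> (\<Sum>i\<in>L. w i * cmod (x i))"
proof -
  have "(\<Sum>i\<in>L. w i * cmod (trunc L x i)) = (\<Sum>i\<in>L. w i * cmod (x i))"
    by (rule sum.cong) (auto simp: trunc_def)
  then show ?thesis
    using sol truth_feasible[OF good] unfolding is_solution_def is_arg_min_def by (metis not_le)
qed

text \<open>Replaces the isometry when s < C^2: then C exceeds sqrt s, and division by C is already
  the desired rate.\<close>

lemma err2_le_err1: "err2 \<le> err1 / C"
proof -
  have "err2 \<le> (\<Sum>i\<in>L. cmod (u i - x i))"
    unfolding err2_def using finL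
    by (intro real_le_lsqrt sum_nonneg sum_squares_le_square_sum) auto
  also have "\<dots> \<le> (\<Sum>i\<in>L. w i * cmod (u i - x i) / C)"
  proof (rule sum_mono)
    fix i
    have "C * cmod (u i - x i) \<le> w i * cmod (u i - x i)"
      using weight_ge by (intro mult_right_mono) auto
    then show "cmod (u i - x i) \<le> w i * cmod (u i - x i) / C"
      using C by (simp add: field_simps)
  qed
  finally show ?thesis by (simp add: err1_def sum_divide_distrib)
qed

text \<open>At the sample points the error is the residual of the minimizer plus the tail
  \<open>r\<close>. Both have squared sum at most m \<eta>^2 / s, so together at most four times
  that, and 4 * 256/3 <= 361 = 19^2.\<close>

lemma lower_isometry_error:
  assumes "C\<^sup>2 \<le> s"
  shows "err2 \<le> 19 * \<eta> / sqrt s + err1 / (4 * sqrt s)"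
proof -
  let ?v = "\<lambda>i. u i - x i"
  have m: "0 < m" using good assms by (simp add: good_def)
  have "isometric t" using good assms by (simp add: good_def)
  then have rip: "(\<Sum>i\<in>L. (cmod (?v i))\<^sup>2)
       \<le> 256 / 3 * ((\<Sum>j\<in>{1..m}. (cmod (\<Sum>i\<in>L. ?v i * Ztilde i (t j)))\<^sup>2) / real m)
         + 1 / (16 * s) * (\<Sum>i\<in>L. w i * cmod (?v i))\<^sup>2"
    unfolding isometric_def by (rule spec)
  have feas: "(\<Sum>j=1..m. (cmod (partial_expansion L u (t j) - expansion x (t j)))\<^sup>2) \<le> real m * \<eta>\<^sup>2 / s"
    using sol by (auto simp: is_solution_def is_arg_min_def feasible_iff)
  have "(\<Sum>j\<in>{1..m}. (cmod (\<Sum>i\<in>L. ?v i * Ztilde i (t j)))\<^sup>2)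
    \<le> (\<Sum>j\<in>{1..m}. 2 * (cmod (partial_expansion L u (t j) - expansion x (t j)))\<^sup>2 + 2 * (cmod (r (t j)))\<^sup>2)"
  proof (rule sum_mono)
    fix j assume "j \<in> {1..m}"
    then have "expansion x (t j) = partial_expansion L x (t j) + r (t j)"
      using good by (intro expansion_eq) (auto simp: good_def)
    then have "(\<Sum>i\<in>L. ?v i * Ztilde i (t j)) = (partial_expansion L u (t j) - expansion x (t j)) + r (t j)"
      by (simp add: partial_expansion_def left_diff_distrib sum_subtractf)
    then have "(cmod (\<Sum>i\<in>L. ?v i * Ztilde i (t j)))\<^sup>2
        \<le> (cmod (partial_expansion L u (t j) - expansion x (t j)) + cmod (r (t j)))\<^sup>2"
      by (intro power_mono) (auto intro: norm_triangle_ineq)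
    also have "\<dots> \<le> 2 * (cmod (partial_expansion L u (t j) - expansion x (t j)))\<^sup>2 + 2 * (cmod (r (t j)))\<^sup>2"
      using sum_squares_ge_zero[of "cmod (partial_expansion L u (t j) - expansion x (t j)) - cmod (r (t j))" 0]
      by (simp add: power2_eq_square algebra_simps)
    finally show "(cmod (\<Sum>i\<in>L. ?v i * Ztilde i (t j)))\<^sup>2
        \<le> 2 * (cmod (partial_expansion L u (t j) - expansion x (t j)))\<^sup>2 + 2 * (cmod (r (t j)))\<^sup>2" .
  qed
  also have "\<dots> \<le> 4 * (real m * \<eta>\<^sup>2 / s)"
  proof -
    have "(\<Sum>j=1..m. (cmod (r (t j)))\<^sup>2) \<le> real m * \<eta>\<^sup>2 / s" using good by (simp add: good_def)
    moreover have "2 * a + 2 * c \<le> 4 * b" if "a \<le> b" "c \<le> b" for a b c :: real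
      using that by linarith
    ultimately show ?thesis using feas unfolding sum.distrib sum_distrib_left[symmetric] by blast
  qed
  finally have "(\<Sum>j\<in>{1..m}. (cmod (\<Sum>i\<in>L. ?v i * Ztilde i (t j)))\<^sup>2) / real m \<le> 4 * (real m * \<eta>\<^sup>2 / s) / real m"
    by (rule divide_right_mono) simp
  also have "\<dots> = 4 * (\<eta>\<^sup>2 / s)" using m by simp
  finally have "(\<Sum>i\<in>L. (cmod (?v i))\<^sup>2) \<le> 256 / 3 * (4 * (\<eta>\<^sup>2 / s)) + 1 / (16 * s) * err1\<^sup>2"
    using rip by (simp add: err1_def)
  also have "\<dots> \<le> (19 * \<eta> / sqrt s + err1 / (4 * sqrt s))\<^sup>2"
  proof -
    have e1: "0 \<le> err1" unfolding err1_def using L_sub by (intro sum_nonneg weighted_nonneg) auto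
    have "(19 * \<eta> / sqrt s + err1 / (4 * sqrt s))\<^sup>2 = (19 * \<eta> / sqrt s)\<^sup>2 + (err1 / (4 * sqrt s))\<^sup>2
        + 2 * (19 * \<eta> / sqrt s) * (err1 / (4 * sqrt s))" by (rule power2_sum)
    moreover have "0 \<le> 2 * (19 * \<eta> / sqrt s) * (err1 / (4 * sqrt s))" using e1 eta_nonneg s by simp
    moreover have "(19 * \<eta> / sqrt s)\<^sup>2 = 361 * (\<eta>\<^sup>2 / s)" "(err1 / (4 * sqrt s))\<^sup>2 = 1 / (16 * s) * err1\<^sup>2"
      using s by (simp_all add: power_divide power_mult_distrib)
    moreover have "0 \<le> \<eta>\<^sup>2 / s" using s by simp
    ultimately show ?thesis by linarith
  qed
  finally have "err2 \<le> \<bar>19 * \<eta> / sqrt s + err1 / (4 * sqrt s)\<bar>"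
    unfolding err2_def by (metis real_sqrt_abs real_sqrt_le_iff)
  moreover have "0 \<le> 19 * \<eta> / sqrt s + err1 / (4 * sqrt s)"
    using eta_nonneg s L_sub unfolding err1_def
    by (intro add_nonneg_nonneg divide_nonneg_nonneg sum_nonneg weighted_nonneg) auto
  ultimately show ?thesis by simp
qed

text \<open>The mass of x off S is \<tau> on L plus \<eta> outside. For C^2 <= s,
  \<open>weighted_l1_recovery\<close> applies with b = 19 \<eta>. For smaller s the set S is empty,
  \<tau> is the whole weighted norm of x on L, and minimality with the triangle inequality
  suffices.\<close>

lemma coefficient_error:
  assumes z: "wl0_norm w z \<le> ennreal s"
  defines "S \<equiv> {i \<in> idx. z i \<noteq> 0}"
  defines "\<sigma> \<equiv> (\<Sum>\<^sub>\<infinity>i\<in>idx - S. w i * cmod (x i))"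
  shows "err1 + \<eta> \<le> 77 * \<sigma>" and "err2 \<le> 38 * \<sigma> / sqrt s" and "\<eta> \<le> \<sigma>"
proof -
  note S = sparse_support[OF z, folded S_def]
  define \<tau> where "\<tau> = (\<Sum>i\<in>L - S. w i * cmod (x i))"
  have tau0: "0 \<le> \<tau>" unfolding \<tau>_def using L_sub by (intro sum_nonneg weighted_nonneg) auto
  have sig: "\<sigma> = \<tau> + \<eta>"
  proof -
    have "\<sigma> = infsum (\<lambda>i. w i * cmod (x i)) ((L - S) \<union> (idx - L))"
      unfolding \<sigma>_def using S(1) L_sub by (intro arg_cong[where f = "infsum _"]) auto
    also have "\<dots> = infsum (\<lambda>i. w i * cmod (x i)) (L - S) + \<eta>"
      unfolding \<eta>_def using finL L_sub by (intro infsum_Un_disjoint x_summable') auto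
    finally show ?thesis using finL by (simp add: \<tau>_def)
  qed
  show "\<eta> \<le> \<sigma>" using sig tau0 by simp
  have "err1 \<le> 76 * \<eta> + 4 * \<tau> \<and> err2 \<le> (38 * \<eta> + 2 * \<tau>) / sqrt s"
  proof (cases "C\<^sup>2 \<le> s")
    case True
    have "sqrt (\<Sum>i\<in>L. (cmod (u i - x i))\<^sup>2) \<le> (19 * \<eta>) / sqrt s + (\<Sum>i\<in>L. w i * cmod (u i - x i)) / (4 * sqrt s)"
      using lower_isometry_error[OF True] by (simp add: err1_def err2_def)
    moreover have "0 \<le> w i" if "i \<in> L" for i using weight_ge[of i] C by simp
    moreover have "0 < s" using s by simp
    ultimately have "err1 \<le> 4 * (19 * \<eta>) + 4 * \<tau>" "err2 \<le> (2 * (19 * \<eta>) + \<tau>) / sqrt s"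
      unfolding err1_def err2_def \<tau>_def
      using weighted_l1_recovery[OF finL S(1) _ _ S(2) u_minimal] by blast+
    moreover have "(2 * (19 * \<eta>) + \<tau>) / sqrt s \<le> (38 * \<eta> + 2 * \<tau>) / sqrt s"
      using tau0 s by (intro divide_right_mono) auto
    ultimately show ?thesis by simp
  next
    case False
    then have "S = {}" using S(3) by simp
    have "err1 \<le> (\<Sum>i\<in>L. w i * cmod (u i) + w i * cmod (x i))"
      unfolding err1_def
    proof (rule sum_mono)
      fix i assume "i \<in> L"
      then have "w i * cmod (u i - x i) \<le> w i * (cmod (u i) + cmod (x i))"
        using L_sub w_pos[of i] by (intro mult_left_mono norm_triangle_ineq4) auto
      then show "w i * cmod (u i - x i) \<le> w i * cmod (u i) + w i * cmod (x i)"
        by (simp add: distrib_left)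
    qed
    also have "\<dots> \<le> 2 * \<tau>"
      using u_minimal \<open>S = {}\<close> by (simp add: sum.distrib \<tau>_def)
    finally have e1: "err1 \<le> 2 * \<tau>" .
    have "sqrt s \<le> C" using False C by (intro real_le_lsqrt) auto
    have "err2 \<le> err1 / C" by (rule err2_le_err1)
    also have "\<dots> \<le> 2 * \<tau> / C" using e1 C by (intro divide_right_mono) auto
    also have "\<dots> \<le> 2 * \<tau> / sqrt s"
      using \<open>sqrt s \<le> C\<close> tau0 s C by (intro divide_left_mono) auto
    also have "\<dots> \<le> (38 * \<eta> + 2 * \<tau>) / sqrt s"
      using eta_nonneg s by (intro divide_right_mono) auto
    finally show ?thesis using e1 eta_nonneg tau0 by simp
  qed
  then have e: "err1 \<le> 76 * \<eta> + 4 * \<tau>" "err2 \<le> (38 * \<eta> + 2 * \<tau>) / sqrt s" by auto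
  show "err1 + \<eta> \<le> 77 * \<sigma>" using e(1) tau0 unfolding sig by simp
  have "(38 * \<eta> + 2 * \<tau>) / sqrt s \<le> 38 * \<sigma> / sqrt s"
    using tau0 s unfolding sig by (intro divide_right_mono) auto
  then show "err2 \<le> 38 * \<sigma> / sqrt s" using e(2) by simp
qed

lemma wl1_error: "wl1_norm w (\<lambda>i. x i - u i) = ennreal (err1 + \<eta>)"
proof -
  let ?h = "\<lambda>i. w i * cmod (x i - u i)"
  have eqB: "?h i = w i * cmod (x i)" if "i \<in> idx - L" for i using that u_zero[of i] by auto
  have sB: "?h summable_on (idx - L)"
    using x_summable'[of "idx - L"] summable_on_cong[of "idx - L" ?h, OF eqB] by auto
  have sL: "?h summable_on L" using finL by simp
  have un: "L \<union> (idx - L) = idx" using L_sub by auto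
  have "?h summable_on idx"
    using summable_on_Un_disjoint[OF sL sB] unfolding un by auto
  then have "wl1_norm w (\<lambda>i. x i - u i) = ennreal (infsum ?h idx)"
    unfolding wl1_norm_def by (rule infsum_ennreal) (rule weighted_nonneg)
  also have "infsum ?h idx = infsum ?h L + infsum ?h (idx - L)"
    using infsum_Un_disjoint[OF sL sB] unfolding un by auto
  also have "infsum ?h (idx - L) = \<eta>" unfolding \<eta>_def by (rule infsum_cong[OF eqB])
  also have "infsum ?h L = err1" using finL by (simp add: err1_def norm_minus_commute)
  finally show ?thesis .
qed

definition d :: "real \<times> real \<Rightarrow> complex" where
  "d p = expansion x p - partial_expansion L u p"

lemma d_eq:
  assumes "p \<in> sph_dom"
  shows "d p = r p - (\<Sum>i\<in>L. (u i - x i) * Ztilde i p)"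
  unfolding d_def expansion_eq[OF assms] partial_expansion_def
  by (simp add: left_diff_distrib sum_subtractf)

lemma sup_error: "sup_norm d \<le> ennreal (err1 + \<eta>)"
  unfolding sup_norm_def
proof (rule SUP_least)
  fix p assume p: "p \<in> sph_dom"
  have "cmod (\<Sum>i\<in>L. (u i - x i) * Ztilde i p) \<le> err1"
    unfolding err1_def using p L_sub by (intro sum_norm_le term_bound) auto
  then have "cmod (d p) \<le> err1 + \<eta>"
    unfolding d_eq[OF p] using r_bound[OF p] norm_triangle_ineq4[of "r p"] by (smt (verit))
  then show "ennreal (cmod (d p)) \<le> ennreal (err1 + \<eta>)" by (rule ennreal_leI)
qed

text \<open>The uniform bound \<eta> on the tail would lose the factor 1 / sqrt s; it comes from the
  mean square, through the large weights outside L.\<close>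

lemma L2_error: "L2_norm d \<le> ennreal (sqrt (2 * (\<eta> / sqrt s)\<^sup>2 + 2 * err2\<^sup>2))"
proof -
  define g where "g = (\<lambda>p. \<Sum>i\<in>L. (u i - x i) * Ztilde i p)"
  have gI: "integrable nu (\<lambda>p. (cmod (g p))\<^sup>2)" "(LINT p|nu. (cmod (g p))\<^sup>2) = err2\<^sup>2"
    unfolding g_def using parseval[OF finL L_sub, of "\<lambda>i. u i - x i"]
    by (simp_all add: err2_def sum_nonneg)
  have rI: "integrable nu (\<lambda>p. (cmod (r p))\<^sup>2)"
    by (rule integrable_const_bound[where B = "\<eta>\<^sup>2"])
       (use r_bound in \<open>auto intro!: AE_I2 power_mono\<close>)
  have r2: "(LINT p|nu. (cmod (r p))\<^sup>2) \<le> (\<eta> / sqrt s)\<^sup>2"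
  proof -
    have "(LINT p|nu. (cmod (r p))\<^sup>2) \<le> (\<Sum>\<^sub>\<infinity>i\<in>idx - L. cmod (x i))\<^sup>2"
      unfolding r_def by (rule expansion_L2_bound) (auto intro: x_summable')
    also have "\<dots> \<le> (\<eta> / (C * sqrt s))\<^sup>2"
      unfolding \<eta>_def using C s weight_outside
      by (intro power_mono infsum_nonneg residual_event(1)[where I = "{}"] x_summable') auto
    also have "\<dots> \<le> (\<eta> / sqrt s)\<^sup>2"
      using C s eta_nonneg by (intro power_mono divide_left_mono) auto
    finally show ?thesis .
  qed
  have le: "(cmod (d p))\<^sup>2 \<le> 2 * (cmod (r p))\<^sup>2 + 2 * (cmod (g p))\<^sup>2" if p: "p \<in> sph_dom" for p
  proof -
    have "(cmod (d p))\<^sup>2 \<le> (cmod (r p) + cmod (g p))\<^sup>2"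
      unfolding d_eq[OF p] g_def by (intro power_mono norm_triangle_ineq4) auto
    also have "\<dots> \<le> 2 * (cmod (r p))\<^sup>2 + 2 * (cmod (g p))\<^sup>2"
      using sum_squares_ge_zero[of "cmod (r p) - cmod (g p)" 0]
      by (simp add: power2_eq_square algebra_simps)
    finally show ?thesis .
  qed
  have "(\<integral>\<^sup>+p. ennreal ((cmod (d p))\<^sup>2) \<partial>nu)
      \<le> (\<integral>\<^sup>+p. ennreal (2 * (cmod (r p))\<^sup>2 + 2 * (cmod (g p))\<^sup>2) \<partial>nu)"
    using le by (intro nn_integral_mono ennreal_leI) auto
  also have "\<dots> = ennreal (LINT p|nu. 2 * (cmod (r p))\<^sup>2 + 2 * (cmod (g p))\<^sup>2)"
    using rI gI(1) by (intro nn_integral_eq_integral) auto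
  also have "(LINT p|nu. 2 * (cmod (r p))\<^sup>2 + 2 * (cmod (g p))\<^sup>2)
      = 2 * (LINT p|nu. (cmod (r p))\<^sup>2) + 2 * err2\<^sup>2"
    using rI gI by simp
  also have "ennreal \<dots> \<le> ennreal (2 * (\<eta> / sqrt s)\<^sup>2 + 2 * err2\<^sup>2)"
    using r2 by (intro ennreal_leI) auto
  finally have I: "(\<integral>\<^sup>+p. ennreal ((cmod (d p))\<^sup>2) \<partial>nu) \<le> ennreal (2 * (\<eta> / sqrt s)\<^sup>2 + 2 * err2\<^sup>2)" .
  then have fin: "(\<integral>\<^sup>+p. ennreal ((cmod (d p))\<^sup>2) \<partial>nu) < \<infinity>"
    by (rule le_less_trans) simp
  have "enn2real (\<integral>\<^sup>+p. ennreal ((cmod (d p))\<^sup>2) \<partial>nu) \<le> 2 * (\<eta> / sqrt s)\<^sup>2 + 2 * err2\<^sup>2"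
    by (rule enn2real_leI[OF _ I]) simp
  then show ?thesis
    using fin unfolding L2_norm_def Let_def by (auto intro!: ennreal_leI)
qed

lemma error_bounds:
  "sup_norm d \<le> wl1_norm w (\<lambda>i. x i - u i)"
  "wl1_norm w (\<lambda>i. x i - u i) \<le> ennreal 77 * best_approx w s x"
  "L2_norm d \<le> ennreal 60 * best_approx w s x / ennreal (sqrt s)"
proof -
  show "sup_norm d \<le> wl1_norm w (\<lambda>i. x i - u i)"
    unfolding wl1_error by (rule sup_error)
  have sig: "err1 + \<eta> \<le> 77 * \<sigma> \<and> sqrt (2 * (\<eta> / sqrt s)\<^sup>2 + 2 * err2\<^sup>2) \<le> 60 / sqrt s * \<sigma> \<and>
      0 \<le> \<sigma> \<and> ennreal \<sigma> \<le> wl1_norm w (\<lambda>i. x i - z i)"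
    if z: "wl0_norm w z \<le> ennreal s" and \<sigma>: "\<sigma> = (\<Sum>\<^sub>\<infinity>i\<in>idx - {i \<in> idx. z i \<noteq> 0}. w i * cmod (x i))" for z \<sigma>
  proof (intro conjI)
    note c = coefficient_error[OF z, folded \<sigma>]
    show "err1 + \<eta> \<le> 77 * \<sigma>" by (rule c(1))
    show s0: "0 \<le> \<sigma>" using c(3) eta_nonneg by simp
    show "ennreal \<sigma> \<le> wl1_norm w (\<lambda>i. x i - z i)"
      unfolding \<sigma> by (rule sparse_support(4)[OF z])
    have "(\<eta> / sqrt s)\<^sup>2 \<le> (\<sigma> / sqrt s)\<^sup>2"
      using c(3) eta_nonneg s by (intro power_mono divide_right_mono) auto
    moreover have "err2\<^sup>2 \<le> (38 * \<sigma> / sqrt s)\<^sup>2"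
      using c(2) by (intro power_mono) (auto simp: err2_def sum_nonneg)
    \<comment> \<open>The constant 60 is chosen so that 2 + 2 * 38^2 = 2890 stays below
      60^2.\<close>
    moreover have "(38 * \<sigma> / sqrt s)\<^sup>2 = 1444 * (\<sigma> / sqrt s)\<^sup>2" "(60 / sqrt s * \<sigma>)\<^sup>2 = 3600 * (\<sigma> / sqrt s)\<^sup>2"
      by (simp_all add: power_divide power_mult_distrib)
    moreover have "0 \<le> (\<sigma> / sqrt s)\<^sup>2" by simp
    ultimately have "2 * (\<eta> / sqrt s)\<^sup>2 + 2 * err2\<^sup>2 \<le> (60 / sqrt s * \<sigma>)\<^sup>2" by linarith
    then show "sqrt (2 * (\<eta> / sqrt s)\<^sup>2 + 2 * err2\<^sup>2) \<le> 60 / sqrt s * \<sigma>"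
      using s0 s by (intro real_le_lsqrt) auto
  qed
  have step: "ennreal a \<le> ennreal K * wl1_norm w (\<lambda>i. x i - z i)"
    if "a \<le> K * \<sigma>" "0 \<le> \<sigma>" "0 \<le> K" "ennreal \<sigma> \<le> wl1_norm w (\<lambda>i. x i - z i)" for a K \<sigma> z
  proof -
    have "ennreal a \<le> ennreal K * ennreal \<sigma>" using that by (simp add: ennreal_leI flip: ennreal_mult)
    also have "\<dots> \<le> ennreal K * wl1_norm w (\<lambda>i. x i - z i)" using that by (intro mult_left_mono) auto
    finally show ?thesis .
  qed
  show "wl1_norm w (\<lambda>i. x i - u i) \<le> ennreal 77 * best_approx w s x"
    unfolding wl1_error best_approx_def
  proof (rule ennreal_le_mult_INF)
    fix z assume "z \<in> {z. wl0_norm w z \<le> ennreal s}"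
    then have z: "wl0_norm w z \<le> ennreal s" by simp
    from sig[OF z refl] show "ennreal (err1 + \<eta>) \<le> ennreal 77 * wl1_norm w (\<lambda>i. x i - z i)"
      by (elim conjE) (rule step, auto)
  qed simp
  have "L2_norm d \<le> ennreal (60 / sqrt s) * best_approx w s x"
    unfolding best_approx_def
  proof (rule ennreal_le_mult_INF)
    fix z assume "z \<in> {z. wl0_norm w z \<le> ennreal s}"
    then have z: "wl0_norm w z \<le> ennreal s" by simp
    from sig[OF z refl] have "ennreal (sqrt (2 * (\<eta> / sqrt s)\<^sup>2 + 2 * err2\<^sup>2))
        \<le> ennreal (60 / sqrt s) * wl1_norm w (\<lambda>i. x i - z i)"
      using s by (elim conjE) (rule step, auto)
    then show "L2_norm d \<le> ennreal (60 / sqrt s) * wl1_norm w (\<lambda>i. x i - z i)"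
      using L2_error by (rule order_trans[rotated])
  qed (use s in simp)
  also have "ennreal (60 / sqrt s) = ennreal 60 / ennreal (sqrt s)"
    using s by (subst divide_ennreal) auto
  also have "\<dots> * best_approx w s x = ennreal 60 * best_approx w s x / ennreal (sqrt s)"
    by (simp add: ennreal_times_divide mult.commute)
  finally show "L2_norm d \<le> ennreal 60 * best_approx w s x / ennreal (sqrt s)" .
qed

end

text \<open>A union bound for the two failures. For m = 0 the tail condition is 0 <= 0 and never
  fails, whereas the exponential bound would be the useless value 1; hence the case distinction in
  the hypothesis.\<close>

lemma good_event:
  assumes E1: "E1 \<in> sets (PiM {1..m} (\<lambda>_. nu))"
    and iso: "C\<^sup>2 \<le> s \<Longrightarrow> 0 < m \<and> (\<forall>t\<in>E1. isometric t)"
    and prob: "measure (PiM {1..m} (\<lambda>_. nu)) (space (PiM {1..m} (\<lambda>_. nu)) - E1)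
      + (if m = 0 then 0 else exp (- (real m / s * (ln (C\<^sup>2) - 1 + 1 / C\<^sup>2)))) < \<delta>"
  shows "\<exists>E\<in>sets (PiM {1..m} (\<lambda>_. nu)). measure (PiM {1..m} (\<lambda>_. nu)) E > 1 - \<delta> \<and> (\<forall>t\<in>E. good t)"
proof -
  let ?P = "PiM {1..m} (\<lambda>_. nu)"
  interpret P: prob_space ?P by (rule prob_space_PiM) (rule prob_space_axioms)
  define R where "R = {t \<in> space ?P. real m * \<eta>\<^sup>2 / s < (\<Sum>j\<in>{1..m}. (cmod (r (t j)))\<^sup>2)}"
  have R: "R \<in> sets ?P" unfolding R_def by measurable
  have "measure ?P R \<le> (if m = 0 then 0 else exp (- (real m / s * (ln (C\<^sup>2) - 1 + 1 / C\<^sup>2))))"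
  proof (cases "m = 0")
    case True
    then have "R = {}" by (simp add: R_def)
    then show ?thesis using True by simp
  next
    case False
    have "measure ?P {t \<in> space ?P. real (card {1..m}) * (\<Sum>\<^sub>\<infinity>i\<in>idx - L. w i * cmod (x i))\<^sup>2 / s
        < (\<Sum>j\<in>{1..m}. (cmod (\<Sum>\<^sub>\<infinity>i\<in>idx - L. x i * Ztilde i (t j)))\<^sup>2)}
      \<le> exp (- (real (card {1..m}) / s * (ln (C\<^sup>2) - 1 + 1 / C\<^sup>2)))"
      by (rule residual_event(2)) (use C s weight_outside in \<open>auto intro: x_summable'\<close>)
    then show ?thesis using False by (simp add: R_def \<eta>_def r_def)
  qed
  moreover have "measure ?P (space ?P - (E1 - R)) \<le> measure ?P (space ?P - E1) + measure ?P R"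
  proof -
    have "space ?P - (E1 - R) = (space ?P - E1) \<union> R" using sets.sets_into_space[OF R] by auto
    then show ?thesis using E1 R by (simp add: measure_Un_le)
  qed
  moreover have "measure ?P (space ?P - (E1 - R)) = 1 - measure ?P (E1 - R)"
    using E1 R by (intro P.prob_compl) auto
  ultimately have "measure ?P (E1 - R) > 1 - \<delta>" using prob by linarith
  moreover have "good t" if "t \<in> E1 - R" for t
  proof -
    have t: "t \<in> space ?P" using that sets.sets_into_space[OF E1] by auto
    then have "\<forall>j\<in>{1..m}. t j \<in> sph_dom" by (auto simp: space_PiM PiE_iff)
    then show ?thesis using that t iso by (auto simp: good_def R_def not_less)
  qed
  ultimately show ?thesis using E1 R by blast
qed

end


section \<open>Probability of a good sample\<close>

lemma ln_minus_one_plus_inverse_pos: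
  fixes D :: real
  assumes "1 < D"
  shows "0 < ln D - 1 + 1 / D"
proof -
  have "ln (inverse D) \<le> inverse D - 1" using assms by (intro ln_le_minus_one) simp
  moreover have "ln (inverse D) \<noteq> inverse D - 1"
  proof
    assume "ln (inverse D) = inverse D - 1"
    then have "inverse D = 1" using assms by (intro ln_eq_minus_one) simp_all
    then show False using assms by simp
  qed
  moreover have "ln (inverse D) = - ln D" by (rule ln_inverse)
  ultimately show ?thesis by (simp add: inverse_eq_divide)
qed

text \<open>For s < C^2 only the tail can fail, and the isometry event is taken to be the whole
  space. For larger s, ln s is at least \<beta> = ln C^2 > 0, which is what
  \<open>level_sum_dominated\<close> needs.\<close>

lemma recovery_probability:
  assumes bo: "bounded_orthonormal nu Ztilde idx (weight C)" and C: "1 < C"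
  shows "\<exists>c0>0. \<forall>(s::real) (m::nat) (x :: nat \<times> int \<Rightarrow> complex).
      1 \<le> s \<longrightarrow> c0 * s * ln s ^ 4 \<le> real m \<longrightarrow> wl1_norm (weight C) x < \<infinity> \<longrightarrow>
      (\<exists>E\<in>sets (PiM {1..m} (\<lambda>_. nu)).
         measure (PiM {1..m} (\<lambda>_. nu)) E > 1 - real (card (Lambda0 s)) powr (- (ln s ^ 3)) \<and>
         (\<forall>t\<in>E. spherical_recovery.good C s m x t))"
proof -
  define \<kappa> where "\<kappa> = ln (C\<^sup>2) - 1 + 1 / C\<^sup>2"
  define \<beta> where "\<beta> = ln (C\<^sup>2)"
  have C2: "1 < C\<^sup>2" using C by (simp add: one_less_power)
  have lam: "0 < \<beta>" unfolding \<beta>_def by (rule ln_gt_zero[OF C2])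
  have kap: "0 < \<kappa>" unfolding \<kappa>_def by (rule ln_minus_one_plus_inverse_pos[OF C2])
  obtain c where c: "0 < c" "\<And>s m N. 1 \<le> s \<Longrightarrow> 1 \<le> m \<Longrightarrow> c * s * ln s ^ 4 \<le> m \<Longrightarrow> 1 \<le> N \<Longrightarrow>
      N \<le> (s ^ 3 + 1)\<^sup>2 \<Longrightarrow> exp (- (m / s * \<kappa>)) < N powr (- (ln s ^ 3))"
    using residual_failure_small[OF kap] by blast
  obtain K where K: "0 < K" "\<And>y. \<beta> \<le> y \<Longrightarrow> y ^ 3 * (6 * y + 2) + 2 \<le> K * y ^ 4"
      "\<And>y. \<beta> \<le> y \<Longrightarrow> level_sum y \<le> K * y ^ 4"
    using level_sum_dominated[OF lam] by blast
  \<comment> \<open>One summand per demand on m: the tail for s < C^2, the level errors, and the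
    tail beside the isometry.\<close>
  define c0 where "c0 = c + 768 * K + K / \<kappa>"
  have c0: "0 < c0" "c \<le> c0" "768 * K \<le> c0" "K / \<kappa> \<le> c0"
    using c(1) K(1) kap by (auto simp: c0_def add_nonneg_nonneg intro!: add_pos_nonneg)
  show ?thesis
  proof (intro exI[of _ c0] conjI c0(1) allI impI)
    fix s :: real and m :: nat and x :: "nat \<times> int \<Rightarrow> complex"
    assume s: "1 \<le> s" and m: "c0 * s * ln s ^ 4 \<le> real m" and x: "wl1_norm (weight C) x < \<infinity>"
    interpret spherical_recovery C s m x by (rule spherical_recovery.intro[OF bo C s x])
    let ?P = "PiM {1..m} (\<lambda>_. nu)"
    interpret P: prob_space ?P by (rule prob_space_PiM) (rule prob_space_axioms)
    define N where "N = real (card L)"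
    have s0: "0 \<le> s" using s by simp
    have N: "1 \<le> N" "N \<le> (s ^ 3 + 1)\<^sup>2"
      unfolding N_def using card_Lambda0_pos[OF s0] by simp (rule card_Lambda0_le[OF s0])
    have mono: "a * s * ln s ^ 4 \<le> real m" if "a \<le> c0" for a
    proof -
      have "a * s * ln s ^ 4 \<le> c0 * s * ln s ^ 4" using that s by (intro mult_right_mono) auto
      then show ?thesis using m by simp
    qed
    show "\<exists>E\<in>sets ?P. measure ?P E > 1 - real (card L) powr (- (ln s ^ 3)) \<and> (\<forall>t\<in>E. good t)"
      unfolding N_def[symmetric]
    proof (cases "C\<^sup>2 \<le> s")
      case False
      have "(if m = 0 then 0 else exp (- (real m / s * \<kappa>))) < N powr (- (ln s ^ 3))"
        using c(2)[OF s _ mono[OF c0(2)] N] N by auto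
      then show "\<exists>E\<in>sets ?P. measure ?P E > 1 - N powr (- (ln s ^ 3)) \<and> (\<forall>t\<in>E. good t)"
        using False unfolding \<kappa>_def by (intro good_event[of "space ?P"]) auto
    next
      case True
      define y where "y = ln s"
      have y: "\<beta> \<le> y" unfolding \<beta>_def y_def using True C2 s by (subst ln_le_cancel_iff) auto
      then have y0: "0 < y" using lam by simp
      have m0: "0 < real m"
      proof -
        have "0 < c0 * s * ln s ^ 4" using c0 s y0 by (simp add: y_def)
        then show ?thesis using m by simp
      qed
      have lev: "768 * s * level_sum (ln s) \<le> real m"
      proof -
        have "768 * s * level_sum y \<le> 768 * s * (K * y ^ 4)"
          using K(3)[OF y] s by (intro mult_left_mono) auto
        also have "\<dots> = (768 * K) * s * ln s ^ 4" by (simp add: y_def)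
        also have "\<dots> \<le> real m" by (rule mono[OF c0(3)])
        finally show ?thesis by (simp add: y_def)
      qed
      define g where "g = y ^ 3 * (6 * y + 2)"
      have res: "g + 2 \<le> real m / s * \<kappa>"
      proof -
        have "g + 2 \<le> K * y ^ 4" using K(2)[OF y] by (simp add: g_def)
        also have "\<dots> = (K / \<kappa> * s * ln s ^ 4) / s * \<kappa>" using kap s by (simp add: y_def)
        also have "\<dots> \<le> real m / s * \<kappa>"
          using mono[OF c0(4)] kap s by (intro mult_right_mono divide_right_mono) auto
        finally show ?thesis .
      qed
      define q where "q = nat \<lceil>y + 8\<rceil>"
      define k where "k = (\<lambda>i. nat \<lceil>4 ^ (i + 6) * (y + 13)\<rceil>)"
      define \<Gamma> where "\<Gamma> = y ^ 3 * (6 * y + 2) + ln (real (nat \<lceil>y + 8\<rceil> + 1)) + 2"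
      have k_eq: "nat \<lceil>4 ^ (i + 6) * (y + 13)\<rceil> = k i" for i by (simp add: k_def)
      note par = level_parameters[OF s N m0 lev, folded y_def, folded q_def \<Gamma>_def, unfolded k_eq]
      have L0: "L \<noteq> {}" using card_Lambda0_pos[OF s0] by (metis card.empty less_irrefl)
      have I0: "{1..m} \<noteq> {}" using m0 by auto
      have cm: "real (card {1..m}) = real m" by simp
      have cN: "real (4 * card L) = 4 * N" by (simp add: N_def)
      obtain E1 where E1: "E1 \<in> sets ?P" "measure ?P (space ?P - E1) \<le> real (q + 1) * exp (- \<Gamma>)"
        and iso: "\<forall>t\<in>E1. \<forall>v. (\<Sum>i\<in>L. (cmod (v i))\<^sup>2)
          \<le> 256 / 3 * ((\<Sum>j\<in>{1..m}. (cmod (\<Sum>i\<in>L. v i * Ztilde i (t j)))\<^sup>2) / real m)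
          + 4 * level_error k q \<Gamma> (4 * N) (real m) * (\<Sum>i\<in>L. w i * cmod (v i))\<^sup>2"
        using lower_isometry_event[where q = q and k = k, OF finL L0 L_sub finite_atLeastAtMost I0 par(2,3), unfolded cm cN]
        by (elim bexE conjE)
      have "isometric t" if "t \<in> E1" for t
        unfolding isometric_def
      proof
        fix v
        have "4 * level_error k q \<Gamma> (4 * N) (real m) * (\<Sum>i\<in>L. w i * cmod (v i))\<^sup>2
            \<le> 1 / (16 * s) * (\<Sum>i\<in>L. w i * cmod (v i))\<^sup>2"
          by (rule mult_right_mono[OF par(1)]) simp
        with iso[rule_format, OF that, of v] show "(\<Sum>i\<in>L. (cmod (v i))\<^sup>2)
          \<le> 256 / 3 * ((\<Sum>j\<in>{1..m}. (cmod (\<Sum>i\<in>L. v i * Ztilde i (t j)))\<^sup>2) / real m)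
          + 1 / (16 * s) * (\<Sum>i\<in>L. w i * cmod (v i))\<^sup>2" by linarith
      qed
      moreover have "measure ?P (space ?P - E1) + (if m = 0 then 0 else exp (- (real m / s * \<kappa>))) < N powr (- (ln s ^ 3))"
      proof -
        have "exp (- (real m / s * \<kappa>)) \<le> exp (- (g + 2))" using res by simp
        moreover have "measure ?P (space ?P - E1) \<le> exp (- (g + 2))"
          using E1(2) par(4) by (simp add: g_def)
        \<comment> \<open>Both failures cost exp (-(g + 2)); the extra 2 in the exponent makes their
          sum strictly smaller than exp (-g).\<close>
        moreover have "2 * exp (- (g + 2)) < exp (- g)"
        proof -
          have "2 < exp (2::real)" using exp_ge_add_one_self[of "2::real"] by simp
          then show ?thesis by (simp add: exp_diff exp_minus exp_add field_simps)
        qed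
        moreover have "exp (- g) \<le> N powr (- (ln s ^ 3))"
          using card_powr_lower_bound[OF s N] by (simp add: g_def y_def)
        ultimately have "measure ?P (space ?P - E1) + exp (- (real m / s * \<kappa>)) < N powr (- (ln s ^ 3))"
          by linarith
        then show ?thesis using m0 by simp
      qed
      ultimately show "\<exists>E\<in>sets ?P. measure ?P E > 1 - N powr (- (ln s ^ 3)) \<and> (\<forall>t\<in>E. good t)"
        using m0 unfolding \<kappa>_def by (intro good_event[OF E1(1)]) auto
    qed
  qed
qed

theorem corollary2p1:
  fixes C :: real
  assumes "C \<ge> 1"
    and "\<forall>l k. \<bar>k\<bar> \<le> int l \<longrightarrow>
           sup_norm (Ztilde (l, k)) \<le> ennreal (C * max 1 (real l) powr (1/6))"
  shows "\<exists>c0>0. \<exists>c1>0. \<exists>c2>0.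
    \<forall>(s::real) (m::nat) (x :: nat \<times> int \<Rightarrow> complex).
      s \<ge> 1 \<longrightarrow> real m \<ge> c0 * s * (ln s) ^ 4 \<longrightarrow> wl1_norm (weight C) x < \<infinity> \<longrightarrow>
      (let w = weight C;
           N = card (Lambda0 s);
           f = expansion x;
           \<eta> = wl1_norm w (\<lambda>i. x i - trunc (Lambda0 s) x i);
           P = PiM {1..m} (\<lambda>_. nu)
       in \<exists>E\<in>sets P. measure P E > 1 - real N powr (- ((ln s) ^ 3)) \<and>
            (\<forall>t\<in>E. (\<exists>xs. is_solution w s m \<eta> t (\<lambda>j. f (t j)) xs) \<and>
               (\<forall>xs. is_solution w s m \<eta> t (\<lambda>j. f (t j)) xs \<longrightarrow>
                 (let d = (\<lambda>p. f p - partial_expansion (Lambda0 s) xs p)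
                  in sup_norm d \<le> wl1_norm w (\<lambda>i. x i - xs i) \<and>
                     wl1_norm w (\<lambda>i. x i - xs i) \<le> ennreal c1 * best_approx w s x \<and>
                     L2_norm d \<le> ennreal c2 * best_approx w s x / ennreal (sqrt s)))))"
proof -
  have bo: "bounded_orthonormal nu Ztilde idx (weight C)"
    by (rule spherical_bounded_orthonormal[OF assms])
  have C: "1 < C" by (rule uniform_bound_gt_one[OF assms])
  obtain c0 where c0: "0 < c0" and ev: "\<And>s m x. 1 \<le> s \<Longrightarrow> c0 * s * ln s ^ 4 \<le> real m \<Longrightarrow>
      wl1_norm (weight C) x < \<infinity> \<Longrightarrow>
      \<exists>E\<in>sets (PiM {1..m} (\<lambda>_. nu)).
         measure (PiM {1..m} (\<lambda>_. nu)) E > 1 - real (card (Lambda0 s)) powr (- (ln s ^ 3)) \<and>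
         (\<forall>t\<in>E. spherical_recovery.good C s m x t)"
    using recovery_probability[OF bo C] by blast
  show ?thesis
    unfolding Let_def
  proof (rule exI[of _ c0], rule conjI[OF c0], rule exI[of _ 77], rule conjI, simp,
      rule exI[of _ 60], rule conjI, simp, intro allI impI)
    fix s :: real and m :: nat and x :: "nat \<times> int \<Rightarrow> complex"
    assume s: "1 \<le> s" and m: "c0 * s * ln s ^ 4 \<le> real m" and x: "wl1_norm (weight C) x < \<infinity>"
    interpret spherical_recovery C s m x by (rule spherical_recovery.intro[OF bo C s x])
    from ev[OF s m x] obtain E where E: "E \<in> sets (PiM {1..m} (\<lambda>_. nu))"
      "measure (PiM {1..m} (\<lambda>_. nu)) E > 1 - real (card L) powr (- (ln s ^ 3))"
      and good: "\<And>t. t \<in> E \<Longrightarrow> good t" by blast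
    show "\<exists>E\<in>sets (PiM {1..m} (\<lambda>_. nu)).
        1 - real (card L) powr (- (ln s ^ 3)) < measure (PiM {1..m} (\<lambda>_. nu)) E \<and>
        (\<forall>t\<in>E. (\<exists>xs. is_solution w s m (wl1_norm w (\<lambda>i. x i - trunc L x i)) t (\<lambda>j. expansion x (t j)) xs) \<and>
          (\<forall>xs. is_solution w s m (wl1_norm w (\<lambda>i. x i - trunc L x i)) t (\<lambda>j. expansion x (t j)) xs \<longrightarrow>
            sup_norm (\<lambda>p. expansion x p - partial_expansion L xs p) \<le> wl1_norm w (\<lambda>i. x i - xs i) \<and>
            wl1_norm w (\<lambda>i. x i - xs i) \<le> ennreal 77 * best_approx w s x \<and>
            L2_norm (\<lambda>p. expansion x p - partial_expansion L xs p)
              \<le> ennreal 60 * best_approx w s x / ennreal (sqrt s)))"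
      unfolding wl1_tail
    proof (intro bexI[OF _ E(1)] conjI E(2) ballI allI impI)
      fix t assume t: "t \<in> E"
      show "\<exists>xs. is_solution w s m (ennreal \<eta>) t (\<lambda>j. expansion x (t j)) xs"
        by (rule solution_exists[OF good[OF t]])
      fix u assume u: "is_solution w s m (ennreal \<eta>) t (\<lambda>j. expansion x (t j)) u"
      note bounds = error_bounds[OF good[OF t] u, unfolded d_def[OF good[OF t] u, abs_def]]
      show "sup_norm (\<lambda>p. expansion x p - partial_expansion L u p) \<le> wl1_norm w (\<lambda>i. x i - u i)"
        "wl1_norm w (\<lambda>i. x i - u i) \<le> ennreal 77 * best_approx w s x"
        "L2_norm (\<lambda>p. expansion x p - partial_expansion L u p)
          \<le> ennreal 60 * best_approx w s x / ennreal (sqrt s)"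
        by (rule bounds)+
    qed
  qed
qed

end
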